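(* Let $n\ge 1$ and let $\beta_1,\dots,\beta_n$ be distinct nonzero points of the open unit disc $\Delta$. Let $\Lambda=\{(f(\beta_1),\dots,f(\beta_n)) : f\in H^1,\ \|f\|_1\le 1\}\subset\mathbb{C}^n$ and $P(z)=\prod_{k=1}^n(1-\overline{\beta_k}z)^{-2}$. Let $F\in H^1$ with $\|F\|_1=1$ be such that $(F(\beta_1),\dots,F(\beta_n))$ lies in the boundary of $\Lambda$ and is an extreme point of $\Lambda$, and write $F=q^2P$, where $q$ is a polynomial of degree at most $n-1$ with no zeros in $\Delta$. Then $(F(\beta_1),\dots,F(\beta_n))$ is an exposed point of $\Lambda$ if and only if $q$ has no zeros on the unit circle $\mathbf{T}$.
   Context: $\Delta=\{z\in\mathbb{C}:|z|<1\}$ and $\mathbf{T}=\{z\in\mathbb{C}:|z|=1\}$. $H^1$ is the Hardy space of the disc $\Delta$, with norm $\|f\|_1=\int_{\mathbf{T}}|f|\,d\sigma$ (boundary values), where $\sigma$ is normalized Lebesgue measure on $\mathbf{T}$. The set $\Lambda$ is a closed convex set in $\mathbb{C}^n$ containing a neighborhood of the origin. A point $\vec P$ of a convex set $\Lambda$ is an extreme point if $\vec P=\lambda\vec P_1+(1-\lambda)\vec P_2$ with $0<\lambda<1$ and $\vec P_1,\vec P_2\in\Lambda$ implies $\vec P_1=\vec P_2$. A point $\vec P\in\Lambda$ is an exposed point if there is a tangent (supporting) real hyperplane to $\Lambda$ that intersects $\Lambda$ exactly at $\vec P$; here real hyperplanes in $\mathbb{C}^n$ are level sets of nonzero real-linear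 functionals $w\mapsto\mathrm{Re}\sum_{k=1}^n c_kw_k$ with $c_1,\dots,c_n\in\mathbb{C}$. Every extreme point of $\Lambda$ in its boundary that is given by $F\in H^1$ with $\|F\|_1=1$ has $F=q^2P$ with $q$ a polynomial of degree at most $n-1$ without zeros in $\Delta$. *)

theory Defs
  imports "HOL-Complex_Analysis.Complex_Analysis"
begin

definition circle_mean :: "(complex \<Rightarrow> real) \<Rightarrow> real" where
  "circle_mean g = (LINT t:{0..2 * pi}|lebesgue. g (cis t)) / (2 * pi)"

text \<open>Elements of the Hardy space are represented by functions on the whole plane; only their
  values in the open unit disc matter here and in all definitions below.\<close>

definition hardy1 :: "(complex \<Rightarrow> complex) set" where
  "hardy1 = {f. f holomorphic_on ball 0 1 \<and>
     bdd_above ((\<lambda>r. circle_mean (\<lambda>\<zeta>. norm (f (of_real r * \<zeta>)))) ` {0..<1})}"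

text \<open>Boundary values are radial limits. For functions in the Hardy space the limit exists at
  almost every point of the circle and the boundary function is integrable; the unspecified value
  at the remaining points does not affect the norm.\<close>

definition boundary_value :: "(complex \<Rightarrow> complex) \<Rightarrow> complex \<Rightarrow> complex" where
  "boundary_value f \<zeta> = Lim (at_left 1) (\<lambda>r. f (of_real r * \<zeta>))"

definition hardy1_norm :: "(complex \<Rightarrow> complex) \<Rightarrow> real" where
  "hardy1_norm f = circle_mean (\<lambda>\<zeta>. norm (boundary_value f \<zeta>))"

definition eval_at :: "complex ^ 'n \<Rightarrow> (complex \<Rightarrow> complex) \<Rightarrow> complex ^ 'n" where
  "eval_at \<beta> f = (\<chi> k. f (\<beta> $ k))"

definition value_body :: "complex ^ 'n \<Rightarrow> (complex ^ 'n) set" where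
  "value_body \<beta> = {eval_at \<beta> f | f. f \<in> hardy1 \<and> hardy1_norm f \<le> 1}"

definition kernel_P :: "complex ^ 'n \<Rightarrow> complex \<Rightarrow> complex" where
  "kernel_P \<beta> z = (\<Prod>k\<in>UNIV. 1 / (1 - cnj (\<beta> $ k) * z) ^ 2)"

text \<open>The library's \<open>exposed_face_of\<close> admits a zero normal vector, which is excluded here.\<close>

definition exposed_point_of :: "complex ^ 'n \<Rightarrow> (complex ^ 'n) set \<Rightarrow> bool"
    (infixr "exposed'_point'_of" 50) where
  "x exposed_point_of S \<longleftrightarrow>
     (\<exists>c d. c \<noteq> 0 \<and>
        S \<subseteq> {w. Re (\<Sum>k\<in>UNIV. c $ k * w $ k) \<le> d} \<and>
        S \<inter> {w. Re (\<Sum>k\<in>UNIV. c $ k * w $ k) = d} = {x})"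

end

(* A zero-free q makes cnj F / |F| a rational function on the circle, so f |-> mean (f cnj F / |F|)
   is a combination c of the evaluations at the beta_k and has norm 1. If it attains its norm at f,
   then f / F is real almost everywhere on the circle, hence constant. Conversely, if q vanishes at zeta
   on the circle, then F = |z - zeta|^2 F1 there with F1 again in the Hardy space; every functional
   attaining its norm at F also attains it at F1, and F1 has values different from those of F.

   The first half needs f(r z) -> f(z) in mean. For this f is split as a b with a, b in H^2 (no Blaschke
   products: on each circle |a|^2 and |b|^2 are only compared with |f| + 1, and Montel's theorem
   gives the limit), and radial limits in H^2 follow from a weak-type maximal inequality. *)

theory Submission
  imports Defs
begin

section \<open>Poisson means\<close>

text \<open>The obstacle is that \<open>hardy1_norm\<close> is built from pointwise radial limits,
  while Cauchy's formula is available on circles of radius below 1; almost everywhere existence and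
  convergence in mean are both needed to connect them. In H^2 both rest on Parseval: square means
  increase with the radius, so the square mean of \<open>h w - h (\<rho> * w)\<close> is at most the
  increment of a bounded increasing function. H^1 has no such identity, hence the factorization.
  Fourier coefficients show that a real boundary function is constant: those of negative index
  vanish in H^1, and reality reflects this to positive index. The degree bound \<open>n - 1\<close>
  shapes the kernel: against \<open>n\<close> poles it leaves exactly one factor \<open>z\<close>,
  which Cauchy's formula over \<open>dt\<close> requires. The converse works with functions
  continuous up to the circle. There F1 has \<open>- \<zeta> * z\<close> in place of the factor
  \<open>(z - \<zeta>)^2\<close>, and after normalization its values cannot be those of F: every
  \<beta>_k would be a root of one quadratic whose roots have product \<open>\<zeta>^2\<close>, of
  modulus 1, although at least two distinct \<beta>_k lie in the open disc.\<close>

abbreviation circ :: "real measure" where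
  "circ \<equiv> lebesgue_on {0..2*pi}"

lemma circle_mean_alt: "circle_mean g = (\<integral>t. g (cis t) \<partial>circ) / (2 * pi)"
  by (simp add: circle_mean_def set_lebesgue_integral_def integral_restrict_space)

lemma continuous_on_cis_compose:
  assumes "continuous_on (sphere 0 1) h"
  shows "continuous_on A (\<lambda>t. h (cis t))"
  by (rule continuous_on_compose2[OF assms]) (auto intro!: continuous_intros)

lemma integrable_circ:
  fixes h :: "complex \<Rightarrow> 'b::euclidean_space"
  assumes "continuous_on (sphere 0 1) h"
  shows "integrable circ (\<lambda>t. h (cis t))"
  by (intro continuous_imp_integrable_real continuous_on_cis_compose assms)

lemma integral_circ:
  fixes h :: "complex \<Rightarrow> 'b::euclidean_space"
  assumes "continuous_on (sphere 0 1) h"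
  shows "(\<integral>t. h (cis t) \<partial>circ) = integral {0..2*pi} (\<lambda>t. h (cis t))"
  by (intro lebesgue_integral_eq_integral integrable_circ assms) auto

lemma Cauchy_circle:
  fixes f :: "complex \<Rightarrow> complex"
  assumes "continuous_on (cball 0 1) f" "f holomorphic_on ball 0 1" "norm z < 1"
  shows "((\<lambda>t. f (cis t) * cis t / (cis t - z)) has_integral (2 * pi * f z)) {0..2*pi}"
proof -
  have "((\<lambda>u. f u / (u - z)) has_contour_integral (2 * of_real pi * \<i> * f z)) (part_circlepath 0 1 0 (2*pi))"
    using Cauchy_integral_circlepath[of 0 1 f z] assms by (simp add: circlepath_def)
  then have "((\<lambda>t. f (cis t) / (cis t - z) * \<i> * cis t) has_integral (2 * of_real pi * \<i> * f z)) {0..2*pi}"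
    by (subst (asm) has_contour_integral_part_circlepath_iff) (auto simp: mult_ac)
  from has_integral_mult_right[OF this, of "-\<i>"] show ?thesis
    by (simp add: mult_ac)
qed

lemma Cauchy_circle_mean:
  fixes f :: "complex \<Rightarrow> complex"
  assumes "continuous_on (cball 0 1) f" "f holomorphic_on ball 0 1" "norm z < 1"
  shows "(\<integral>t. f (cis t) * cis t / (cis t - z) \<partial>circ) = 2 * pi * f z"
proof -
  have "continuous_on (sphere 0 1) (\<lambda>w. f w * w / (w - z))"
    using assms by (auto intro!: continuous_intros continuous_on_subset[OF assms(1)])
  from integral_circ[OF this] Cauchy_circle[OF assms] show ?thesis
    by (auto simp: integral_unique)
qed

section \<open>The Poisson kernel and its domination by symmetric interval means\<close>

text \<open>The factor \<open>1 / (2 * pi)\<close> is left out, so the integral over a period is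
  \<open>2 * pi\<close>.\<close>

definition poisson_ker :: "real \<Rightarrow> real \<Rightarrow> real" where
  "poisson_ker r s = (1 - r\<^sup>2) / (1 - 2 * r * cos s + r\<^sup>2)"

lemma poisson_denom_pos:
  fixes r :: real
  assumes "0 \<le> r" "r < 1"
  shows "1 - 2 * r * cos s + r\<^sup>2 > 0"
proof -
  have "2 * r * cos s \<le> 2 * r * 1"
    using assms by (intro mult_left_mono) auto
  moreover have "(1 - r)^2 > 0" using assms by simp
  ultimately show ?thesis by (simp add: power2_eq_square algebra_simps)
qed

lemma norm_cis_diff_sq: "(norm (1 - of_real r * cis s))\<^sup>2 = 1 - 2 * r * cos s + r\<^sup>2"
proof -
  have "(norm (1 - of_real r * cis s))\<^sup>2 = (1 - r * cos s)\<^sup>2 + (r * sin s)\<^sup>2"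
    by (simp add: cmod_power2)
  also have "\<dots> = 1 - 2 * r * cos s + r\<^sup>2 * ((sin s)\<^sup>2 + (cos s)\<^sup>2)"
    unfolding power2_eq_square by algebra
  finally show ?thesis by simp
qed

text \<open>Multiplying \<open>f\<close> by a function equal to 1 at the point of evaluation turns the Cauchy kernel
  into the Poisson kernel.\<close>

lemma poisson_integral:
  fixes f :: "complex \<Rightarrow> complex"
  assumes f: "continuous_on (cball 0 1) f" "f holomorphic_on ball 0 1" and r: "0 \<le> r" "r < 1"
  shows "((\<lambda>t. poisson_ker r t * f (cis t)) has_integral (2 * pi * f r)) {0..2*pi}"
proof -
  define g where "g w = f w * ((1 - of_real (r\<^sup>2)) / (1 - of_real r * w))" for w :: complex
  have nz: "1 - of_real r * w \<noteq> 0" if "norm w \<le> 1" for w :: complex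
  proof
    assume "1 - of_real r * w = 0"
    then have "norm (of_real r * w) = 1" by simp
    moreover have "norm (of_real r * w) \<le> r * 1"
      unfolding norm_mult using r that by (intro mult_mono) auto
    ultimately show False using r by simp
  qed
  have g: "continuous_on (cball 0 1) g" "g holomorphic_on ball 0 1"
    unfolding g_def using nz by (auto intro!: continuous_intros holomorphic_intros f)
  have gr: "g r = f r"
    using nz[of "of_real r"] r by (simp add: g_def power2_eq_square)
  \<comment> \<open>Since \<open>cnj (cis t)\<close> is the inverse of \<open>cis t\<close>, the
    Cauchy denominator is \<open>cis t\<close> times the conjugate of the denominator built into
    \<open>g\<close>; together they form a squared modulus.\<close>
  have eq: "g (cis t) * cis t / (cis t - of_real r) = poisson_ker r t * f (cis t)" for t
  proof -
    have "cis t * cnj (cis t) = 1" by (simp add: cis_cnj cis_mult)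
    then have "cis t - of_real r = cis t * cnj (1 - of_real r * cis t)"
      by (simp add: algebra_simps)
    then have "g (cis t) * cis t / (cis t - of_real r) =
      f (cis t) * (1 - of_real (r\<^sup>2)) / ((1 - of_real r * cis t) * cnj (1 - of_real r * cis t))"
      by (simp add: g_def)
    also have "(1 - of_real r * cis t) * cnj (1 - of_real r * cis t) = of_real (1 - 2 * r * cos t + r\<^sup>2)"
      unfolding norm_cis_diff_sq[symmetric] complex_norm_square by simp
    finally show ?thesis by (simp add: poisson_ker_def)
  qed
  show ?thesis using Cauchy_circle[OF g, of "of_real r"] r by (simp add: eq gr)
qed

text \<open>Folding about the midpoint \<open>c\<close>. It serves both the Poisson integral, folded
  at \<open>pi\<close>, and interval means around a boundary point, so that the two can be compared
  in the same variable.\<close>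

lemma has_integral_symmetrize:
  fixes f :: "real \<Rightarrow> 'a::banach"
  assumes "(f has_integral I) {0..2*c}" "c \<ge> 0"
  shows "((\<lambda>s. f (c + s) + f (c - s)) has_integral I) {0..c}"
proof -
  have int: "f integrable_on {0..2*c}" using assms by (auto simp: integrable_on_def)
  have 1: "(f has_integral integral {0..c} f) {0..c}" 
    using int assms by (intro integrable_integral integrable_on_subinterval[OF int]) auto
  have 2: "(f has_integral integral {c..2*c} f) {c..2*c}" 
    using int assms by (intro integrable_integral integrable_on_subinterval[OF int]) auto
  have "I = integral {0..c} f + integral {c..2*c} f"
    using has_integral_combine[OF _ _ 1 2] assms by (auto intro: has_integral_unique)
  moreover have "((\<lambda>s. f (c + s)) has_integral integral {c..2*c} f) {0..c}"
    using has_integral_shift_real_ivl[OF 2, of c] by (simp add: add.commute)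
  moreover have "((\<lambda>s. f (c - s)) has_integral integral {0..c} f) {0..c}"
  proof -
    have "((\<lambda>s. f (s + c)) has_integral integral {0..c} f) {- c..0}"
      using has_integral_shift_real_ivl[OF 1, of c] by simp
    then have "((\<lambda>s. f (-s + c)) has_integral integral {0..c} f) {0..c}"
      using has_integral_reflect_real[where f = "\<lambda>s. f (s + c)" and a = "-c" and b = 0] by simp
    then show ?thesis by (simp add: add.commute)
  qed
  ultimately show ?thesis by (simp add: has_integral_add add.commute)
qed


lemma poisson_ker_props:
  assumes "0 \<le> r" "r < 1"
  shows poisson_ker_nonneg: "poisson_ker r s \<ge> 0"
    and poisson_ker_has_derivative:
      "(poisson_ker r has_real_derivative
        (- (1 - r\<^sup>2) * (2 * r * sin s) / (1 - 2 * r * cos s + r\<^sup>2)\<^sup>2)) (at s)"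
    and poisson_ker_continuous: "continuous_on A (poisson_ker r)"
proof -
  note p = poisson_denom_pos[OF assms]
  have r2: "r\<^sup>2 \<le> 1" using assms by (simp add: power_le_one)
  show "poisson_ker r s \<ge> 0"
    unfolding poisson_ker_def using p[of s] r2 by simp
  show "(poisson_ker r has_real_derivative
        (- (1 - r\<^sup>2) * (2 * r * sin s) / (1 - 2 * r * cos s + r\<^sup>2)\<^sup>2)) (at s)"
    unfolding poisson_ker_def using p[of s]
    by (auto intro!: derivative_eq_intros simp: power2_eq_square minus_divide_left algebra_simps)
  show "continuous_on A (poisson_ker r)"
    unfolding poisson_ker_def using p by (auto intro!: continuous_intros simp: less_imp_neq[symmetric])
qed

text \<open>The Poisson kernel is decreasing on \<open>[0, \<pi>]\<close>, so Poisson means are controlled by symmetric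
  interval means. This is an integration by parts in disguise: \<open>D\<close> below is the deficit
  \<open>2 \<lambda> s - \<integral> u\<close>, and \<open>(K D)' \<le> K D'\<close>.\<close>

lemma poisson_mean_le:
  fixes u :: "real \<Rightarrow> real"
  assumes r: "0 \<le> r" "r < 1" and u: "continuous_on {0..pi} u"
    and avg: "\<And>s. s \<in> {0..pi} \<Longrightarrow> integral {0..s} u \<le> 2 * s * lam"
    and I: "((\<lambda>s. poisson_ker r s * u s) has_integral I) {0..pi}"
    and J: "(poisson_ker r has_integral J) {0..pi}"
  shows "I \<le> 2 * lam * J"
proof -
  let ?K = "poisson_ker r"
  let ?K' = "\<lambda>s. - (1 - r\<^sup>2) * (2 * r * sin s) / (1 - 2 * r * cos s + r\<^sup>2)\<^sup>2"
  define D where "D s = 2 * s * lam - integral {0..s} u" for s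
  have D': "(D has_real_derivative (2 * lam - u s)) (at s within {0..pi})" if "s \<in> {0..pi}" for s
  proof -
    have "((\<lambda>s. integral {0..s} u) has_real_derivative u s) (at s within {0..pi})"
      using integral_has_real_derivative[OF u] that by simp
    then show ?thesis unfolding D_def by (auto intro!: derivative_eq_intros)
  qed
  have \<Phi>: "((\<lambda>s. ?K s * D s) has_real_derivative (?K' s * D s + ?K s * (2 * lam - u s))) (at s within {0..pi})"
    if "s \<in> {0..pi}" for s
    using DERIV_mult[OF has_field_derivative_at_within[OF poisson_ker_has_derivative[OF r]] D'[OF that]]
    by (simp add: algebra_simps)
  have "((\<lambda>s. ?K' s * D s + ?K s * (2 * lam - u s)) has_integral (?K pi * D pi - ?K 0 * D 0)) {0..pi}"
    by (rule fundamental_theorem_of_calculus)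
      (use \<Phi> in \<open>auto simp: has_real_derivative_iff_has_vector_derivative\<close>)
  moreover have "((\<lambda>s. 2 * lam * ?K s - ?K s * u s) has_integral (2 * lam * J - I)) {0..pi}"
    by (intro has_integral_diff has_integral_mult_right I J)
  moreover have "?K' s * D s + ?K s * (2 * lam - u s) \<le> 2 * lam * ?K s - ?K s * u s" if "s \<in> {0..pi}" for s
  proof -
    have "?K' s \<le> 0"
      using r that sin_ge_zero[of s]
      by (intro divide_nonpos_nonneg mult_nonpos_nonneg mult_nonneg_nonneg) (auto simp: power_le_one)
    moreover have "D s \<ge> 0" using avg[OF that] by (simp add: D_def)
    ultimately have "?K' s * D s \<le> 0" by (rule mult_nonpos_nonneg)
    then show ?thesis by (simp add: algebra_simps)
  qed
  ultimately have "?K pi * D pi - ?K 0 * D 0 \<le> 2 * lam * J - I"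
    by (rule has_integral_le)
  \<comment> \<open>The boundary terms are harmless: \<open>D 0 = 0\<close>, and this one has the
    sign that allows it to be dropped.\<close>
  moreover have "?K pi * D pi \<ge> 0"
    using avg[of pi] poisson_ker_nonneg[OF r] by (simp add: D_def)
  ultimately show ?thesis by (simp add: D_def)
qed

text \<open>Rotation by \<theta> reduces the claim to the real point \<open>r\<close>. The kernel is
  even, so the contributions of \<open>\<theta> + s\<close> and \<open>\<theta> - s\<close> share
  one weight, which is the form in which symmetric means can enter.\<close>

lemma poisson_half_integral:
  fixes f :: "complex \<Rightarrow> complex"
  assumes f: "continuous_on (cball 0 1) f" "f holomorphic_on ball 0 1" and r: "0 \<le> r" "r < 1"
  shows "((\<lambda>s. poisson_ker r s * (f (cis (\<theta> + s)) + f (cis (\<theta> - s)))) has_integral 2 * pi * f (of_real r * cis \<theta>)) {0..pi}"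
proof -
  define g where "g w = f (w * cis \<theta>)" for w
  have g: "continuous_on (cball 0 1) g" "g holomorphic_on ball 0 1"
    unfolding g_def
    by (auto intro!: continuous_on_compose2[OF f(1)] continuous_intros holomorphic_intros
        holomorphic_on_compose_gen[OF _ f(2), unfolded o_def] simp: norm_mult)
  have "((\<lambda>t. poisson_ker r t * g (cis t)) has_integral (2 * pi * g r)) {0..2*pi}"
    by (rule poisson_integral[OF g r])
  from has_integral_symmetrize[OF this]
  have 1: "((\<lambda>s. poisson_ker r (pi+s) * g (cis (pi+s)) + poisson_ker r (pi-s) * g (cis (pi-s))) has_integral (2 * pi * g r)) {0..pi}"
    by simp
  \<comment> \<open>Folding at \<open>pi\<close> leaves the peak of the kernel at
    \<open>s = pi\<close>; replacing \<open>s\<close> by \<open>pi - s\<close> moves it to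
    0.\<close>
  have "((\<lambda>s. poisson_ker r (pi+(pi-s)) * g (cis (pi+(pi-s))) + poisson_ker r (pi-(pi-s)) * g (cis (pi-(pi-s)))) has_integral (2 * pi * g r)) {0..pi}"
  proof -
    let ?h = "\<lambda>s. poisson_ker r (pi+s) * g (cis (pi+s)) + poisson_ker r (pi-s) * g (cis (pi-s))"
    have "((\<lambda>s. ?h (s + pi)) has_integral (2 * pi * g r)) {- pi..0}"
      using has_integral_shift_real_ivl[OF 1, of pi] by simp
    then have "((\<lambda>s. ?h (-s + pi)) has_integral (2 * pi * g r)) {0..pi}"
      using has_integral_reflect_real[where f = "\<lambda>s. ?h (s + pi)" and a = "-pi" and b = 0] by simp
    then show ?thesis by (simp add: algebra_simps)
  qed
  moreover have "poisson_ker r (pi+(pi-s)) * g (cis (pi+(pi-s))) + poisson_ker r (pi-(pi-s)) * g (cis (pi-(pi-s)))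
     = poisson_ker r s * (f (cis (\<theta> + s)) + f (cis (\<theta> - s)))" for s
  proof -
    have "cis (pi + (pi - s)) = cis (2 * pi + (-s))" by (simp add: algebra_simps)
    also have "\<dots> = cis (-s)" unfolding cis_mult[symmetric] by simp
    finally have a: "g (cis (pi + (pi - s))) = f (cis (\<theta> - s))"
      by (simp add: g_def cis_mult algebra_simps)
    have b: "g (cis (pi - (pi - s))) = f (cis (\<theta> + s))"
      by (simp add: g_def cis_mult algebra_simps)
    have "cos (pi + (pi - s)) = cos s"
      using cos_2pi_minus[of s] by (simp add: algebra_simps)
    then have c: "poisson_ker r (pi + (pi - s)) = poisson_ker r s"
      by (simp add: poisson_ker_def)
    show ?thesis unfolding a b c by (simp add: algebra_simps)
  qed
  ultimately show ?thesis by (simp add: g_def)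
qed

text \<open>This is the domination of radial values by the Hardy-Littlewood maximal function:
  \<open>norm (f z)\<close> is at most the Poisson integral of the boundary modulus, and the
  decreasing kernel bounds that by interval means.\<close>

lemma norm_le_of_interval_means:
  fixes f :: "complex \<Rightarrow> complex"
  assumes f: "continuous_on (cball 0 1) f" "f holomorphic_on ball 0 1" and r: "0 \<le> r" "r < 1"
    and avg: "\<And>s. s \<in> {0<..pi} \<Longrightarrow> integral {\<theta> - s..\<theta> + s} (\<lambda>t. norm (f (cis t))) \<le> 2 * s * lam"
  shows "norm (f (of_real r * cis \<theta>)) \<le> lam"
proof -
  define u where "u s = norm (f (cis (\<theta> + s))) + norm (f (cis (\<theta> - s)))" for s
  have cf: "continuous_on (sphere 0 1) f" by (rule continuous_on_subset[OF f(1)]) auto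
  have c: "continuous_on A (\<lambda>t. f (cis t))" for A by (rule continuous_on_cis_compose[OF cf])
  have cu: "continuous_on A u" for A unfolding u_def
    by (intro continuous_intros continuous_on_compose2[OF c[of UNIV]]) auto
  have avg': "integral {0..s} u \<le> 2 * s * lam" if "s \<in> {0..pi}" for s
  proof (cases "s = 0")
    case False
    let ?n = "\<lambda>t. norm (f (cis t))"
    have "(?n has_integral integral {\<theta> - s..\<theta> + s} ?n) {\<theta> - s..\<theta> + s}"
      by (intro integrable_integral integrable_continuous_real continuous_intros c)
    from has_integral_shift_real_ivl[OF this, of "\<theta> - s"] that
    have "((\<lambda>x. ?n (x + (\<theta> - s))) has_integral integral {\<theta> - s..\<theta> + s} ?n) {0..2 * s}"
      by (simp add: algebra_simps)
    from has_integral_symmetrize[OF this] that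
    have "((\<lambda>x. ?n (s + x + (\<theta> - s)) + ?n (s - x + (\<theta> - s))) has_integral integral {\<theta> - s..\<theta> + s} ?n) {0..s}"
      by simp
    then have "(u has_integral integral {\<theta> - s..\<theta> + s} ?n) {0..s}"
      by (simp add: u_def[abs_def] add.commute)
    then show ?thesis using avg[of s] that False by (simp add: integral_unique)
  qed auto
  let ?K = "poisson_ker r"
  have "(\<lambda>s. ?K s * u s) integrable_on {0..pi}"
    by (intro integrable_continuous_real continuous_intros cu poisson_ker_continuous[OF r])
  then obtain I where I: "((\<lambda>s. ?K s * u s) has_integral I) {0..pi}" by (auto simp: integrable_on_def)
  \<comment> \<open>Representing the constant function 1 yields the mass \<open>pi\<close> of the
    kernel over a half period.\<close>
  have "((\<lambda>s. of_real (?K s) * (1 + 1)) has_integral 2 * pi * (1::complex)) {0..pi}"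
    using poisson_half_integral[OF _ _ r, of "\<lambda>_. 1"] by auto
  from has_integral_Re[OF has_integral_divide[OF this, of 2]] have J: "(?K has_integral pi) {0..pi}"
    by simp
  have "norm (2 * pi * f (of_real r * cis \<theta>)) \<le> I"
  proof -
    note h = poisson_half_integral[OF f r, of \<theta>]
    have "norm (integral {0..pi} (\<lambda>s. of_real (?K s) * (f (cis (\<theta> + s)) + f (cis (\<theta> - s))))) \<le> integral {0..pi} (\<lambda>s. ?K s * u s)"
    proof (rule integral_norm_bound_integral)
      show "norm (of_real (?K s) * (f (cis (\<theta> + s)) + f (cis (\<theta> - s)))) \<le> ?K s * u s" for s
        unfolding norm_mult norm_of_real u_def using poisson_ker_nonneg[OF r, of s]
        by (intro mult_mono norm_triangle_ineq) auto
    qed (use h I in \<open>auto simp: integrable_on_def\<close>)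
    then show ?thesis using h I by (simp add: integral_unique)
  qed
  also have "I \<le> 2 * lam * pi"
    by (rule poisson_mean_le[OF r cu avg' I J])
  finally show ?thesis by (simp add: norm_mult)
qed

section \<open>The radial maximal function\<close>

text \<open>Intervals of radius at most \<open>pi\<close> centred in one period stay within three
  periods, and this accounts for their total mass.\<close>

lemma integral_three_periods:
  fixes u :: "real \<Rightarrow> real"
  assumes c: "continuous_on UNIV u" and per: "\<And>t. u (t + 2 * pi) = u t"
  shows "integral {- (2 * pi)..4 * pi} u = 3 * integral {0..2 * pi} u"
proof -
  have i: "u integrable_on {a..b}" for a b
    by (intro integrable_continuous_real continuous_on_subset[OF c]) auto
  have "integral {- (2 * pi)..0} (\<lambda>t. u (t + 2 * pi)) = integral {0..2 * pi} u"
    using integral_shift_real_ivl[of 0 "2 * pi" "2 * pi" u] by simp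
  then have 1: "integral {- (2 * pi)..0} u = integral {0..2 * pi} u" by (simp add: per)
  have "integral {0..2 * pi} (\<lambda>t. u (t + 2 * pi)) = integral {2 * pi..4 * pi} u"
    using integral_shift_real_ivl[of "2 * pi" "2 * pi" "4 * pi" u] by simp
  then have 2: "integral {2 * pi..4 * pi} u = integral {0..2 * pi} u" by (simp add: per)
  have "integral {- (2 * pi)..4 * pi} u = integral {- (2 * pi)..0} u + integral {0..4 * pi} u"
    using Henstock_Kurzweil_Integration.integral_combine[OF _ _ i, of "- (2 * pi)" 0 "4 * pi"] by simp
  also have "integral {0..4 * pi} u = integral {0..2 * pi} u + integral {2 * pi..4 * pi} u"
    using Henstock_Kurzweil_Integration.integral_combine[OF _ _ i, of 0 "2 * pi" "4 * pi"] by simp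
  finally show ?thesis using 1 2 by simp
qed

text \<open>Each point of \<open>S\<close> is the centre of an interval on which
  \<open>norm f\<close> has mean above \<open>lam\<close>; the Vitali lemma selects disjoint ones.
  The constant 15 is 5, the enlargement in that lemma, times 3, the number of periods that the
  intervals can reach.\<close>

lemma radial_maximal_weak_type:
  fixes f :: "complex \<Rightarrow> complex"
  assumes f: "continuous_on (cball 0 1) f" "f holomorphic_on ball 0 1"
    and lam: "lam > 0" and S: "S \<in> lmeasurable" "S \<subseteq> {0..2 * pi}"
    and big: "\<And>t. t \<in> S \<Longrightarrow> \<exists>r\<in>{0..<1}. norm (f (of_real r * cis t)) > lam"
  shows "measure lebesgue S \<le> 15 / lam * (\<integral>t. norm (f (cis t)) \<partial>circ)"
proof -
  define u where "u t = norm (f (cis t))" for t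
  have cf: "continuous_on (sphere 0 1) f" by (rule continuous_on_subset[OF f(1)]) auto
  have cu: "continuous_on A u" for A
    unfolding u_def by (intro continuous_on_norm continuous_on_cis_compose cf)
  have ui: "u integrable_on {a..b}" for a b by (intro integrable_continuous_real cu)
  have u_int: "(\<integral>t. norm (f (cis t)) \<partial>circ) = integral {0..2 * pi} u"
    unfolding u_def by (rule integral_circ) (intro continuous_on_norm cf)
  have per: "u (t + 2 * pi) = u t" for t
    unfolding u_def cis_mult[symmetric] by simp
  have "\<exists>s\<in>{0<..pi}. integral {t - s..t + s} u > 2 * s * lam" if t: "t \<in> S" for t
  proof (rule ccontr)
    assume *: "\<not> ?thesis"
    obtain r where r: "0 \<le> r" "r < 1" "norm (f (of_real r * cis t)) > lam" using big[OF t] by auto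
    have "norm (f (of_real r * cis t)) \<le> lam"
      by (rule norm_le_of_interval_means[OF f r(1,2)]) (use * in \<open>force simp: u_def[abs_def]\<close>)
    with r show False by simp
  qed
  then obtain s where s: "\<And>t. t \<in> S \<Longrightarrow> s t \<in> {0<..pi}"
    "\<And>t. t \<in> S \<Longrightarrow> integral {t - s t..t + s t} u > 2 * s t * lam" by metis
  have cov: "S \<subseteq> (\<Union>i\<in>S. ball i (s i))"
    using s(1) by force
  obtain C where C: "countable C" "C \<subseteq> S" "pairwise (\<lambda>i j. disjnt (ball i (s i)) (ball j (s j))) C"
     "S \<subseteq> (\<Union>i\<in>C. ball i (5 * s i))"
    by (rule Vitali_covering_lemma_balls[OF cov, of pi]) (use s(1) in auto)
  define M where "M = 15 / lam * integral {0..2 * pi} u"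
  \<comment> \<open>\<open>M\<close> is the same for all finite subfamilies, so the estimate passes
    to the countable union.\<close>
  have bound: "measure lebesgue (\<Union>i\<in>I. ball i (5 * s i)) \<le> M" if I: "I \<subseteq> C" "finite I" for I
  proof -
    have IS: "i \<in> S" if "i \<in> I" for i using that I C by auto
    have "measure lebesgue (\<Union>i\<in>I. ball i (5 * s i)) \<le> (\<Sum>i\<in>I. measure lebesgue (ball i (5 * s i)))"
      by (intro measure_UNION_le I) auto
    also have "\<dots> \<le> (\<Sum>i\<in>I. 5 / lam * integral (ball i (s i)) u)"
    proof (rule sum_mono)
      fix i assume "i \<in> I"
      note si = s[OF IS[OF this]]
      have "measure lebesgue (ball i (5 * s i)) = 10 * s i"
        using si by (simp add: ball_eq_greaterThanLessThan)
      also have "\<dots> \<le> 5 / lam * integral {i - s i..i + s i} u"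
        using si lam by (simp add: field_simps)
      also have "integral {i - s i..i + s i} u = integral (ball i (s i)) u"
        by (simp add: ball_eq_greaterThanLessThan integral_open_interval_real)
      finally show "measure lebesgue (ball i (5 * s i)) \<le> 5 / lam * integral (ball i (s i)) u" .
    qed
    also have "\<dots> = 5 / lam * (\<Sum>i\<in>I. integral (ball i (s i)) u)" by (simp add: sum_distrib_left)
    also have "(\<Sum>i\<in>I. integral (ball i (s i)) u) \<le> 3 * integral {0..2 * pi} u"
      unfolding integral_three_periods[OF cu per, symmetric]
    proof (rule has_integral_subset_le)
      show "(u has_integral (\<Sum>i\<in>I. integral (ball i (s i)) u)) (\<Union>i\<in>I. ball i (s i))"
      proof (rule has_integral_UN)
        show "(u has_integral integral (ball i (s i)) u) (ball i (s i))" for i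
          by (intro integrable_integral)
            (simp add: ball_eq_greaterThanLessThan integrable_on_open_interval_real ui)
        show "pairwise (\<lambda>i i'. negligible (ball i (s i) \<inter> ball i' (s i'))) I"
          using pairwise_subset[OF C(3) I(1)] by (auto simp: pairwise_def disjnt_def)
      qed (rule I)
      show "(\<Union>i\<in>I. ball i (s i)) \<subseteq> {- (2 * pi)..4 * pi}"
      proof
        fix x assume "x \<in> (\<Union>i\<in>I. ball i (s i))"
        then obtain i where i: "i \<in> I" "\<bar>i - x\<bar> < s i" by (auto simp: dist_real_def)
        moreover have "0 \<le> i" "i \<le> 2 * pi" "s i \<le> pi"
          using s(1)[OF IS[OF i(1)]] IS[OF i(1)] S(2) by auto
        ultimately have "- (2 * pi) \<le> x \<and> x \<le> 4 * pi" using pi_gt_zero unfolding abs_less_iff by linarith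
        then show "x \<in> {- (2 * pi)..4 * pi}" by simp
      qed
    qed (use ui in \<open>auto simp: u_def[abs_def]\<close>)
    finally show ?thesis using lam by (simp add: M_def divide_right_mono)
  qed
  have cov_meas: "(\<Union>i\<in>C. ball i (5 * s i)) \<in> lmeasurable"
    by (rule fmeasurable_UN_bound[OF C(1) _ bound]) auto
  have "measure lebesgue S \<le> measure lebesgue (\<Union>i\<in>C. ball i (5 * s i))"
    by (rule measure_mono_fmeasurable[OF C(4)]) (use S cov_meas in auto)
  also have "\<dots> \<le> M"
    by (rule measure_UN_bound[OF C(1) _ bound]) auto
  finally show ?thesis unfolding u_int M_def .
qed


lemma continuous_on_radius:
  assumes "h holomorphic_on ball 0 1" "0 \<le> r" "r < 1"
  shows "continuous_on (cball 0 1) (\<lambda>w. h (of_real r * w))"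
    and "continuous_on (sphere 0 1) (\<lambda>w. h (of_real r * w))"
    and "(\<lambda>w. h (of_real r * w)) holomorphic_on ball 0 1"
    and "continuous_on A (\<lambda>t. h (of_real r * cis t))"
proof -
  have *: "norm (of_real r * w) < 1" if "norm w \<le> 1" for w :: complex
  proof -
    have "norm (of_real r * w) \<le> r * 1" unfolding norm_mult using assms that by (intro mult_mono) auto
    then show ?thesis using assms by simp
  qed
  note c = holomorphic_on_imp_continuous_on[OF assms(1)]
  show "continuous_on (cball 0 1) (\<lambda>w. h (of_real r * w))"
    "continuous_on (sphere 0 1) (\<lambda>w. h (of_real r * w))"
    "continuous_on A (\<lambda>t. h (of_real r * cis t))"
    by (rule continuous_on_compose2[OF c]; use * in \<open>force intro!: continuous_intros\<close>)+
  show "(\<lambda>w. h (of_real r * w)) holomorphic_on ball 0 1"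
    by (rule holomorphic_on_compose_gen[OF _ assms(1), unfolded o_def])
      (use * in \<open>auto intro!: holomorphic_intros\<close>)
qed

text \<open>Dilates by \<open>s n\<close> are continuous up to the circle. The level set for radii
  below \<open>s n\<close> is an open set cut with the closed interval, hence measurable, and a
  radius \<open>r\<close> becomes \<open>r / s n\<close> for the dilate; these sets increase to
  \<open>S\<close>.\<close>

lemma radial_maximal_weak_type_disc:
  fixes h :: "complex \<Rightarrow> complex"
  assumes h: "h holomorphic_on ball 0 1" and lam: "lam > 0"
    and E: "\<And>s. s \<in> {0<..<1} \<Longrightarrow> (\<integral>t. norm (h (of_real s * cis t)) \<partial>circ) \<le> E"
  defines "S \<equiv> {t\<in>{0..2 * pi}. \<exists>r\<in>{0..<1}. norm (h (of_real r * cis t)) > lam}"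
  shows "S \<in> lmeasurable" "measure lebesgue S \<le> 15 / lam * E"
proof -
  define s where "s n = 1 - 1 / real (n + 2)" for n
  have s: "s n > 0" "s n < 1" for n by (auto simp: s_def)
  have s_mono: "s m \<le> s n" if "m \<le> n" for m n using that by (auto simp: s_def field_simps)
  define T where "T n = {t\<in>{0..2 * pi}. \<exists>r\<in>{0..<s n}. norm (h (of_real r * cis t)) > lam}" for n
  have T: "T n \<in> lmeasurable" for n
  proof -
    have "open (\<Union>r\<in>{0..<s n}. {t. lam < norm (h (of_real r * cis t))})"
      using s(2)[of n]
      by (intro open_UN ballI open_Collect_less continuous_on_norm continuous_on_radius(4) h continuous_intros) auto
    then have "(\<Union>r\<in>{0..<s n}. {t. lam < norm (h (of_real r * cis t))}) \<inter> {0..2 * pi} \<in> lmeasurable"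
      by (subst Int_commute, intro fmeasurable_Int_fmeasurable) auto
    also have "(\<Union>r\<in>{0..<s n}. {t. lam < norm (h (of_real r * cis t))}) \<inter> {0..2 * pi} = T n"
      by (auto simp: T_def)
    finally show ?thesis .
  qed
  have mT: "measure lebesgue (T n) \<le> 15 / lam * E" for n
  proof -
    have sn: "0 \<le> s n" "s n < 1" using s[of n] by auto
    have "measure lebesgue (T n) \<le> 15 / lam * (\<integral>t. norm (h (of_real (s n) * cis t)) \<partial>circ)"
    proof (rule radial_maximal_weak_type[OF continuous_on_radius(1,3)[OF h sn] lam T])
      fix t assume "t \<in> T n"
      then obtain r where "r \<in> {0..<s n}" "norm (h (of_real r * cis t)) > lam" by (auto simp: T_def)
      then show "\<exists>r\<in>{0..<1}. lam < norm (h (of_real (s n) * (of_real r * cis t)))"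
        using s[of n] by (intro bexI[of _ "r / s n"]) auto
    qed (auto simp: T_def)
    also have "\<dots> \<le> 15 / lam * E" using E[of "s n"] s[of n] lam by (intro mult_left_mono) auto
    finally show ?thesis .
  qed
  have "T m \<subseteq> T n" if "m \<le> n" for m n
  proof -
    have "{0..<s m} \<subseteq> {0..<s n}" using s_mono[OF that] by auto
    then show ?thesis unfolding T_def by blast
  qed
  then have "incseq T" by (simp add: incseq_def)
  then have UT: "(\<Union>i\<le>n. T i) = T n" for n by (auto simp: incseq_def)
  have "S = (\<Union>n. T n)"
  proof
    show "S \<subseteq> (\<Union>n. T n)"
    proof
      fix t assume "t \<in> S"
      then obtain r where r: "t \<in> {0..2 * pi}" "0 \<le> r" "r < 1" "norm (h (of_real r * cis t)) > lam" by (auto simp: S_def)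
      obtain n where "inverse (real (Suc n)) < 1 - r" using reals_Archimedean[of "1 - r"] r(3) by auto
      moreover have "1 / real (n + 2) \<le> inverse (real (Suc n))" by (simp add: field_simps)
      ultimately have "r < s n" by (simp add: s_def)
      then have "t \<in> T n" using r unfolding T_def by (auto intro!: bexI[of _ r])
      then show "t \<in> (\<Union>n. T n)" by blast
    qed
    have "{0..<s n} \<subseteq> {0..<1}" for n using s(2)[of n] by auto
    then show "(\<Union>n. T n) \<subseteq> S" unfolding S_def T_def by blast
  qed
  moreover have UT_le: "measure lebesgue (\<Union>i\<le>n. T i) \<le> 15 / lam * E" for n
    using mT UT by simp
  ultimately show "S \<in> lmeasurable" "measure lebesgue S \<le> 15 / lam * E"
    using fmeasurable_countable_Union[of T, OF T UT_le] measure_countable_Union_le[of T, OF T UT_le] by auto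
qed

section \<open>Square means and radial limits\<close>

definition sq_mean :: "(complex \<Rightarrow> complex) \<Rightarrow> real \<Rightarrow> real" where
  "sq_mean h r = (\<integral>t. (norm (h (of_real r * cis t)))\<^sup>2 \<partial>circ)"

lemma taylor_coeff_circle:
  fixes h :: "complex \<Rightarrow> complex"
  assumes h: "h holomorphic_on ball 0 1" and r: "0 < r" "r < 1"
  shows "(\<integral>t. h (of_real r * cis t) * cis (- (real k * t)) \<partial>circ) = 2 * pi * ((deriv ^^ k) h 0 / fact k * of_real r ^ k)"
proof -
  have c: "continuous_on (cball 0 r) h"
    by (rule continuous_on_subset[OF holomorphic_on_imp_continuous_on[OF h]], rule subsetI) (use r in simp)
  have hol: "h holomorphic_on ball 0 r"
    by (rule holomorphic_on_subset[OF h]) (use r in auto)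
  have "((\<lambda>u. h u / (u - 0) ^ Suc k) has_contour_integral ((2 * pi * \<i>) / fact k * (deriv ^^ k) h 0)) (part_circlepath 0 r 0 (2 * pi))"
    using Cauchy_has_contour_integral_higher_derivative_circlepath[OF c hol, of 0 k] r
    by (simp add: circlepath_def)
  then have 1: "((\<lambda>t. h (of_real r * cis t) / (of_real r * cis t) ^ Suc k * of_real r * \<i> * cis t) has_integral ((2 * pi * \<i>) / fact k * (deriv ^^ k) h 0)) {0..2 * pi}"
    by (subst (asm) has_contour_integral_part_circlepath_iff) (auto simp: mult_ac)
  have eq: "h (of_real r * cis t) / (of_real r * cis t) ^ Suc k * of_real r * \<i> * cis t
     = (\<i> / of_real r ^ k) * (h (of_real r * cis t) * cis (- (real k * t)))" for t
  proof -
    have "cis (- (real k * t)) = inverse (cis t ^ k)"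
      by (simp add: Complex.DeMoivre cis_inverse)
    then show ?thesis using r by (simp add: field_simps power_mult_distrib)
  qed
  from 1 have "((\<lambda>t. (\<i> / of_real r ^ k) * (h (of_real r * cis t) * cis (- (real k * t)))) has_integral ((2 * pi * \<i>) / fact k * (deriv ^^ k) h 0)) {0..2 * pi}"
    unfolding eq .
  from has_integral_mult_right[OF this, of "of_real r ^ k / \<i>"] r
  have 2: "((\<lambda>t. h (of_real r * cis t) * cis (- (real k * t))) has_integral (2 * pi * ((deriv ^^ k) h 0 / fact k * of_real r ^ k))) {0..2 * pi}"
    by (simp add: field_simps)
  have "continuous_on (sphere 0 1) (\<lambda>w. h (of_real r * w) * (inverse w) ^ k)"
    using continuous_on_radius(2)[OF h, of r] r by (auto intro!: continuous_intros)
  from integral_circ[OF this] 2 show ?thesis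
    by (simp add: Complex.DeMoivre cis_inverse integral_unique)
qed

text \<open>Parseval's identity by direct computation: only one factor of \<open>h * cnj h\<close>
  is expanded, the series is integrated term by term, and each term is a Taylor coefficient times
  its conjugate.\<close>

lemma sq_mean_sums:
  assumes h: "h holomorphic_on ball 0 1" and r: "0 < r" "r < 1"
  shows "(\<lambda>k. 2 * pi * (norm ((deriv ^^ k) h 0 / fact k))\<^sup>2 * r ^ (2 * k)) sums sq_mean h r"
proof -
  define c where "c k = (deriv ^^ k) h 0 / fact k" for k
  have sums: "(\<lambda>k. c k * w ^ k) sums h w" if "norm w < 1" for w
    using holomorphic_power_series[OF h, of w] that by (simp add: c_def)
  have rt: "norm (of_real r * cis t) < 1" for t using r by (simp add: norm_mult)
  have cont: "continuous_on (sphere 0 1) (\<lambda>w. h (of_real r * w))"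
    using continuous_on_radius(2)[OF h, of r] r by simp
  define F where "F k t = c k * (of_real r * cis t) ^ k * cnj (h (of_real r * cis t))" for k t
  have F_sums: "(\<lambda>k. F k t) sums (h (of_real r * cis t) * cnj (h (of_real r * cis t)))" for t
    unfolding F_def by (intro sums_mult2 sums rt)
  have F_int: "integrable circ (F k)" for k
    unfolding F_def by (intro integrable_circ continuous_intros cont)
  have Fn: "norm (F k t) = norm (c k) * r ^ k * norm (h (of_real r * cis t))" for k t
    using r by (simp add: F_def norm_mult norm_power)
  \<comment> \<open>Absolute convergence at \<open>r\<close> follows from convergence at the larger
    radius \<open>(r + 1) / 2\<close>.\<close>
  have summ: "summable (\<lambda>k. norm (c k) * r ^ k)"
  proof -
    have "summable (\<lambda>k. c k * of_real ((r + 1) / 2) ^ k)"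
      using sums[of "of_real ((r + 1) / 2)"] r by (auto simp: sums_iff simp del: of_real_add of_real_divide)
    from powser_insidea[OF this, of "of_real r"] r show ?thesis
      by (simp add: norm_mult norm_power del: of_real_add of_real_divide)
  qed
  have "(\<lambda>k. integral\<^sup>L circ (F k)) sums (\<integral>t. (\<Sum>k. F k t) \<partial>circ)"
  proof (rule sums_integral[OF F_int])
    show "AE t in circ. summable (\<lambda>k. norm (F k t))"
      unfolding Fn using summ by (intro AE_I2 summable_mult2)
    show "summable (\<lambda>k. \<integral>t. norm (F k t) \<partial>circ)"
      unfolding Fn using summ by (simp add: summable_mult2)
  qed
  also have "(\<lambda>t. (\<Sum>k. F k t)) = (\<lambda>t. of_real ((norm (h (of_real r * cis t)))\<^sup>2))"
    unfolding complex_norm_square using F_sums by (simp add: sums_iff)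
  also have "(\<integral>t. complex_of_real ((norm (h (of_real r * cis t)))\<^sup>2) \<partial>circ) = of_real (sq_mean h r)"
    by (simp add: sq_mean_def del: of_real_power)
  also have "(\<lambda>k. integral\<^sup>L circ (F k)) = (\<lambda>k. of_real (2 * pi * (norm (c k))\<^sup>2 * r ^ (2 * k)))"
  proof
    fix k
    have eq: "F k t = c k * of_real r ^ k * cnj (h (of_real r * cis t) * cis (- (real k * t)))" for t
      by (simp add: F_def power_mult_distrib Complex.DeMoivre cis_cnj mult_ac[where 'a = complex])
    have "integral\<^sup>L circ (F k) = c k * of_real r ^ k * cnj (\<integral>t. h (of_real r * cis t) * cis (- (real k * t)) \<partial>circ)"
      unfolding eq by (simp only: integral_mult_right_zero Bochner_Integration.integral_cnj)
    also have "\<dots> = c k * of_real r ^ k * cnj (2 * pi * (c k * of_real r ^ k))"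
      unfolding taylor_coeff_circle[OF assms] c_def ..
    also have "\<dots> = 2 * pi * (c k * cnj (c k)) * of_real (r ^ (2 * k))"
      by (simp add: power_mult_distrib mult_ac power2_eq_square power_mult)
    also have "\<dots> = of_real (2 * pi * (norm (c k))\<^sup>2 * r ^ (2 * k))"
      by (simp flip: complex_norm_square)
    finally show "integral\<^sup>L circ (F k) = of_real (2 * pi * (norm (c k))\<^sup>2 * r ^ (2 * k))" .
  qed
  finally show ?thesis by (simp add: sums_of_real_iff c_def del: of_real_mult of_real_power)
qed

lemma sq_mean_mono:
  assumes h: "h holomorphic_on ball 0 1" and r: "0 < s" "s \<le> r" "r < 1"
  shows "sq_mean h s \<le> sq_mean h r"
  by (rule sums_le[OF _ sq_mean_sums[OF h] sq_mean_sums[OF h]])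
    (use r in \<open>auto intro!: mult_left_mono power_mono\<close>)

text \<open>Coefficientwise in Parseval the claim is \<open>(1 - x)^2 \<le> 1 - x^2\<close> for
  \<open>x = \<rho>^k\<close> in the unit interval. The gain is that the right side is an increment
  of a monotone function of the radius.\<close>

lemma sq_mean_dilation_diff:
  assumes h: "h holomorphic_on ball 0 1" and \<rho>: "0 < \<rho>" "\<rho> < 1" and r: "0 < r" "r < 1"
  shows "sq_mean (\<lambda>w. h w - h (of_real \<rho> * w)) r \<le> sq_mean h r - sq_mean h (\<rho> * r)"
proof (rule sums_le[OF _ sq_mean_sums sums_diff[OF sq_mean_sums sq_mean_sums]])
  have hr: "(\<lambda>w. h (of_real \<rho> * w)) holomorphic_on ball 0 1"
    using continuous_on_radius(3)[OF h, of \<rho>] \<rho> by simp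
  show "(\<lambda>w. h w - h (of_real \<rho> * w)) holomorphic_on ball 0 1"
    by (intro holomorphic_intros h hr)
  fix k
  define c where "c = (deriv ^^ k) h 0 / fact k"
  have in_ball: "of_real \<rho> * w \<in> ball 0 1" if "w \<in> ball 0 1" for w :: complex
    using mult_strict_mono[of \<rho> 1 "norm w" 1] that \<rho> by (auto simp: norm_mult)
  have "(deriv ^^ k) (\<lambda>w. h w - h (of_real \<rho> * w)) 0 = (deriv ^^ k) h 0 - of_real \<rho> ^ k * (deriv ^^ k) h 0"
    by (subst higher_deriv_diff[OF h hr]; simp?)
      (subst higher_deriv_compose_linear[OF h, of "ball 0 1"]; use in_ball in simp)
  then have "(deriv ^^ k) (\<lambda>w. h w - h (of_real \<rho> * w)) 0 / fact k = of_real (1 - \<rho> ^ k) * c"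
    by (simp add: c_def field_simps)
  then have "(norm ((deriv ^^ k) (\<lambda>w. h w - h (of_real \<rho> * w)) 0 / fact k))\<^sup>2 = (1 - \<rho> ^ k)\<^sup>2 * (norm c)\<^sup>2"
    by (simp only: norm_mult norm_of_real power_mult_distrib power2_abs)
  also have "\<dots> \<le> (1 - \<rho> ^ (2 * k)) * (norm c)\<^sup>2"
  proof (rule mult_right_mono)
    have "0 \<le> \<rho> ^ k" "\<rho> ^ k \<le> 1" using \<rho> by (auto simp: power_le_one)
    then have "(1 - \<rho> ^ k) * (1 - \<rho> ^ k) \<le> (1 - \<rho> ^ k) * (1 + \<rho> ^ k)" by (intro mult_left_mono) auto
    then show "(1 - \<rho> ^ k)\<^sup>2 \<le> 1 - \<rho> ^ (2 * k)"
      by (simp add: power2_eq_square algebra_simps power_mult power_mult_distrib)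
  qed auto
  finally have "2 * pi * (norm ((deriv ^^ k) (\<lambda>w. h w - h (of_real \<rho> * w)) 0 / fact k))\<^sup>2 * r ^ (2 * k)
     \<le> 2 * pi * ((1 - \<rho> ^ (2 * k)) * (norm c)\<^sup>2) * r ^ (2 * k)"
    using r by (intro mult_right_mono mult_left_mono) auto
  also have "\<dots> = 2 * pi * (norm c)\<^sup>2 * r ^ (2 * k) - 2 * pi * (norm c)\<^sup>2 * (\<rho> * r) ^ (2 * k)"
    by (simp add: algebra_simps power_mult_distrib)
  finally show "2 * pi * (norm ((deriv ^^ k) (\<lambda>w. h w - h (of_real \<rho> * w)) 0 / fact k))\<^sup>2 * r ^ (2 * k)
     \<le> 2 * pi * (norm ((deriv ^^ k) h 0 / fact k))\<^sup>2 * r ^ (2 * k) -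
       2 * pi * (norm ((deriv ^^ k) h 0 / fact k))\<^sup>2 * (\<rho> * r) ^ (2 * k)"
    by (simp only: c_def)
qed (use h \<rho> r mult_strict_mono[of \<rho> 1 r 1] in auto)

section \<open>The space H^2: mean-square Cauchy property and radial limits\<close>

definition hardy2 :: "(complex \<Rightarrow> complex) set" where
  "hardy2 = {h. h holomorphic_on ball 0 1 \<and> bdd_above (sq_mean h ` {0<..<1})}"

text \<open>Square means increase to a finite supremum, so beyond some radius every increment is at
  most \<open>e\<close>. The bound has to be uniform in \<open>r\<close>, because the maximal
  inequality takes all circles at once.\<close>

lemma hardy2_dilation_diff_small:
  assumes "h \<in> hardy2" "e > 0"
  obtains \<rho>0 where "0 < \<rho>0" "\<rho>0 < 1"
    "\<And>\<rho> r. \<lbrakk>\<rho>0 \<le> \<rho>; \<rho> < 1; 0 < r; r < 1\<rbrakk> \<Longrightarrow> sq_mean (\<lambda>w. h w - h (of_real \<rho> * w)) r \<le> e"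
proof -
  have h: "h holomorphic_on ball 0 1" and bdd: "bdd_above (sq_mean h ` {0<..<1})"
    using assms by (auto simp: hardy2_def)
  define B where "B = (SUP r\<in>{0<..<1}. sq_mean h r)"
  have B: "sq_mean h r \<le> B" if "0 < r" "r < 1" for r
    unfolding B_def using that by (intro cSUP_upper bdd) auto
  have "\<exists>r\<in>{0<..<1}. B - e < sq_mean h r"
    unfolding B_def by (subst less_cSUP_iff[symmetric]) (use bdd assms(2) in auto)
  then obtain \<rho>1 where \<rho>1: "0 < \<rho>1" "\<rho>1 < 1" "B - e < sq_mean h \<rho>1" by auto
  show thesis
  \<comment> \<open>Two factors that are at least \<open>sqrt \<rho>1\<close> have product at least
    \<open>\<rho>1\<close>. A smaller \<open>r\<close> is first raised to \<open>r'\<close>, which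
    can only increase the square mean of the difference.\<close>
  proof (rule that[of "sqrt \<rho>1"])
    fix \<rho> r assume *: "sqrt \<rho>1 \<le> \<rho>" "\<rho> < 1" "0 < r" "r < (1::real)"
    define r' where "r' = max r (sqrt \<rho>1)"
    have sq: "0 < sqrt \<rho>1" "sqrt \<rho>1 < 1" using \<rho>1 by auto
    have r': "0 < r'" "r' < 1" "r \<le> r'" "sqrt \<rho>1 \<le> r'" using * sq by (auto simp: r'_def)
    have \<rho>: "0 < \<rho>" using sq * by linarith
    have "sqrt \<rho>1 * sqrt \<rho>1 \<le> \<rho> * r'" using sq * r' \<rho> by (intro mult_mono) auto
    then have le: "\<rho>1 \<le> \<rho> * r'" using \<rho>1 by simp
    have lt: "\<rho> * r' < 1" using * r' \<rho> mult_strict_mono[of \<rho> 1 r' 1] by simp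
    have "sq_mean (\<lambda>w. h w - h (of_real \<rho> * w)) r \<le> sq_mean (\<lambda>w. h w - h (of_real \<rho> * w)) r'"
      using h continuous_on_radius(3)[OF h, of \<rho>] * r' \<rho>
      by (intro sq_mean_mono holomorphic_intros) auto
    also have "\<dots> \<le> sq_mean h r' - sq_mean h (\<rho> * r')"
      by (rule sq_mean_dilation_diff[OF h]) (use * r' \<rho> in auto)
    also have "\<dots> \<le> B - sq_mean h \<rho>1"
      using B[OF r'(1,2)] sq_mean_mono[OF h \<rho>1(1) le lt] by linarith
    finally show "sq_mean (\<lambda>w. h w - h (of_real \<rho> * w)) r \<le> e" using \<rho>1 by simp
  qed (use \<rho>1 in auto)
qed

lemma convergent_at_left_1:
  fixes \<phi> :: "real \<Rightarrow> complex"
  assumes "\<And>e. e > 0 \<Longrightarrow> \<exists>\<rho><1. \<forall>r\<in>{\<rho><..<1}. \<forall>s\<in>{\<rho><..<1}. dist (\<phi> r) (\<phi> s) \<le> e"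
  shows "\<exists>l. (\<phi> \<longlongrightarrow> l) (at_left 1)"
proof -
  define x where "x n = 1 - inverse (real (Suc n))" for n
  have x1: "x n < 1" for n by (simp add: x_def)
  have x: "x \<longlonglongrightarrow> 1"
    unfolding x_def using tendsto_diff[OF tendsto_const LIMSEQ_inverse_real_of_nat, of 1] by simp
  have "Cauchy (\<lambda>n. \<phi> (x n))"
  proof (rule metric_CauchyI)
    fix e :: real assume "e > 0"
    then obtain \<rho> where \<rho>: "\<rho> < 1" "\<forall>r\<in>{\<rho><..<1}. \<forall>s\<in>{\<rho><..<1}. dist (\<phi> r) (\<phi> s) \<le> e / 2"
      using assms[of "e / 2"] by auto
    from order_tendstoD(1)[OF x \<rho>(1)] obtain N where "\<forall>n\<ge>N. \<rho> < x n" by (auto simp: eventually_sequentially)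
    then have "dist (\<phi> (x m)) (\<phi> (x n)) \<le> e / 2" if "m \<ge> N" "n \<ge> N" for m n using \<rho>(2) x1 that by auto
    moreover have "e / 2 < e" using \<open>e > 0\<close> by simp
    ultimately show "\<exists>M. \<forall>m\<ge>M. \<forall>n\<ge>M. dist (\<phi> (x m)) (\<phi> (x n)) < e"
      using le_less_trans by blast
  qed
  then obtain l where l: "(\<lambda>n. \<phi> (x n)) \<longlonglongrightarrow> l" by (auto simp: Cauchy_convergent_iff convergent_def)
  have "(\<phi> \<longlongrightarrow> l) (at_left 1)"
  proof (rule tendstoI)
    fix e :: real assume "e > 0"
    then obtain \<rho> where \<rho>: "\<rho> < 1" "\<forall>r\<in>{\<rho><..<1}. \<forall>s\<in>{\<rho><..<1}. dist (\<phi> r) (\<phi> s) \<le> e / 2"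
      using assms[of "e / 2"] by auto
    have ev: "\<forall>\<^sub>F n in sequentially. \<rho> < x n" by (rule order_tendstoD(1)[OF x \<rho>(1)])
    have "dist (\<phi> r) l \<le> e / 2" if "r \<in> {\<rho><..<1}" for r
    proof (rule tendsto_upperbound[OF tendsto_dist[OF tendsto_const l]])
      show "\<forall>\<^sub>F n in sequentially. dist (\<phi> r) (\<phi> (x n)) \<le> e / 2"
        using ev by eventually_elim (use \<rho>(2) x1 that in auto)
    qed auto
    moreover have "e / 2 < e" using \<open>e > 0\<close> by simp
    moreover have "\<forall>\<^sub>F r in at_left 1. r \<in> {\<rho><..<1}" by (rule eventually_at_left_real[OF \<rho>(1)])
    ultimately show "\<forall>\<^sub>F r in at_left 1. dist (\<phi> r) l < e"
      using le_less_trans eventually_mono by (metis (mono_tags, lifting))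
  qed
  then show ?thesis ..
qed

lemma integral_circ_const: "(\<integral>t. c \<partial>circ) = (2 * pi) *\<^sub>R (c::'b::euclidean_space)"
proof -
  have "(\<integral>t. (\<lambda>_. c) (cis t) \<partial>circ) = integral {0..2 * pi} (\<lambda>t. c)" by (rule integral_circ) auto
  then show ?thesis by simp
qed

lemma integrable_circ_continuous:
  fixes f :: "real \<Rightarrow> 'b::euclidean_space"
  shows "continuous_on UNIV f \<Longrightarrow> integrable circ f"
  by (intro continuous_imp_integrable_real) (auto intro: continuous_on_subset)

text \<open>Integrating \<open>2 * \<delta> * x \<le> x^2 + \<delta>^2\<close> takes the place of
  the Cauchy-Schwarz inequality; \<delta> stays free so that the two terms can be balanced.\<close>

lemma L1_le_L2_circ:
  fixes f :: "real \<Rightarrow> complex"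
  assumes f: "continuous_on UNIV f" and \<delta>: "\<delta> > 0"
  shows "(\<integral>t. norm (f t) \<partial>circ) \<le> (\<integral>t. (norm (f t))\<^sup>2 \<partial>circ) / (2 * \<delta>) + \<delta> * pi"
proof -
  have i: "integrable circ (\<lambda>t. (norm (f t))\<^sup>2)" "integrable circ (\<lambda>t. norm (f t))" "integrable circ (\<lambda>t. \<delta> / 2)"
    by (intro integrable_circ_continuous continuous_intros f)+
  have "(\<integral>t. norm (f t) \<partial>circ) \<le> (\<integral>t. (norm (f t))\<^sup>2 / (2 * \<delta>) + \<delta> / 2 \<partial>circ)"
  proof (rule integral_mono)
    fix t
    have "0 \<le> (norm (f t) - \<delta>)\<^sup>2" by simp
    then have "2 * \<delta> * norm (f t) \<le> (norm (f t))\<^sup>2 + \<delta>\<^sup>2" by (simp add: power2_eq_square algebra_simps)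
    then show "norm (f t) \<le> (norm (f t))\<^sup>2 / (2 * \<delta>) + \<delta> / 2"
      using \<delta> by (simp add: field_simps power2_eq_square)
  qed (use i in auto)
  also have "\<dots> = (\<integral>t. (norm (f t))\<^sup>2 \<partial>circ) / (2 * \<delta>) + (\<integral>t. \<delta> / 2 \<partial>circ)"
    using i by (subst Bochner_Integration.integral_add) auto
  also have "(\<integral>t. \<delta> / 2 \<partial>circ) = \<delta> * pi" by (subst integral_circ_const) simp
  finally show ?thesis .
qed

text \<open>The dilate \<open>h (\<rho> * w)\<close> is continuous across the circle and does not
  oscillate near it. Oscillation above \<open>3 * lam\<close> therefore forces the difference
  \<open>g\<close> above \<open>lam\<close> somewhere on the ray, and the maximal inequality makes
  the set of such \<open>t\<close> small: \<open>g\<close> may account for \<open>lam\<close> at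
  each of the two radii, the dilate for the third.\<close>

lemma hardy2_oscillation_negligible:
  assumes h2: "h \<in> hardy2" and lam: "lam > 0"
  shows "negligible {t\<in>{0..2 * pi}. \<forall>\<rho><1. \<exists>r\<in>{\<rho><..<1}. \<exists>s\<in>{\<rho><..<1}.
     dist (h (of_real r * cis t)) (h (of_real s * cis t)) > 3 * lam}" (is "negligible ?N")
  unfolding negligible_outer_le
proof (intro allI impI)
  fix e :: real assume e: "e > 0"
  have h: "h holomorphic_on ball 0 1" using h2 by (simp add: hardy2_def)
  \<comment> \<open>\<open>E\<close> is chosen so that \<open>15 / lam * E = e\<close>, and \<delta>
    so that both terms of the L^1 bound are \<open>E / 2\<close>.\<close>
  define E where "E = e * lam / 15"
  have E: "E > 0" using e lam by (simp add: E_def)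
  define \<delta> where "\<delta> = E / (2 * pi)"
  have \<delta>: "\<delta> > 0" using E by (simp add: \<delta>_def)
  obtain \<rho> where \<rho>: "0 < \<rho>" "\<rho> < 1"
    and \<rho>_small: "\<And>\<rho>' r. \<lbrakk>\<rho> \<le> \<rho>'; \<rho>' < 1; 0 < r; r < 1\<rbrakk> \<Longrightarrow> sq_mean (\<lambda>w. h w - h (of_real \<rho>' * w)) r \<le> E * \<delta>"
    by (rule hardy2_dilation_diff_small[OF h2 mult_pos_pos[OF E \<delta>]]) (rule that, assumption+)
  define g where "g w = h w - h (of_real \<rho> * w)" for w
  have g: "g holomorphic_on ball 0 1"
    unfolding g_def using continuous_on_radius(3)[OF h, of \<rho>] \<rho> by (intro holomorphic_on_diff h) auto
  define T where "T = {t\<in>{0..2 * pi}. \<exists>r\<in>{0..<1}. norm (g (of_real r * cis t)) > lam}"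
  have gE: "(\<integral>t. norm (g (of_real s * cis t)) \<partial>circ) \<le> E" if "s \<in> {0<..<1}" for s
  proof -
    have "(\<integral>t. norm (g (of_real s * cis t)) \<partial>circ) \<le> sq_mean g s / (2 * \<delta>) + \<delta> * pi"
      unfolding sq_mean_def using that by (intro L1_le_L2_circ continuous_on_radius(4)[OF g] \<delta>) auto
    also have "sq_mean g s \<le> E * \<delta>" using \<rho>_small[of \<rho> s] \<rho> that by (simp add: g_def[abs_def])
    finally have "(\<integral>t. norm (g (of_real s * cis t)) \<partial>circ) \<le> E * \<delta> / (2 * \<delta>) + \<delta> * pi"
      using \<delta> by (simp add: divide_right_mono)
    also have "\<dots> = E" using \<delta> by (simp add: \<delta>_def)
    finally show ?thesis .
  qed
  note W = radial_maximal_weak_type_disc[OF g lam gE, folded T_def]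
  have "?N \<subseteq> T"
  proof
    fix t assume t: "t \<in> ?N"
    show "t \<in> T"
    proof (rule ccontr)
      assume "t \<notin> T"
      have small: "norm (g (of_real r * cis t)) \<le> lam" if "0 \<le> r" "r < 1" for r
      proof (rule ccontr)
        assume "\<not> ?thesis"
        then have "t \<in> T" unfolding T_def using t that by (auto intro!: bexI[of _ r])
        with \<open>t \<notin> T\<close> show False ..
      qed
      \<comment> \<open>At \<open>r = 1\<close> the argument \<open>\<rho> * cis t\<close> still
        lies in the open disc, so \<open>p\<close> is continuous there.\<close>
      define p where "p r = h (of_real \<rho> * (of_real r * cis t))" for r :: real
      have "isCont h (of_real \<rho> * cis t)"
        using \<rho> by (intro field_differentiable_imp_continuous_at
          holomorphic_on_imp_differentiable_at[OF h]) (auto simp: norm_mult)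
      then have "isCont p 1"
        unfolding p_def by (intro isCont_o2[where f = "\<lambda>r. of_real \<rho> * (of_real r * cis t)" and g = h]) auto
      then have "\<forall>\<^sub>F r in at 1. dist (p r) (p 1) < lam / 2"
        using lam by (intro tendstoD[OF isContD]) auto
      then obtain d where d: "d > 0" "\<And>r. r \<noteq> 1 \<Longrightarrow> dist r 1 < d \<Longrightarrow> dist (p r) (p 1) < lam / 2"
        unfolding eventually_at by blast
      define \<rho>' where "\<rho>' = max 0 (1 - d)"
      have "\<rho>' < 1" using d by (auto simp: \<rho>'_def)
      then obtain r s where rs: "r \<in> {\<rho>'<..<1}" "s \<in> {\<rho>'<..<1}"
        "dist (h (of_real r * cis t)) (h (of_real s * cis t)) > 3 * lam"
        using t[unfolded mem_Collect_eq, THEN conjunct2, rule_format, OF \<open>\<rho>' < 1\<close>] by (elim bexE)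
      have "dist (p r) (p 1) < lam / 2" "dist (p s) (p 1) < lam / 2"
        using d(2)[of r] d(2)[of s] rs by (auto simp: \<rho>'_def dist_real_def)
      then have "dist (p r) (p s) < lam" using dist_triangle_half_r[of "p 1" "p r" lam "p s"] by (simp add: dist_commute)
      moreover have "dist (h (of_real r * cis t)) (p r) \<le> lam" "dist (h (of_real s * cis t)) (p s) \<le> lam"
        using small[of r] small[of s] rs unfolding g_def p_def dist_norm \<rho>'_def by simp_all
      ultimately have "dist (h (of_real r * cis t)) (h (of_real s * cis t)) \<le> 3 * lam"
        using dist_triangle[of "h (of_real r * cis t)" "h (of_real s * cis t)" "p r"]
          dist_triangle[of "p r" "h (of_real s * cis t)" "p s"]
        by (simp add: dist_commute)
      with rs show False by simp
    qed
  qed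
  moreover have "15 / lam * E = e" using lam by (simp add: E_def)
  ultimately show "\<exists>T. ?N \<subseteq> T \<and> T \<in> lmeasurable \<and> measure lebesgue T \<le> e" using W by (intro exI[of _ T]) simp
qed

lemma hardy2_radial_limit:
  assumes h2: "h \<in> hardy2"
  shows "AE t in circ. \<exists>l. ((\<lambda>r. h (of_real r * cis t)) \<longlongrightarrow> l) (at_left 1)"
proof -
  define N where "N n = {t\<in>{0..2 * pi}. \<forall>\<rho><1. \<exists>r\<in>{\<rho><..<1}. \<exists>s\<in>{\<rho><..<1}.
     dist (h (of_real r * cis t)) (h (of_real s * cis t)) > 3 * (1 / real (Suc n))}" for n
  have "negligible (\<Union>n. N n)"
    unfolding N_def by (intro negligible_Union_nat hardy2_oscillation_negligible h2) auto
  then have "AE t in lebesgue. t \<notin> (\<Union>n. N n)"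
    using negligible_iff_null_sets AE_not_in by blast
  then have "AE t in lebesgue. t \<in> {0..2 * pi} \<longrightarrow> (\<exists>l. ((\<lambda>r. h (of_real r * cis t)) \<longlongrightarrow> l) (at_left 1))"
  proof (rule AE_mp, intro AE_I2 impI)
    fix t assume t: "t \<notin> (\<Union>n. N n)" "t \<in> {0..2 * pi}"
    show "\<exists>l. ((\<lambda>r. h (of_real r * cis t)) \<longlongrightarrow> l) (at_left 1)"
    proof (rule convergent_at_left_1)
      fix e :: real assume "e > 0"
      then obtain n where "inverse (real (Suc n)) < e / 3" using reals_Archimedean[of "e / 3"] by auto
      then have n: "3 * (1 / real (Suc n)) \<le> e" by (simp add: field_simps)
      from t have "t \<notin> N n" by auto
      then obtain \<rho> where "\<rho> < 1" "\<And>r s. r \<in> {\<rho><..<1} \<Longrightarrow> s \<in> {\<rho><..<1} \<Longrightarrow>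
        dist (h (of_real r * cis t)) (h (of_real s * cis t)) \<le> 3 * (1 / real (Suc n))"
        using t(2) unfolding N_def by (auto simp: not_less)
      then show "\<exists>\<rho><1. \<forall>r\<in>{\<rho><..<1}. \<forall>s\<in>{\<rho><..<1}.
          dist (h (of_real r * cis t)) (h (of_real s * cis t)) \<le> e"
        using n by (meson order_trans)
    qed
  qed
  then show ?thesis by (simp add: AE_restrict_space_iff)
qed

section \<open>Factorization in the Hardy space\<close>

text \<open>On the circle \<open>cnj z\<close> is the inverse of \<open>z\<close>, so
  \<open>p * cnj q\<close> is a trigonometric polynomial, and conjugating its negative frequencies
  does not change the real part. The induction strips the constant terms of both polynomials at
  once, using \<open>z * cnj z = 1\<close>.\<close>

lemma Re_mult_cnj_poly_on_circle:
  "\<exists>s. \<forall>z. norm z = 1 \<longrightarrow> Re (poly p z * cnj (poly q z)) = Re (poly s z)"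
proof (induction q arbitrary: p)
  case 0
  show ?case by (intro exI[of _ 0]) simp
next
  case (pCons a q)
  obtain b p' where p: "p = pCons b p'" by (cases p)
  obtain s where s: "\<And>z. norm z = 1 \<Longrightarrow> Re (poly p' z * cnj (poly q z)) = Re (poly s z)"
    using pCons.IH[of p'] by blast
  show ?case
  proof (intro exI[of _ "smult (cnj a) p + s + smult (cnj b) (pCons 0 q)"] allI impI)
    fix z :: complex assume z: "norm z = 1"
    then have zz: "z * cnj z = 1" by (simp add: complex_norm_square[symmetric])
    have "poly p z * cnj (poly (pCons a q) z)
        = cnj a * poly p z + (z * cnj z) * (poly p' z * cnj (poly q z)) + b * cnj (z * poly q z)"
      by (simp add: p algebra_simps)
    also have "Re \<dots> = Re (cnj a * poly p z) + Re (poly s z) + Re (cnj (b * cnj (z * poly q z)))"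
      by (simp only: zz mult_1 plus_complex.sel s[OF z] cnj.sel)
    also have "cnj (b * cnj (z * poly q z)) = cnj b * (z * poly q z)" by simp
    finally show "Re (poly p z * cnj (poly (pCons a q) z))
        = Re (poly (smult (cnj a) p + s + smult (cnj b) (pCons 0 q)) z)"
      by (simp only: poly_add poly_smult poly_pCons plus_complex.sel add_0)
  qed
qed

text \<open>Approximating by real parts of polynomials supplies the harmonic conjugate for free: the
  exponential of the polynomial is a zero-free holomorphic function of nearly prescribed
  modulus.\<close>

lemma Re_poly_dense_on_circle:
  fixes u :: "complex \<Rightarrow> real"
  assumes "continuous_on (sphere 0 1) u" "e > 0"
  shows "\<exists>p. \<forall>z\<in>sphere 0 1. \<bar>u z - Re (poly p z)\<bar> < e"
proof -
  define R where "R = {f. \<exists>p. \<forall>z\<in>sphere 0 1. f z = Re (poly p z)}"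
  interpret function_ring_on R "sphere 0 1"
  proof
    fix f assume "f \<in> R"
    then obtain p where p: "\<And>z. z \<in> sphere 0 1 \<Longrightarrow> f z = Re (poly p z)" unfolding R_def by blast
    have "continuous_on (sphere 0 1) (\<lambda>z. Re (poly p z))" by (intro continuous_intros)
    then show "continuous_on (sphere 0 1) f" using p by (metis (no_types, lifting) continuous_on_cong)
  next
    fix f g assume "f \<in> R" "g \<in> R"
    then obtain p q where p: "\<And>z. z \<in> sphere 0 1 \<Longrightarrow> f z = Re (poly p z)"
      and q: "\<And>z. z \<in> sphere 0 1 \<Longrightarrow> g z = Re (poly q z)" unfolding R_def by blast
    show "(\<lambda>x. f x + g x) \<in> R" unfolding R_def using p q by (auto intro!: exI[of _ "p + q"])
    obtain s where s: "\<And>z. norm z = 1 \<Longrightarrow> Re (poly p z * cnj (poly q z)) = Re (poly s z)"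
      using Re_mult_cnj_poly_on_circle[of p q] by blast
    \<comment> \<open>\<open>2 * Re p * Re q\<close> is the real part of
      \<open>p * q + p * cnj q\<close>, and on the circle the second summand has the real part of a
      polynomial.\<close>
    have "f z * g z = Re (poly (smult (1/2) (p * q + s)) z)" if "z \<in> sphere 0 1" for z
    proof -
      have "Re (poly p z) * Re (poly q z) = (Re (poly p z * poly q z) + Re (poly p z * cnj (poly q z))) / 2"
        by simp
      then show ?thesis using p[OF that] q[OF that] s[of z] that by simp
    qed
    then show "(\<lambda>x. f x * g x) \<in> R" unfolding R_def by blast
  next
    fix c show "(\<lambda>_. c) \<in> R" unfolding R_def by (auto intro!: exI[of _ "[:of_real c:]"])
  next
    fix x y :: complex assume "x \<in> sphere 0 1" "y \<in> sphere 0 1" "x \<noteq> y"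
    have "Re \<in> R" unfolding R_def by (auto intro!: exI[of _ "[:0, 1:]"])
    moreover have "Im \<in> R" unfolding R_def by (auto intro!: exI[of _ "[:0, -\<i>:]"])
    ultimately show "\<exists>f\<in>R. f x \<noteq> f y" using \<open>x \<noteq> y\<close> complex_eq_iff by blast
  qed auto
  show ?thesis using Stone_Weierstrass_basic[OF assms] unfolding R_def by (smt (verit) mem_Collect_eq)
qed

text \<open>The factors are \<open>f / exp (Q / 2)\<close> and \<open>exp (Q / 2)\<close>, where \<open>Re Q\<close> approximates
  \<open>ln (\<bar>f\<bar> + 1)\<close> on the circle of radius \<open>\<rho>\<close>; the approximation need only be within a constant.\<close>

lemma holomorphic_split_on_circle:
  fixes f :: "complex \<Rightarrow> complex"
  assumes f: "f holomorphic_on ball 0 1" and \<rho>: "0 < \<rho>" "\<rho> < 1"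
  obtains a b where "a holomorphic_on ball 0 1" "b holomorphic_on ball 0 1"
    "\<And>w. f w = a w * b w"
    "sq_mean a \<rho> \<le> 3 * (\<integral>t. norm (f (of_real \<rho> * cis t)) \<partial>circ)"
    "sq_mean b \<rho> \<le> 3 * (\<integral>t. norm (f (of_real \<rho> * cis t)) \<partial>circ) + 6 * pi"
proof -
  define n where "n z = norm (f (of_real \<rho> * z))" for z
  have cn: "continuous_on (sphere 0 1) n"
    unfolding n_def using continuous_on_radius(2)[OF f, of \<rho>] \<rho> by (intro continuous_on_norm) auto
  have n0: "n z \<ge> 0" for z by (simp add: n_def)
  \<comment> \<open>The summand 1 keeps the logarithm finite at zeros of \<open>f\<close>; its price
    is the additive \<open>6 * pi\<close> in the bound for \<open>b\<close>.\<close>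
  have "continuous_on (sphere 0 1) (\<lambda>z. ln (n z + 1))"
    using n0 by (intro continuous_intros cn) (auto simp: add_nonneg_eq_0_iff)
  from Re_poly_dense_on_circle[OF this zero_less_one] obtain Q where
    "\<forall>z\<in>sphere 0 1. \<bar>ln (n z + 1) - Re (poly Q z)\<bar> < 1" ..
  then have Q: "\<bar>ln (n z + 1) - Re (poly Q z)\<bar> < 1" if "z \<in> sphere 0 1" for z
    using that by (rule bspec)
  define b where "b w = exp (poly Q (w / of_real \<rho>) / 2)" for w
  define a where "a w = f w / b w" for w
  have b: "b holomorphic_on ball 0 1"
    unfolding b_def by (intro holomorphic_intros) (use \<rho> in auto)
  have a: "a holomorphic_on ball 0 1"
    unfolding a_def by (intro holomorphic_intros f b) (simp add: b_def)
  have nb: "(norm (b (of_real \<rho> * z)))\<^sup>2 = exp (Re (poly Q z))" for z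
    using \<rho> by (simp add: b_def exp_double[symmetric])
  \<comment> \<open>An error below 1 in the logarithm costs a factor \<open>exp 1\<close>, which is
    at most 3.\<close>
  have bounds: "exp (Re (poly Q z)) \<le> 3 * (n z + 1)" "n z + 1 \<le> 3 * exp (Re (poly Q z))" if "z \<in> sphere 0 1" for z
  proof -
    have "n z + 1 > 0" using n0[of z] by simp
    then have e: "n z + 1 = exp (ln (n z + 1))" by simp
    have "exp (Re (poly Q z)) \<le> exp (1 + ln (n z + 1))" using Q[OF that] by simp
    also have "\<dots> = exp 1 * (n z + 1)" unfolding exp_add e[symmetric] ..
    also have "\<dots> \<le> 3 * (n z + 1)" using exp_le n0[of z] by (intro mult_right_mono) auto
    finally show "exp (Re (poly Q z)) \<le> 3 * (n z + 1)" .
    have "exp (ln (n z + 1)) \<le> exp (1 + Re (poly Q z))" using Q[OF that] by simp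
    then have "n z + 1 \<le> exp (1 + Re (poly Q z))" using e by (rule ord_eq_le_trans[rotated])
    also have "\<dots> \<le> 3 * exp (Re (poly Q z))" unfolding exp_add using exp_le by (intro mult_right_mono) auto
    finally show "n z + 1 \<le> 3 * exp (Re (poly Q z))" .
  qed
  have na: "(norm (a (of_real \<rho> * z)))\<^sup>2 \<le> 3 * n z" if "z \<in> sphere 0 1" for z
  proof -
    have "(norm (a (of_real \<rho> * z)))\<^sup>2 = (n z)\<^sup>2 / exp (Re (poly Q z))"
      by (simp add: a_def norm_divide power_divide nb n_def)
    also have "\<dots> \<le> 3 * n z"
    proof -
      have "n z * n z \<le> n z * (3 * exp (Re (poly Q z)))"
        using bounds(2)[OF that] n0[of z] by (intro mult_left_mono) auto
      then show ?thesis by (simp add: field_simps power2_eq_square)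
    qed
    finally show ?thesis .
  qed
  have int: "integrable circ (\<lambda>t. (norm (h (of_real \<rho> * cis t)))\<^sup>2)" if "h holomorphic_on ball 0 1" for h :: "complex \<Rightarrow> complex"
    using that \<rho> by (intro integrable_circ_continuous continuous_on_power continuous_on_norm continuous_on_radius(4)) auto
  have nint: "integrable circ (\<lambda>t. n (cis t))" by (rule integrable_circ[OF cn])
  have "sq_mean a \<rho> \<le> (\<integral>t. 3 * n (cis t) \<partial>circ)"
    unfolding sq_mean_def by (rule integral_mono) (use int[OF a] nint na in \<open>auto simp del: power2_less_eq_zero_iff\<close>)
  then have 1: "sq_mean a \<rho> \<le> 3 * (\<integral>t. norm (f (of_real \<rho> * cis t)) \<partial>circ)" by (simp add: n_def)
  have "sq_mean b \<rho> \<le> (\<integral>t. 3 * n (cis t) + 3 \<partial>circ)"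
    unfolding sq_mean_def
  proof (rule integral_mono)
    show "integrable circ (\<lambda>t. 3 * n (cis t) + 3)"
      by (rule Bochner_Integration.integrable_add[OF integrable_mult_right[OF nint]
            integrable_circ_continuous[OF continuous_on_const]])
    show "(norm (b (of_real \<rho> * cis t)))\<^sup>2 \<le> 3 * n (cis t) + 3" for t
      using bounds(1)[of "cis t"] unfolding nb by simp
  qed (rule int[OF b])
  also have "\<dots> = 3 * (\<integral>t. n (cis t) \<partial>circ) + (\<integral>t. 3 \<partial>circ)"
    using Bochner_Integration.integral_add[OF integrable_mult_right[OF nint, of 3]
        integrable_circ_continuous[OF continuous_on_const[of UNIV 3]]] by simp
  also have "(\<integral>t. 3 \<partial>circ) = 6 * pi" by (subst integral_circ_const) simp
  finally have 2: "sq_mean b \<rho> \<le> 3 * (\<integral>t. norm (f (of_real \<rho> * cis t)) \<partial>circ) + 6 * pi" by (simp add: n_def)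
  show thesis by (rule that[OF a b _ 1 2]) (simp add: a_def b_def)
qed

section \<open>Locally uniform bounds and the limit of the factors\<close>

text \<open>Cauchy's formula on the circle of radius \<open>(1 + R) / 2\<close>, where the kernel is
  at most \<open>2 / (1 - R)\<close> and the L^1 mean at most \<open>C / 2 + pi\<close>. The bound
  depends on \<open>h\<close> only through \<open>C\<close>, as a normal family requires.\<close>

lemma sq_mean_pointwise_bound:
  assumes h: "h holomorphic_on ball 0 1" and C: "\<And>r. \<lbrakk>0 < r; r < 1\<rbrakk> \<Longrightarrow> sq_mean h r \<le> C"
    and R: "0 \<le> R" "R < 1" and w: "norm w \<le> R"
  shows "norm (h w) \<le> (C / 2 + pi) / (1 - R) / pi"
proof -
  define r where "r = (1 + R) / 2"
  have r: "0 < r" "r < 1" "R < r" using R by (auto simp: r_def)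
  have wr: "norm (w / of_real r) \<le> R / r" using w r by (simp add: norm_divide divide_right_mono)
  have Rr: "R / r < 1" using r R by simp
  have gap: "(1 - R) / 2 \<le> 1 - R / r" 
  proof -
    have "R \<le> r * ((1 + R) / 2)" using zero_le_power2[of "1 - R"] by (simp add: r_def power2_eq_square field_simps)
    then show ?thesis using r by (simp add: field_simps)
  qed
  let ?h = "\<lambda>z. h (of_real r * z)"
  have c: "continuous_on (cball 0 1) ?h" "?h holomorphic_on ball 0 1" "continuous_on UNIV (\<lambda>t. ?h (cis t))"
    using continuous_on_radius(1,3,4)[OF h, of r] r by auto
  have "2 * pi * ?h (w / of_real r) = (\<integral>t. ?h (cis t) * cis t / (cis t - w / of_real r) \<partial>circ)"
    using Cauchy_circle_mean[OF c(1,2), of "w / of_real r"] wr Rr by simp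
  then have "norm (2 * pi * h w) = norm (\<integral>t. ?h (cis t) * cis t / (cis t - w / of_real r) \<partial>circ)"
    using r by simp
  also have "\<dots> \<le> (\<integral>t. norm (?h (cis t)) * (2 / (1 - R)) \<partial>circ)"
  proof (rule Bochner_Integration.integral_norm_bound_integral)
    have nz: "cis t - w / of_real r \<noteq> 0" for t
      using wr Rr by (metis eq_iff_diff_eq_0 norm_cis order_le_less_trans less_irrefl)
    show "integrable circ (\<lambda>t. ?h (cis t) * cis t / (cis t - w / of_real r))"
      using nz by (intro integrable_circ_continuous continuous_intros c(3)) auto
    show "integrable circ (\<lambda>t. norm (?h (cis t)) * (2 / (1 - R)))"
      by (intro integrable_circ_continuous continuous_intros c(3))
    fix t
    have low: "(1 - R) / 2 \<le> norm (cis t - w / of_real r)"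
      using norm_triangle_ineq2[of "cis t" "w / of_real r"] wr gap by simp
    then show "norm (?h (cis t) * cis t / (cis t - w / of_real r)) \<le> norm (?h (cis t)) * (2 / (1 - R))"
    proof -
      have "norm (?h (cis t) * cis t / (cis t - w / of_real r)) = norm (?h (cis t)) / norm (cis t - w / of_real r)"
        by (simp only: norm_mult norm_divide norm_cis mult_1_right)
      also have "\<dots> \<le> norm (?h (cis t)) / ((1 - R) / 2)"
        by (rule divide_left_mono) (use low R nz[of t] in auto)
      finally show ?thesis by (simp add: mult.commute)
    qed
  qed
  also have "\<dots> = (\<integral>t. norm (?h (cis t)) \<partial>circ) * (2 / (1 - R))" by simp
  also have "\<dots> \<le> (C / 2 + pi) * (2 / (1 - R))"
  proof (rule mult_right_mono)
    show "(\<integral>t. norm (?h (cis t)) \<partial>circ) \<le> C / 2 + pi"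
      using L1_le_L2_circ[OF c(3), of 1] C[OF r(1,2)] by (simp add: sq_mean_def)
  qed (use R in auto)
  finally show ?thesis using R by (simp add: norm_mult field_simps)
qed

text \<open>The bound \<open>C\<close> survives the limit because on each fixed circle the family is
  uniformly bounded, so that dominated convergence applies to the square means.\<close>

lemma Montel_hardy2:
  fixes A :: "nat \<Rightarrow> complex \<Rightarrow> complex"
  assumes A: "\<And>n. A n holomorphic_on ball 0 1"
    and C: "\<And>n r. \<lbrakk>0 < r; r < 1\<rbrakk> \<Longrightarrow> sq_mean (A n) r \<le> C"
  obtains a k where "a \<in> hardy2" "strict_mono (k :: nat \<Rightarrow> nat)"
    "\<And>w. w \<in> ball 0 1 \<Longrightarrow> (\<lambda>n. A (k n) w) \<longlonglongrightarrow> a w"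
proof -
  define B where "B R = (C / 2 + pi) / (1 - R) / pi" for R :: real
  have B: "norm (A n w) \<le> B R" if "0 \<le> R" "R < 1" "norm w \<le> R" for n R w
    unfolding B_def by (rule sq_mean_pointwise_bound[OF A C that])
  have bdd: "\<exists>B. \<forall>h\<in>range A. \<forall>z\<in>K. norm (h z) \<le> B" if K: "compact K" "K \<subseteq> ball 0 1" for K
  proof (cases "K = {}")
    case False
    obtain x where x: "x \<in> K" "\<And>y. y \<in> K \<Longrightarrow> norm y \<le> norm x"
      using continuous_attains_sup[OF K(1) False, of norm] by (auto intro: continuous_intros)
    have "norm x < 1" using x K by auto
    then show ?thesis using B[of "norm x"] x by auto
  qed auto
  obtain a k where a: "a holomorphic_on ball 0 1" "strict_mono (k :: nat \<Rightarrow> nat)"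
    "\<And>w. w \<in> ball 0 1 \<Longrightarrow> (\<lambda>n. A (k n) w) \<longlonglongrightarrow> a w"
    by (rule Montel[of "ball 0 1" "range A" A]) (use A bdd in auto)
  have "sq_mean a r \<le> C" if r: "0 < r" "r < 1" for r
  proof (rule LIMSEQ_le_const2)
    show "(\<lambda>n. sq_mean (A (k n)) r) \<longlonglongrightarrow> sq_mean a r"
      unfolding sq_mean_def
    proof (rule integral_dominated_convergence[where w = "\<lambda>_. (B r)\<^sup>2"])
      have m: "(\<lambda>t. (norm (h (of_real r * cis t)))\<^sup>2) \<in> borel_measurable circ"
        if "h holomorphic_on ball 0 1" for h :: "complex \<Rightarrow> complex"
        using that r by (intro borel_measurable_integrable integrable_circ_continuous continuous_intros continuous_on_radius(4)) auto
      show "(\<lambda>t. (norm (a (of_real r * cis t)))\<^sup>2) \<in> borel_measurable circ" by (rule m[OF a(1)])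
      show "(\<lambda>t. (norm (A (k n) (of_real r * cis t)))\<^sup>2) \<in> borel_measurable circ" for n by (rule m[OF A])
      show "integrable circ (\<lambda>_. (B r)\<^sup>2)" by (intro integrable_circ_continuous continuous_intros)
      show "AE t in circ. (\<lambda>n. (norm (A (k n) (of_real r * cis t)))\<^sup>2) \<longlonglongrightarrow> (norm (a (of_real r * cis t)))\<^sup>2"
        using r by (intro AE_I2 tendsto_intros a(3)) (auto simp: norm_mult)
      show "AE t in circ. norm ((norm (A (k n) (of_real r * cis t)))\<^sup>2) \<le> (B r)\<^sup>2" for n
        using r B[of r] by (intro AE_I2) (auto simp: norm_mult intro!: power_mono)
    qed
    show "\<exists>N. \<forall>n\<ge>N. sq_mean (A (k n)) r \<le> C" using C[OF r] by blast
  qed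
  then have "a \<in> hardy2" unfolding hardy2_def using a(1) by (auto intro!: bdd_aboveI)
  then show thesis using that a by blast
qed

lemma hardy1_mean_bound:
  assumes "f \<in> hardy1"
  obtains C where "C > 0" "\<And>r. \<lbrakk>0 \<le> r; r < 1\<rbrakk> \<Longrightarrow> (\<integral>t. norm (f (of_real r * cis t)) \<partial>circ) \<le> C"
proof -
  from assms obtain M where M: "\<And>r. r \<in> {0..<1} \<Longrightarrow> circle_mean (\<lambda>\<zeta>. norm (f (of_real r * \<zeta>))) \<le> M"
    unfolding hardy1_def bdd_above_def by blast
  show thesis
  proof (rule that[of "max 1 (2 * pi * M)"])
    fix r :: real assume "0 \<le> r" "r < 1"
    then have "circle_mean (\<lambda>\<zeta>. norm (f (of_real r * \<zeta>))) \<le> M" by (intro M) auto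
    then have "(\<integral>t. norm (f (of_real r * cis t)) \<partial>circ) \<le> 2 * pi * M"
      by (simp add: circle_mean_alt field_simps)
    then show "(\<integral>t. norm (f (of_real r * cis t)) \<partial>circ) \<le> max 1 (2 * pi * M)" by simp
  qed simp
qed

text \<open>Factors made on the circle of radius \<open>\<rho> n\<close> are controlled only inside
  it. Dilating them by \<open>\<rho> n\<close> gives bounds on the whole disc, independent of
  \<open>n\<close>; their product is then \<open>f (\<rho> n * w)\<close>, which converges to
  \<open>f w\<close>.\<close>

theorem hardy1_factor:
  assumes f1: "f \<in> hardy1"
  obtains a b where "a \<in> hardy2" "b \<in> hardy2" "\<And>w. w \<in> ball 0 1 \<Longrightarrow> f w = a w * b w"
proof -
  have f: "f holomorphic_on ball 0 1" using f1 by (simp add: hardy1_def)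
  obtain C where C: "C > 0" "\<And>r. \<lbrakk>0 \<le> r; r < 1\<rbrakk> \<Longrightarrow> (\<integral>t. norm (f (of_real r * cis t)) \<partial>circ) \<le> C"
    using hardy1_mean_bound[OF f1] by blast
  define \<rho> where "\<rho> n = 1 - inverse (real (Suc (Suc n)))" for n
  have \<rho>: "0 < \<rho> n" "\<rho> n < 1" for n by (auto simp: \<rho>_def field_simps)
  have \<rho>_lim: "\<rho> \<longlonglongrightarrow> 1"
    unfolding \<rho>_def using tendsto_diff[OF tendsto_const LIMSEQ_Suc[OF LIMSEQ_inverse_real_of_nat], of 1] by simp
  have "\<exists>a b. a holomorphic_on ball 0 1 \<and> b holomorphic_on ball 0 1 \<and> (\<forall>w. f w = a w * b w) \<and>
      sq_mean a (\<rho> n) \<le> 3 * C + 6 * pi \<and> sq_mean b (\<rho> n) \<le> 3 * C + 6 * pi" for n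
  proof -
    obtain a b where ab: "a holomorphic_on ball 0 1" "b holomorphic_on ball 0 1"
      "\<And>w. f w = a w * b w"
      "sq_mean a (\<rho> n) \<le> 3 * (\<integral>t. norm (f (of_real (\<rho> n) * cis t)) \<partial>circ)"
      "sq_mean b (\<rho> n) \<le> 3 * (\<integral>t. norm (f (of_real (\<rho> n) * cis t)) \<partial>circ) + 6 * pi"
      by (rule holomorphic_split_on_circle[OF f \<rho>[of n]]) (rule that)
    have "(\<integral>t. norm (f (of_real (\<rho> n) * cis t)) \<partial>circ) \<le> C" using \<rho>[of n] by (intro C(2)) auto
    moreover have "pi \<ge> 0" by simp
    ultimately have "sq_mean a (\<rho> n) \<le> 3 * C + 6 * pi" "sq_mean b (\<rho> n) \<le> 3 * C + 6 * pi"
      using ab(4,5) by linarith+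
    then show ?thesis using ab(1-3) by blast
  qed
  then obtain a b where ab: "\<And>n. a n holomorphic_on ball 0 1" "\<And>n. b n holomorphic_on ball 0 1"
    "\<And>n w. f w = a n w * b n w"
    "\<And>n. sq_mean (a n) (\<rho> n) \<le> 3 * C + 6 * pi" "\<And>n. sq_mean (b n) (\<rho> n) \<le> 3 * C + 6 * pi"
    by metis
  have dil: "(\<lambda>w. h (of_real (\<rho> n) * w)) holomorphic_on ball 0 1"
      "\<And>r. \<lbrakk>0 < r; r < 1\<rbrakk> \<Longrightarrow> sq_mean (\<lambda>w. h (of_real (\<rho> n) * w)) r \<le> 3 * C + 6 * pi"
    if h: "h holomorphic_on ball 0 1" "sq_mean h (\<rho> n) \<le> 3 * C + 6 * pi" for h n
  proof -
    show "(\<lambda>w. h (of_real (\<rho> n) * w)) holomorphic_on ball 0 1"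
      using continuous_on_radius(3)[OF h(1), of "\<rho> n"] \<rho>[of n] by simp
    fix r :: real assume r: "0 < r" "r < 1"
    have "sq_mean (\<lambda>w. h (of_real (\<rho> n) * w)) r = sq_mean h (\<rho> n * r)"
      by (simp add: sq_mean_def mult.assoc)
    also have "\<dots> \<le> sq_mean h (\<rho> n)"
      using \<rho>[of n] r by (intro sq_mean_mono h) auto
    finally show "sq_mean (\<lambda>w. h (of_real (\<rho> n) * w)) r \<le> 3 * C + 6 * pi" using h(2) by simp
  qed
  obtain a' k where a': "a' \<in> hardy2" "strict_mono (k :: nat \<Rightarrow> nat)"
    "\<And>w. w \<in> ball 0 1 \<Longrightarrow> (\<lambda>n. a (k n) (of_real (\<rho> (k n)) * w)) \<longlonglongrightarrow> a' w"
    using Montel_hardy2[of "\<lambda>n w. a n (of_real (\<rho> n) * w)", OF dil(1)[OF ab(1,4)] dil(2)[OF ab(1,4)]] by metis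
  \<comment> \<open>The second extraction runs along the first subsequence \<open>k\<close>, so that
    both factors converge along \<open>k (l n)\<close>.\<close>
  obtain b' l where b': "b' \<in> hardy2" "strict_mono (l :: nat \<Rightarrow> nat)"
    "\<And>w. w \<in> ball 0 1 \<Longrightarrow> (\<lambda>n. b (k (l n)) (of_real (\<rho> (k (l n))) * w)) \<longlonglongrightarrow> b' w"
    using Montel_hardy2[of "\<lambda>n w. b (k n) (of_real (\<rho> (k n)) * w)", OF dil(1)[OF ab(2,5)] dil(2)[OF ab(2,5)]] by metis
  have "f w = a' w * b' w" if w: "w \<in> ball 0 1" for w
  proof (rule LIMSEQ_unique)
    have kl: "strict_mono (k \<circ> l)" using a'(2) b'(2) by (rule strict_mono_o)
    have "(\<lambda>n. a (k (l n)) (of_real (\<rho> (k (l n))) * w)) \<longlonglongrightarrow> a' w"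
      using LIMSEQ_subseq_LIMSEQ[OF a'(3)[OF w] b'(2)] by (simp add: o_def)
    from tendsto_mult[OF this b'(3)[OF w]]
    show "(\<lambda>n. f (of_real (\<rho> (k (l n))) * w)) \<longlonglongrightarrow> a' w * b' w" by (simp add: ab(3)[symmetric])
    have "(\<lambda>n. \<rho> (k (l n))) \<longlonglongrightarrow> 1"
      using LIMSEQ_subseq_LIMSEQ[OF \<rho>_lim kl] by (simp add: o_def)
    then have "(\<lambda>n. of_real (\<rho> (k (l n))) * w) \<longlonglongrightarrow> of_real 1 * w" by (intro tendsto_intros)
    moreover have "isCont f w"
      using w by (intro field_differentiable_imp_continuous_at holomorphic_on_imp_differentiable_at[OF f]) auto
    ultimately show "(\<lambda>n. f (of_real (\<rho> (k (l n))) * w)) \<longlonglongrightarrow> f w"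
      by (intro isCont_tendsto_compose[of w f]) auto
  qed
  with a'(1) b'(1) show thesis by (rule that)
qed

section \<open>Radial limits and the Cauchy property in the mean for H^1\<close>

text \<open>The limit exists wherever both H^2 factors have one. Thus the unspecified choice made by
  \<open>Lim\<close> is confined to a null set.\<close>

lemma hardy1_radial_limit:
  assumes "f \<in> hardy1"
  shows "AE t in circ. ((\<lambda>r. f (of_real r * cis t)) \<longlongrightarrow> boundary_value f (cis t)) (at_left 1)"
proof -
  obtain a b where ab: "a \<in> hardy2" "b \<in> hardy2" "\<And>w. w \<in> ball 0 1 \<Longrightarrow> f w = a w * b w"
    by (rule hardy1_factor[OF assms]) (rule that)
  show ?thesis
    using hardy2_radial_limit[OF ab(1)] hardy2_radial_limit[OF ab(2)]
  proof eventually_elim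
    fix t
    assume "\<exists>l. ((\<lambda>r. a (of_real r * cis t)) \<longlongrightarrow> l) (at_left 1)"
      and "\<exists>l. ((\<lambda>r. b (of_real r * cis t)) \<longlongrightarrow> l) (at_left 1)"
    then obtain l m where "((\<lambda>r. a (of_real r * cis t)) \<longlongrightarrow> l) (at_left 1)"
      "((\<lambda>r. b (of_real r * cis t)) \<longlongrightarrow> m) (at_left 1)" by blast
    then have "((\<lambda>r. a (of_real r * cis t) * b (of_real r * cis t)) \<longlongrightarrow> l * m) (at_left 1)" by (rule tendsto_mult)
    moreover have "\<forall>\<^sub>F r in at_left 1. f (of_real r * cis t) = a (of_real r * cis t) * b (of_real r * cis t)"
      using eventually_at_left_real[OF zero_less_one] by eventually_elim (auto intro!: ab(3) simp: norm_mult)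
    ultimately have *: "((\<lambda>r. f (of_real r * cis t)) \<longlongrightarrow> l * m) (at_left 1)"
      by (subst tendsto_cong)
    then have "boundary_value f (cis t) = l * m"
      unfolding boundary_value_def by (intro tendsto_Lim) auto
    with * show "((\<lambda>r. f (of_real r * cis t)) \<longlongrightarrow> boundary_value f (cis t)) (at_left 1)" by simp
  qed
qed

lemma hardy2_sq_mean_bound:
  assumes "h \<in> hardy2"
  obtains C where "C > 0" "\<And>r. \<lbrakk>0 < r; r < 1\<rbrakk> \<Longrightarrow> sq_mean h r \<le> C"
proof -
  obtain M where "\<And>r. r \<in> {0<..<1} \<Longrightarrow> sq_mean h r \<le> M"
    using assms unfolding hardy2_def bdd_above_def by blast
  then show thesis by (intro that[of "max 1 M"]) (auto simp: le_max_iff_disj)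
qed

text \<open>Two radii \<open>s < r\<close> amount to a dilation by \<open>s / r\<close> on the
  circle of radius \<open>r\<close>, and \<open>s / r \<ge> s\<close> keeps the factor above the
  threshold.\<close>

lemma hardy2_radii_diff_small:
  assumes h2: "h \<in> hardy2" and e: "e > 0"
  obtains \<rho>0 where "0 < \<rho>0" "\<rho>0 < 1" "\<And>r s. \<lbrakk>\<rho>0 \<le> s; s < r; r < 1\<rbrakk> \<Longrightarrow>
    (\<integral>t. (norm (h (of_real r * cis t) - h (of_real s * cis t)))\<^sup>2 \<partial>circ) \<le> e"
proof (rule hardy2_dilation_diff_small[OF assms])
  fix \<rho>0 :: real assume \<rho>0: "0 < \<rho>0" "\<rho>0 < 1"
    "\<And>\<rho> r. \<lbrakk>\<rho>0 \<le> \<rho>; \<rho> < 1; 0 < r; r < 1\<rbrakk> \<Longrightarrow> sq_mean (\<lambda>w. h w - h (of_real \<rho> * w)) r \<le> e"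
  show thesis
  proof (rule that[OF \<rho>0(1,2)])
    fix r s :: real assume rs: "\<rho>0 \<le> s" "s < r" "r < 1"
    then have r0: "r > 0" using \<rho>0 by linarith
    have "s * r \<le> s * 1" using rs \<rho>0 by (intro mult_left_mono) auto
    then have "s \<le> s / r" using r0 by (simp add: field_simps)
    then have "sq_mean (\<lambda>w. h w - h (of_real (s / r) * w)) r \<le> e"
      using rs r0 by (intro \<rho>0(3)) auto
    then show "(\<integral>t. (norm (h (of_real r * cis t) - h (of_real s * cis t)))\<^sup>2 \<partial>circ) \<le> e"
      using r0 by (simp add: sq_mean_def)
  qed
qed

lemma norm_mult_le_weighted_squares:
  fixes x y :: complex
  assumes "\<delta> > 0"
  shows "norm (x * y) \<le> (\<delta> * (norm x)\<^sup>2 + (norm y)\<^sup>2 / \<delta>) / 2"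
proof -
  have "0 \<le> (\<delta> * norm x - norm y)\<^sup>2" by simp
  then have "2 * \<delta> * (norm x * norm y) \<le> \<delta> * (\<delta> * (norm x)\<^sup>2) + (norm y)\<^sup>2"
    by (simp add: power2_eq_square algebra_simps)
  then show ?thesis using assms by (simp add: norm_mult field_simps)
qed

text \<open>With primes for the second radius,
  \<open>a * b - a' * b' = a * (b - b') + b' * (a - a')\<close>: each summand pairs a factor of
  bounded square mean with one of small square mean.\<close>

lemma hardy1_radii_diff_small:
  assumes f1: "f \<in> hardy1" and e: "e > 0"
  obtains \<rho>0 where "0 < \<rho>0" "\<rho>0 < 1" "\<And>r s. \<lbrakk>\<rho>0 \<le> s; s < r; r < 1\<rbrakk> \<Longrightarrow>
    (\<integral>t. norm (f (of_real r * cis t) - f (of_real s * cis t)) \<partial>circ) \<le> e"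
proof -
  obtain a b where ab: "a \<in> hardy2" "b \<in> hardy2" "\<And>w. w \<in> ball 0 1 \<Longrightarrow> f w = a w * b w"
    by (rule hardy1_factor[OF f1]) (rule that)
  have hol: "a holomorphic_on ball 0 1" "b holomorphic_on ball 0 1" "f holomorphic_on ball 0 1"
    using ab(1,2) f1 by (auto simp: hardy2_def hardy1_def)
  obtain C1 where C1: "C1 > 0" "\<And>r. \<lbrakk>0 < r; r < 1\<rbrakk> \<Longrightarrow> sq_mean a r \<le> C1" by (rule hardy2_sq_mean_bound[OF ab(1)]) blast
  obtain C2 where C2: "C2 > 0" "\<And>r. \<lbrakk>0 < r; r < 1\<rbrakk> \<Longrightarrow> sq_mean b r \<le> C2" by (rule hardy2_sq_mean_bound[OF ab(2)]) blast
  \<comment> \<open>With this \<delta> the bounded factors contribute \<open>e / 2\<close> in total;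
    the differences, of square mean at most \<open>\<delta> * e / 2\<close>, contribute the other
    half.\<close>
  define \<delta> where "\<delta> = e / (C1 + C2)"
  have \<delta>: "\<delta> > 0" using e C1 C2 by (simp add: \<delta>_def)
  have e2: "\<delta> * e / 2 > 0" using \<delta> e by simp
  obtain \<rho>1 where \<rho>1: "0 < \<rho>1" "\<rho>1 < 1" "\<And>r s. \<lbrakk>\<rho>1 \<le> s; s < r; r < 1\<rbrakk> \<Longrightarrow>
    (\<integral>t. (norm (a (of_real r * cis t) - a (of_real s * cis t)))\<^sup>2 \<partial>circ) \<le> \<delta> * e / 2"
    by (rule hardy2_radii_diff_small[OF ab(1) e2]) blast
  obtain \<rho>2 where \<rho>2: "0 < \<rho>2" "\<rho>2 < 1" "\<And>r s. \<lbrakk>\<rho>2 \<le> s; s < r; r < 1\<rbrakk> \<Longrightarrow>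
    (\<integral>t. (norm (b (of_real r * cis t) - b (of_real s * cis t)))\<^sup>2 \<partial>circ) \<le> \<delta> * e / 2"
    by (rule hardy2_radii_diff_small[OF ab(2) e2]) blast
  show thesis
  proof (rule that[of "max \<rho>1 \<rho>2"])
    fix r s :: real assume "max \<rho>1 \<rho>2 \<le> s" "s < r" "r < 1"
    then have rs: "\<rho>1 \<le> s" "\<rho>2 \<le> s" "0 < s" "s < r" "0 < r" "r < 1" "s < 1" using \<rho>1(1) by auto
    define A where "A r t = a (of_real r * cis t)" for r t
    define B where "B r t = b (of_real r * cis t)" for r t
    have cont: "continuous_on UNIV (A r)" "continuous_on UNIV (A s)" "continuous_on UNIV (B r)" "continuous_on UNIV (B s)"
      unfolding A_def B_def using rs by (auto intro!: continuous_on_radius(4) hol)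
    have fAB: "f (of_real p * cis t) = A p t * B p t" if "0 < p" "p < 1" for p t
      unfolding A_def B_def using that by (intro ab(3)) (auto simp: norm_mult)
    have i: "integrable circ (\<lambda>t. (norm (A r t))\<^sup>2)" "integrable circ (\<lambda>t. (norm (B s t))\<^sup>2)"
      "integrable circ (\<lambda>t. (norm (B r t - B s t))\<^sup>2)" "integrable circ (\<lambda>t. (norm (A r t - A s t))\<^sup>2)"
      by (intro integrable_circ_continuous continuous_on_power continuous_on_norm continuous_on_diff cont)+
    define W where "W t = (\<delta> * (norm (A r t))\<^sup>2 + (norm (B r t - B s t))\<^sup>2 / \<delta>) / 2 +
       (\<delta> * (norm (B s t))\<^sup>2 + (norm (A r t - A s t))\<^sup>2 / \<delta>) / 2" for t
    have "(\<integral>t. norm (f (of_real r * cis t) - f (of_real s * cis t)) \<partial>circ) \<le> (\<integral>t. W t \<partial>circ)"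
    proof (rule integral_mono)
      show "integrable circ (\<lambda>t. norm (f (of_real r * cis t) - f (of_real s * cis t)))"
        using rs by (intro integrable_circ_continuous continuous_on_norm continuous_on_diff continuous_on_radius(4) hol) auto
      show "integrable circ W" unfolding W_def
        by (intro Bochner_Integration.integrable_add integrable_divide integrable_mult_right i)
      fix t
      have "f (of_real r * cis t) - f (of_real s * cis t) = A r t * (B r t - B s t) + B s t * (A r t - A s t)"
        using fAB rs by (simp add: algebra_simps)
      also have "norm \<dots> \<le> norm (A r t * (B r t - B s t)) + norm (B s t * (A r t - A s t))" by (rule norm_triangle_ineq)
      also have "\<dots> \<le> W t" unfolding W_def by (intro add_mono norm_mult_le_weighted_squares \<delta>)
      finally show "norm (f (of_real r * cis t) - f (of_real s * cis t)) \<le> W t" .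
    qed
    also have "(\<integral>t. W t \<partial>circ) = (\<delta> * (\<integral>t. (norm (A r t))\<^sup>2 \<partial>circ) + (\<integral>t. (norm (B r t - B s t))\<^sup>2 \<partial>circ) / \<delta>) / 2 +
       (\<delta> * (\<integral>t. (norm (B s t))\<^sup>2 \<partial>circ) + (\<integral>t. (norm (A r t - A s t))\<^sup>2 \<partial>circ) / \<delta>) / 2"
      unfolding W_def using i by simp
    also have "\<dots> \<le> (\<delta> * C1 + (\<delta> * e / 2) / \<delta>) / 2 + (\<delta> * C2 + (\<delta> * e / 2) / \<delta>) / 2"
    proof (intro add_mono divide_right_mono mult_left_mono)
      show "(\<integral>t. (norm (A r t))\<^sup>2 \<partial>circ) \<le> C1" using C1(2)[of r] rs by (simp add: sq_mean_def A_def)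
      show "(\<integral>t. (norm (B s t))\<^sup>2 \<partial>circ) \<le> C2" using C2(2)[of s] rs by (simp add: sq_mean_def B_def)
      show "(\<integral>t. (norm (B r t - B s t))\<^sup>2 \<partial>circ) \<le> \<delta> * e / 2" using \<rho>2(3)[of s r] rs by (simp add: B_def)
      show "(\<integral>t. (norm (A r t - A s t))\<^sup>2 \<partial>circ) \<le> \<delta> * e / 2" using \<rho>1(3)[of s r] rs by (simp add: A_def)
    qed (use \<delta> in auto)
    also have "\<dots> = e"
    proof -
      have "\<delta> * (C1 + C2) = e" using C1(1) C2(1) by (simp add: \<delta>_def)
      then show ?thesis using \<delta> by (simp add: field_simps)
    qed
    finally show "(\<integral>t. norm (f (of_real r * cis t) - f (of_real s * cis t)) \<partial>circ) \<le> e" .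
  qed (use \<rho>1 \<rho>2 in auto)
qed

section \<open>Boundary values in the mean\<close>

text \<open>Completeness of Lebesgue measure is what counts: \<open>boundary_value\<close> is a
  limit of continuous functions only almost everywhere and arbitrary elsewhere.\<close>

lemma borel_measurable_lebesgue_on_AE:
  fixes f g :: "'a::euclidean_space \<Rightarrow> 'b::euclidean_space"
  assumes f: "f \<in> borel_measurable (lebesgue_on S)" and S: "S \<in> sets lebesgue"
    and eq: "AE x in lebesgue_on S. f x = g x"
  shows "g \<in> borel_measurable (lebesgue_on S)"
proof -
  have "(\<lambda>x. if x \<in> S then f x else 0) \<in> borel_measurable lebesgue"
    using borel_measurable_if[OF S] f by blast
  moreover have "AE x in lebesgue. (if x \<in> S then f x else 0) = (if x \<in> S then g x else 0)"
    using eq S by (subst (asm) AE_restrict_space_iff) (auto elim: eventually_mono)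
  ultimately have "(\<lambda>x. if x \<in> S then g x else 0) \<in> borel_measurable lebesgue"
    by (rule borel_measurable_AE)
  then show ?thesis using borel_measurable_if[OF S] by blast
qed

text \<open>Measurability of limits and Fatou's lemma speak of sequences, boundary values of the
  filter \<open>at_left 1\<close>; this sequence mediates.\<close>

lemma seq_tendsto_at_left_1:
  obtains x :: "nat \<Rightarrow> real" where "\<And>n. 0 < x n" "\<And>n. x n < 1" "x \<longlonglongrightarrow> 1" "filterlim x (at_left 1) sequentially"
proof -
  define x where "x n = 1 - inverse (real (Suc (Suc n)))" for n
  have x: "0 < x n" "x n < 1" for n by (auto simp: x_def field_simps)
  have lim: "x \<longlonglongrightarrow> 1"
    unfolding x_def using tendsto_diff[OF tendsto_const LIMSEQ_Suc[OF LIMSEQ_inverse_real_of_nat], of 1] by simp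
  have "filterlim x (at_left 1) sequentially"
    unfolding filterlim_at
  proof
    show "\<forall>\<^sub>F n in sequentially. x n \<in> {..<1} \<and> x n \<noteq> 1"
      using x(2) by (intro always_eventually allI) (simp add: less_imp_neq)
  qed (rule lim)
  with x lim show thesis by (rule that)
qed

lemma boundary_value_measurable:
  assumes f: "f \<in> hardy1"
  shows "(\<lambda>t. boundary_value f (cis t)) \<in> borel_measurable circ"
proof -
  obtain x :: "nat \<Rightarrow> real" where x: "\<And>n. 0 < x n" "\<And>n. x n < 1" "x \<longlonglongrightarrow> 1" "filterlim x (at_left 1) sequentially"
    by (rule seq_tendsto_at_left_1) (rule that)
  have hol: "f holomorphic_on ball 0 1" using f by (simp add: hardy1_def)
  have m: "(\<lambda>t. f (of_real (x n) * cis t)) \<in> borel_measurable circ" for n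
    using x(1,2)[of n] by (intro borel_measurable_integrable integrable_circ_continuous continuous_on_radius(4) hol) auto
  have "(\<lambda>t. lim (\<lambda>n. f (of_real (x n) * cis t))) \<in> borel_measurable circ"
    by (rule borel_measurable_lim_metric[OF m])
  then show ?thesis
  proof (rule borel_measurable_lebesgue_on_AE)
    show "AE t in circ. lim (\<lambda>n. f (of_real (x n) * cis t)) = boundary_value f (cis t)"
      using hardy1_radial_limit[OF f]
      by eventually_elim (rule limI, erule filterlim_compose[OF _ x(4)])
  qed auto
qed

text \<open>Fatou's lemma: one radius is fixed while the other tends to 1 in the Cauchy estimate.
  Integrability of the difference is a result of the same bound.\<close>

lemma hardy1_boundary_approx:
  assumes f: "f \<in> hardy1" and e: "e > 0"
  obtains \<rho>0 where "0 < \<rho>0" "\<rho>0 < 1"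
    "\<And>r. \<lbrakk>\<rho>0 \<le> r; r < 1\<rbrakk> \<Longrightarrow> integrable circ (\<lambda>t. f (of_real r * cis t) - boundary_value f (cis t))"
    "\<And>r. \<lbrakk>\<rho>0 \<le> r; r < 1\<rbrakk> \<Longrightarrow> (\<integral>t. norm (f (of_real r * cis t) - boundary_value f (cis t)) \<partial>circ) \<le> e"
proof -
  have hol: "f holomorphic_on ball 0 1" using f by (simp add: hardy1_def)
  obtain \<rho>0 where \<rho>0: "0 < \<rho>0" "\<rho>0 < 1" "\<And>r s. \<lbrakk>\<rho>0 \<le> s; s < r; r < 1\<rbrakk> \<Longrightarrow>
    (\<integral>t. norm (f (of_real r * cis t) - f (of_real s * cis t)) \<partial>circ) \<le> e"
    by (rule hardy1_radii_diff_small[OF f e]) blast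
  obtain x :: "nat \<Rightarrow> real" where x: "\<And>n. 0 < x n" "\<And>n. x n < 1" "x \<longlonglongrightarrow> 1" "filterlim x (at_left 1) sequentially"
    by (rule seq_tendsto_at_left_1) (rule that)
  have cont: "continuous_on UNIV (\<lambda>t. f (of_real r * cis t))" if "0 < r" "r < 1" for r
    using that by (intro continuous_on_radius(4) hol) auto
  have main: "integrable circ (\<lambda>t. f (of_real r * cis t) - boundary_value f (cis t)) \<and>
    (\<integral>t. norm (f (of_real r * cis t) - boundary_value f (cis t)) \<partial>circ) \<le> e" if r: "\<rho>0 \<le> r" "r < 1" for r
  proof -
    have r0: "0 < r" using r \<rho>0 by linarith
    define u where "u n t = norm (f (of_real (x n) * cis t) - f (of_real r * cis t))" for n t
    define v where "v t = f (of_real r * cis t) - boundary_value f (cis t)" for t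
    have u_int: "integrable circ (u n)" for n
      unfolding u_def using x(1,2)[of n] r r0 by (intro integrable_circ_continuous continuous_on_norm continuous_on_diff cont) auto
    have v_meas: "v \<in> borel_measurable circ"
      unfolding v_def using r r0
      by (intro borel_measurable_diff boundary_value_measurable f borel_measurable_integrable integrable_circ_continuous cont) auto
    have u_small: "integral\<^sup>L circ (u n) \<le> e" if "r < x n" for n
      unfolding u_def using \<rho>0(3)[OF r(1) that x(2)] .
    have "(\<integral>\<^sup>+ t. ennreal (norm (v t)) \<partial>circ) = (\<integral>\<^sup>+ t. liminf (\<lambda>n. ennreal (u n t)) \<partial>circ)"
    proof (rule nn_integral_cong_AE)
      show "AE t in circ. ennreal (norm (v t)) = liminf (\<lambda>n. ennreal (u n t))"
        using hardy1_radial_limit[OF f]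
      proof eventually_elim
        fix t assume "((\<lambda>r. f (of_real r * cis t)) \<longlongrightarrow> boundary_value f (cis t)) (at_left 1)"
        from filterlim_compose[OF this x(4)]
        have "(\<lambda>n. u n t) \<longlonglongrightarrow> norm (boundary_value f (cis t) - f (of_real r * cis t))"
          unfolding u_def by (intro tendsto_intros)
        then have "(\<lambda>n. ennreal (u n t)) \<longlonglongrightarrow> ennreal (norm (v t))"
          by (simp add: v_def norm_minus_commute)
        then show "ennreal (norm (v t)) = liminf (\<lambda>n. ennreal (u n t))"
          by (intro lim_imp_Liminf[symmetric]) auto
      qed
    qed
    also have "\<dots> \<le> liminf (\<lambda>n. \<integral>\<^sup>+ t. ennreal (u n t) \<partial>circ)"
      by (rule nn_integral_liminf, rule measurable_compose[OF borel_measurable_integrable[OF u_int]]) simp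
    also have "\<dots> \<le> ennreal e"
    proof (rule Liminf_le)
      have "\<forall>\<^sub>F n in sequentially. r < x n" using order_tendstoD(1)[OF x(3) r(2)] .
      then show "\<forall>\<^sub>F n in sequentially. (\<integral>\<^sup>+ t. ennreal (u n t) \<partial>circ) \<le> ennreal e"
      proof eventually_elim
        fix n assume "r < x n"
        have "(\<integral>\<^sup>+ t. ennreal (u n t) \<partial>circ) = ennreal (integral\<^sup>L circ (u n))"
          by (intro nn_integral_eq_integral u_int) (simp add: u_def)
        then show "(\<integral>\<^sup>+ t. ennreal (u n t) \<partial>circ) \<le> ennreal e"
          using u_small[OF \<open>r < x n\<close>] by (simp add: ennreal_leI)
      qed
    qed auto
    finally have le: "(\<integral>\<^sup>+ t. ennreal (norm (v t)) \<partial>circ) \<le> ennreal e" .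
    have int: "integrable circ v"
      by (rule integrableI_bounded[OF v_meas]) (use le_less_trans[OF le ennreal_less_top] in simp)
    then have "(\<integral>\<^sup>+ t. ennreal (norm (v t)) \<partial>circ) = ennreal (\<integral>t. norm (v t) \<partial>circ)"
      by (intro nn_integral_eq_integral integrable_norm) auto
    with le e have "(\<integral>t. norm (v t) \<partial>circ) \<le> e" by (simp add: ennreal_le_iff)
    with int show ?thesis by (simp add: v_def[abs_def])
  qed
  show thesis by (rule that[OF \<rho>0(1,2) main[THEN conjunct1] main[THEN conjunct2]])
qed

lemma boundary_value_integrable:
  assumes f: "f \<in> hardy1"
  shows "integrable circ (\<lambda>t. boundary_value f (cis t))"
proof -
  obtain \<rho>0 where \<rho>0: "0 < \<rho>0" "\<rho>0 < 1"
    "\<And>r. \<lbrakk>\<rho>0 \<le> r; r < 1\<rbrakk> \<Longrightarrow> integrable circ (\<lambda>t. f (of_real r * cis t) - boundary_value f (cis t))"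
    by (rule hardy1_boundary_approx[OF f zero_less_one]) blast
  have "integrable circ (\<lambda>t. f (of_real \<rho>0 * cis t))"
    using f \<rho>0 by (intro integrable_circ_continuous continuous_on_radius(4)) (auto simp: hardy1_def)
  from Bochner_Integration.integrable_diff[OF this \<rho>0(3)[OF order_refl \<rho>0(2)]] show ?thesis by simp
qed

lemma integrable_mult_continuous_circ:
  fixes g :: "real \<Rightarrow> complex"
  assumes g: "integrable circ g" and \<phi>: "continuous_on (sphere 0 1) \<phi>"
  shows "integrable circ (\<lambda>t. g t * \<phi> (cis t))"
proof -
  have "compact (\<phi> ` sphere 0 1)" by (rule compact_continuous_image[OF \<phi>]) simp
  then obtain M where "\<forall>x\<in>\<phi> ` sphere 0 1. norm x \<le> M"
    using compact_imp_bounded bounded_iff by metis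
  then have M: "norm (\<phi> z) \<le> M" if "z \<in> sphere 0 1" for z using that by blast
  show ?thesis
  proof (rule Bochner_Integration.integrable_bound)
    show "integrable circ (\<lambda>t. norm (g t) * M)" using g by simp
    show "(\<lambda>t. g t * \<phi> (cis t)) \<in> borel_measurable circ"
      using g integrable_circ[OF \<phi>] by (intro borel_measurable_times) auto
    show "AE t in circ. norm (g t * \<phi> (cis t)) \<le> norm (norm (g t) * M)"
    proof (rule AE_I2)
      fix t
      have "norm (g t) * norm (\<phi> (cis t)) \<le> norm (g t) * M" using M[of "cis t"] by (intro mult_left_mono) auto
      then show "norm (g t * \<phi> (cis t)) \<le> norm (norm (g t) * M)" by (simp add: norm_mult)
    qed
  qed
qed

text \<open>A continuous \<phi> is bounded on the circle, so convergence in mean suffices. Through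
  this limit, identities proved by Cauchy's formula on smaller circles become statements about
  boundary values.\<close>

lemma hardy1_integral_limit:
  fixes \<phi> :: "complex \<Rightarrow> complex"
  assumes f: "f \<in> hardy1" and \<phi>: "continuous_on (sphere 0 1) \<phi>"
  shows "((\<lambda>r. \<integral>t. f (of_real r * cis t) * \<phi> (cis t) \<partial>circ) \<longlongrightarrow>
          (\<integral>t. boundary_value f (cis t) * \<phi> (cis t) \<partial>circ)) (at_left 1)"
proof (rule tendstoI)
  fix e :: real assume e: "e > 0"
  have hol: "f holomorphic_on ball 0 1" using f by (simp add: hardy1_def)
  have "compact (\<phi> ` sphere 0 1)" by (rule compact_continuous_image[OF \<phi>]) simp
  then obtain M where M0: "M > 0" "\<forall>x\<in>\<phi> ` sphere 0 1. norm x \<le> M"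
    using compact_imp_bounded bounded_pos by metis
  then have M: "M > 0" "\<And>z. z \<in> sphere 0 1 \<Longrightarrow> norm (\<phi> z) \<le> M" by blast+
  have e2: "e / (2 * M) > 0" using e M by simp
  obtain \<rho>0 where \<rho>0: "0 < \<rho>0" "\<rho>0 < 1"
    "\<And>r. \<lbrakk>\<rho>0 \<le> r; r < 1\<rbrakk> \<Longrightarrow> integrable circ (\<lambda>t. f (of_real r * cis t) - boundary_value f (cis t))"
    "\<And>r. \<lbrakk>\<rho>0 \<le> r; r < 1\<rbrakk> \<Longrightarrow> (\<integral>t. norm (f (of_real r * cis t) - boundary_value f (cis t)) \<partial>circ) \<le> e / (2 * M)"
    by (rule hardy1_boundary_approx[OF f e2]) blast
  have "\<forall>\<^sub>F r in at_left 1. r \<in> {\<rho>0<..<1}" by (rule eventually_at_left_real[OF \<rho>0(2)])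
  then show "\<forall>\<^sub>F r in at_left 1. dist (\<integral>t. f (of_real r * cis t) * \<phi> (cis t) \<partial>circ)
      (\<integral>t. boundary_value f (cis t) * \<phi> (cis t) \<partial>circ) < e"
  proof eventually_elim
    fix r assume "r \<in> {\<rho>0<..<1}"
    then have r: "\<rho>0 \<le> r" "r < 1" "0 < r" using \<rho>0 by auto
    let ?v = "\<lambda>t. f (of_real r * cis t) - boundary_value f (cis t)"
    have i1: "integrable circ (\<lambda>t. f (of_real r * cis t) * \<phi> (cis t))"
      using r by (intro integrable_mult_continuous_circ[OF _ \<phi>] integrable_circ_continuous continuous_on_radius(4) hol) auto
    have i2: "integrable circ (\<lambda>t. boundary_value f (cis t) * \<phi> (cis t))"
      by (intro integrable_mult_continuous_circ[OF _ \<phi>] boundary_value_integrable f)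
    have "dist (\<integral>t. f (of_real r * cis t) * \<phi> (cis t) \<partial>circ) (\<integral>t. boundary_value f (cis t) * \<phi> (cis t) \<partial>circ)
        = norm (\<integral>t. ?v t * \<phi> (cis t) \<partial>circ)"
      unfolding dist_norm Bochner_Integration.integral_diff[OF i1 i2, symmetric] by (simp add: algebra_simps)
    also have "\<dots> \<le> (\<integral>t. norm (?v t) * M \<partial>circ)"
    proof (rule Bochner_Integration.integral_norm_bound_integral)
      show "integrable circ (\<lambda>t. ?v t * \<phi> (cis t))" by (rule integrable_mult_continuous_circ[OF \<rho>0(3)[OF r(1,2)] \<phi>])
      show "integrable circ (\<lambda>t. norm (?v t) * M)" using \<rho>0(3)[OF r(1,2)] by simp
      fix t show "norm (?v t * \<phi> (cis t)) \<le> norm (?v t) * M"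
        unfolding norm_mult using M(2)[of "cis t"] by (intro mult_left_mono) auto
    qed
    also have "\<dots> = (\<integral>t. norm (?v t) \<partial>circ) * M" by simp
    also have "\<dots> \<le> e / (2 * M) * M" using \<rho>0(4)[OF r(1,2)] M by (intro mult_right_mono) auto
    also have "\<dots> < e" using M e by simp
    finally show "dist (\<integral>t. f (of_real r * cis t) * \<phi> (cis t) \<partial>circ)
      (\<integral>t. boundary_value f (cis t) * \<phi> (cis t) \<partial>circ) < e" .
  qed
qed

section \<open>Fourier coefficients of boundary functions\<close>

lemma hardy1_boundary_taylor:
  fixes f :: "complex \<Rightarrow> complex"
  assumes f: "f \<in> hardy1"
  shows "(\<integral>t. boundary_value f (cis t) * inverse (cis t) ^ k \<partial>circ) = 2 * pi * ((deriv ^^ k) f 0 / fact k)"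
proof (rule tendsto_unique)
  have hol: "f holomorphic_on ball 0 1" using f by (simp add: hardy1_def)
  show "((\<lambda>r. \<integral>t. f (of_real r * cis t) * inverse (cis t) ^ k \<partial>circ) \<longlongrightarrow>
      (\<integral>t. boundary_value f (cis t) * inverse (cis t) ^ k \<partial>circ)) (at_left 1)"
    by (rule hardy1_integral_limit[OF f]) (auto intro!: continuous_intros)
  have lim: "((\<lambda>r. 2 * pi * ((deriv ^^ k) f 0 / fact k * of_real r ^ k)) \<longlongrightarrow> 2 * pi * ((deriv ^^ k) f 0 / fact k * of_real 1 ^ k)) (at_left 1)"
    by (intro tendsto_intros)
  have "\<forall>\<^sub>F r in at_left 1. (\<integral>t. f (of_real r * cis t) * inverse (cis t) ^ k \<partial>circ) = 2 * pi * ((deriv ^^ k) f 0 / fact k * of_real r ^ k)"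
    using eventually_at_left_real[OF zero_less_one]
  proof eventually_elim
    fix r :: real assume "r \<in> {0<..<1}"
    then show "(\<integral>t. f (of_real r * cis t) * inverse (cis t) ^ k \<partial>circ) = 2 * pi * ((deriv ^^ k) f 0 / fact k * of_real r ^ k)"
      using taylor_coeff_circle[OF hol, of r k] by (simp add: Complex.DeMoivre cis_inverse)
  qed
  then show "((\<lambda>r. \<integral>t. f (of_real r * cis t) * inverse (cis t) ^ k \<partial>circ) \<longlongrightarrow> 2 * pi * ((deriv ^^ k) f 0 / fact k)) (at_left 1)"
    using lim by (simp add: tendsto_cong)
qed auto

text \<open>On smaller circles the integral is \<open>2 * pi\<close> times the value at 0 of a
  holomorphic function with the factor \<open>w ^ k\<close>. These are the Fourier coefficients of
  negative index.\<close>

lemma hardy1_boundary_orthogonal: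
  assumes f: "f \<in> hardy1" and k: "k > 0"
  shows "(\<integral>t. boundary_value f (cis t) * cis t ^ k \<partial>circ) = 0"
proof (rule tendsto_unique)
  have hol: "f holomorphic_on ball 0 1" using f by (simp add: hardy1_def)
  show "((\<lambda>r. \<integral>t. f (of_real r * cis t) * cis t ^ k \<partial>circ) \<longlongrightarrow>
      (\<integral>t. boundary_value f (cis t) * cis t ^ k \<partial>circ)) (at_left 1)"
    by (rule hardy1_integral_limit[OF f, of "\<lambda>z. z ^ k"]) (intro continuous_intros)
  have "\<forall>\<^sub>F r in at_left 1. (\<integral>t. f (of_real r * cis t) * cis t ^ k \<partial>circ) = 0"
    using eventually_at_left_real[OF zero_less_one]
  proof eventually_elim
    fix r :: real assume "r \<in> {0<..<1}"
    then have "continuous_on (cball 0 1) (\<lambda>w. f (of_real r * w) * w ^ k)" "(\<lambda>w. f (of_real r * w) * w ^ k) holomorphic_on ball 0 1"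
      by (auto intro!: continuous_on_mult holomorphic_on_mult continuous_on_radius(1,3)[OF hol] continuous_intros holomorphic_intros)
    from Cauchy_circle_mean[OF this, of 0] k show "(\<integral>t. f (of_real r * cis t) * cis t ^ k \<partial>circ) = 0" by simp
  qed
  then show "((\<lambda>r. \<integral>t. f (of_real r * cis t) * cis t ^ k \<partial>circ) \<longlongrightarrow> 0) (at_left 1)"
    by (rule tendsto_eventually)
qed auto

text \<open>A real function has conjugate Fourier coefficients at \<open>k\<close> and
  \<open>-k\<close>. Those of negative index vanish, hence so do all Taylor coefficients of positive
  index, and the one of index 0 is real.\<close>

lemma hardy1_real_boundary_constant:
  assumes f: "f \<in> hardy1" and real: "AE t in circ. boundary_value f (cis t) \<in> \<real>"
  obtains c where "\<And>w. w \<in> ball 0 1 \<Longrightarrow> f w = of_real c"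
proof -
  have hol: "f holomorphic_on ball 0 1" using f by (simp add: hardy1_def)
  have cnj_eq: "(\<integral>t. boundary_value f (cis t) * inverse (cis t) ^ k \<partial>circ) = cnj (\<integral>t. boundary_value f (cis t) * cis t ^ k \<partial>circ)" for k
  proof -
    have m: "(\<lambda>t. boundary_value f (cis t) * \<phi> (cis t)) \<in> borel_measurable circ"
      if "continuous_on (sphere 0 1) \<phi>" for \<phi>
      by (intro borel_measurable_integrable integrable_mult_continuous_circ boundary_value_integrable f that)
    have "(\<integral>t. boundary_value f (cis t) * inverse (cis t) ^ k \<partial>circ) = (\<integral>t. cnj (boundary_value f (cis t) * cis t ^ k) \<partial>circ)"
    proof (rule integral_cong_AE)
      show "(\<lambda>t. boundary_value f (cis t) * inverse (cis t) ^ k) \<in> borel_measurable circ"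
        by (rule m) (auto intro!: continuous_intros)
      have "(\<lambda>t. boundary_value f (cis t) * cis t ^ k) \<in> borel_measurable circ"
        by (rule m[of "\<lambda>z. z ^ k"]) (intro continuous_intros)
      then show "(\<lambda>t. cnj (boundary_value f (cis t) * cis t ^ k)) \<in> borel_measurable circ"
        by (rule measurable_compose) (intro borel_measurable_continuous_onI continuous_intros)
      show "AE t in circ. boundary_value f (cis t) * inverse (cis t) ^ k = cnj (boundary_value f (cis t) * cis t ^ k)"
        using real by eventually_elim (simp add: Reals_cnj_iff cis_cnj cis_inverse)
    qed
    then show ?thesis by (simp only: Bochner_Integration.integral_cnj)
  qed
  have zero: "(deriv ^^ k) f 0 / fact k = 0" if "k > 0" for k
    using hardy1_boundary_taylor[OF f, of k] hardy1_boundary_orthogonal[OF f that] cnj_eq[of k] by simp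
  have "cnj (2 * pi * f 0) = 2 * pi * f 0"
    using hardy1_boundary_taylor[OF f, of 0] cnj_eq[of 0] by simp
  then have "cnj (f 0) = f 0" by simp
  then have f0: "f 0 = of_real (Re (f 0))" using Reals_cnj_iff of_real_Re by metis
  show thesis
  proof (rule that)
    fix w :: complex assume w: "w \<in> ball 0 1"
    have "(\<lambda>k. (deriv ^^ k) f 0 / fact k * (w - 0) ^ k) sums f w"
      by (rule holomorphic_power_series[OF hol w])
    moreover have "(\<lambda>k. (deriv ^^ k) f 0 / fact k * (w - 0) ^ k) = (\<lambda>k. if k = 0 then f 0 else 0)"
      using zero by (auto simp: fun_eq_iff)
    ultimately have "(\<lambda>k. if k = 0 then f 0 else 0) sums f w" by simp
    then have "f w = f 0" using sums_single[of 0 "\<lambda>_. f 0"] sums_unique2 by blast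
    then show "f w = of_real (Re (f 0))" using f0 by simp
  qed
qed

section \<open>Norming functionals\<close>

lemma continuous_radial_limit:
  fixes G :: "complex \<Rightarrow> complex"
  assumes G: "continuous_on (cball 0 1) G" and z: "norm \<zeta> = 1"
  shows "((\<lambda>r. G (of_real r * \<zeta>)) \<longlongrightarrow> G \<zeta>) (at_left 1)"
proof -
  have "continuous_on {0..1} (\<lambda>r. G (of_real r * \<zeta>))"
    by (rule continuous_on_compose2[OF G]) (auto intro!: continuous_intros simp: norm_mult z)
  then have "\<forall>x\<in>{0..1}. ((\<lambda>r. G (of_real r * \<zeta>)) \<longlongrightarrow> G (of_real x * \<zeta>)) (at x within {0..1})"
    by (simp add: continuous_on_def)
  from bspec[OF this, of 1] show ?thesis by (simp add: at_within_Icc_at_left)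
qed

text \<open>Agreement is asked only in the open disc: elements of \<open>hardy1\<close> are
  arbitrary on the circle itself, whereas the formula \<open>G\<close> extends continuously and
  supplies the boundary values.\<close>

lemma disc_algebra_hardy1:
  assumes G: "continuous_on (cball 0 1) G" "G holomorphic_on ball 0 1"
    and eq: "\<And>z. z \<in> ball 0 1 \<Longrightarrow> f z = G z"
  shows disc_algebra_boundary_value: "\<And>\<zeta>. norm \<zeta> = 1 \<Longrightarrow> boundary_value f \<zeta> = G \<zeta>"
    and disc_algebra_in_hardy1: "f \<in> hardy1"
    and disc_algebra_norm: "hardy1_norm f = (\<integral>t. norm (G (cis t)) \<partial>circ) / (2 * pi)"
proof -
  show bv: "boundary_value f \<zeta> = G \<zeta>" if z: "norm \<zeta> = 1" for \<zeta>
    unfolding boundary_value_def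
  proof (rule tendsto_Lim)
    have "((\<lambda>r. G (of_real r * \<zeta>)) \<longlongrightarrow> G \<zeta>) (at_left 1)"
      by (rule continuous_radial_limit[OF G(1) z])
    moreover have "\<forall>\<^sub>F r in at_left 1. f (of_real r * \<zeta>) = G (of_real r * \<zeta>)"
      using eventually_at_left_real[OF zero_less_one]
      by eventually_elim (auto intro!: eq simp: norm_mult z)
    ultimately show "((\<lambda>r. f (of_real r * \<zeta>)) \<longlongrightarrow> G \<zeta>) (at_left 1)"
      by (subst tendsto_cong) simp_all
  qed simp
  have hol: "f holomorphic_on ball 0 1"
    using holomorphic_transform[OF G(2)] eq by simp
  have "compact (G ` cball 0 1)" by (rule compact_continuous_image[OF G(1)]) simp
  then obtain M where "\<forall>x\<in>G ` cball 0 1. norm x \<le> M"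
    using compact_imp_bounded bounded_iff by metis
  then have M: "norm (G z) \<le> M" if "z \<in> cball 0 1" for z using that by blast
  have "circle_mean (\<lambda>\<zeta>. norm (f (of_real r * \<zeta>))) \<le> M" if r: "0 \<le> r" "r < 1" for r
  proof -
    have "(\<integral>t. norm (f (of_real r * cis t)) \<partial>circ) \<le> (\<integral>t. M \<partial>circ)"
    proof (rule integral_mono)
      show "integrable circ (\<lambda>t. norm (f (of_real r * cis t)))"
        using r by (intro integrable_circ_continuous continuous_on_norm continuous_on_radius(4) hol) auto
      show "integrable circ (\<lambda>t. M)" by (intro integrable_circ_continuous continuous_on_const)
      show "norm (f (of_real r * cis t)) \<le> M" for t
        using eq[of "of_real r * cis t"] M[of "of_real r * cis t"] r by (simp add: norm_mult)
    qed
    also have "\<dots> = 2 * pi * M" by (subst integral_circ_const) simp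
    finally show ?thesis by (simp add: circle_mean_alt field_simps)
  qed
  then show "f \<in> hardy1" using hol by (auto simp: hardy1_def intro!: bdd_aboveI)
  show "hardy1_norm f = (\<integral>t. norm (G (cis t)) \<partial>circ) / (2 * pi)"
    unfolding hardy1_norm_def circle_mean_alt by (simp add: bv)
qed

section \<open>The kernel that represents a combination of evaluations\<close>

text \<open>Simple poles are what turns an integral against the kernel into point values, without
  derivatives; this is the use made of the distinctness of the \<beta>_k.\<close>

lemma partial_fractions_simple:
  fixes B :: "complex set"
  assumes "finite B" "B \<noteq> {}"
  shows "\<exists>w. \<forall>z. z \<notin> B \<longrightarrow> 1 / (\<Prod>b\<in>B. z - b) = (\<Sum>b\<in>B. w b / (z - b))"
  using assms
proof (induction B rule: finite_ne_induct)
  case (singleton x)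
  show ?case by (intro exI[of _ "\<lambda>_. 1"]) simp
next
  case (insert x B)
  obtain w where w: "\<And>z. z \<notin> B \<Longrightarrow> 1 / (\<Prod>b\<in>B. z - b) = (\<Sum>b\<in>B. w b / (z - b))"
    using insert.IH by blast
  \<comment> \<open>From \<open>1 / ((z - b) * (z - x)) = (1 / (z - b) - 1 / (z - x)) / (b -
    x)\<close>: each old weight is divided by \<open>b - x\<close>, and the new pole collects the
    negatives.\<close>
  define v where "v b = (if b = x then - (\<Sum>b\<in>B. w b / (b - x)) else w b / (b - x))" for b
  show ?case
  proof (intro exI[of _ v] allI impI)
    fix z assume z: "z \<notin> insert x B"
    have "1 / (\<Prod>b\<in>insert x B. z - b) = (\<Sum>b\<in>B. w b / (z - b)) / (z - x)"
      using w[of z] z insert.hyps by (simp add: divide_simps flip: divide_divide_eq_left)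
    also have "\<dots> = (\<Sum>b\<in>B. w b / (b - x) / (z - b) - w b / (b - x) / (z - x))"
      unfolding sum_divide_distrib
    proof (rule sum.cong[OF refl])
      fix b assume "b \<in> B"
      then have "b \<noteq> x" "z \<noteq> b" "z \<noteq> x" using z insert.hyps by auto
      then have nz: "b - x \<noteq> 0" "z - b \<noteq> 0" "z - x \<noteq> 0" by auto
      have "w b / (b - x) / (z - b) - w b / (b - x) / (z - x)
          = w b * ((z - x) - (z - b)) / ((b - x) * (z - b) * (z - x))"
        using nz by (simp add: divide_simps) (simp add: algebra_simps)
      also have "(z - x) - (z - b) = b - x" by simp
      finally show "w b / (z - b) / (z - x) = w b / (b - x) / (z - b) - w b / (b - x) / (z - x)"
        using nz by simp
    qed
    also have "\<dots> = (\<Sum>b\<in>B. w b / (b - x) / (z - b)) + v x / (z - x)"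
      by (simp add: sum_subtractf v_def sum_divide_distrib)
    also have "(\<Sum>b\<in>B. w b / (b - x) / (z - b)) = (\<Sum>b\<in>B. v b / (z - b))"
      using insert.hyps by (intro sum.cong) (auto simp: v_def)
    finally show "1 / (\<Prod>b\<in>insert x B. z - b) = (\<Sum>b\<in>insert x B. v b / (z - b))"
      using insert.hyps by (simp add: add.commute)
  qed
qed

text \<open>The witness is the reversed polynomial with conjugated coefficients. Reversal is at
  \<open>m\<close> and not at the degree, so that the power of \<open>z\<close> does not depend on
  \<open>q\<close>.\<close>

lemma conjugate_poly_on_circle:
  fixes q :: "complex poly"
  assumes "degree q \<le> m"
  obtains s where "\<And>z. norm z = 1 \<Longrightarrow> poly s z = z ^ m * cnj (poly q z)"
proof (rule that)
  fix z :: complex assume z: "norm z = 1"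
  then have zz: "z * cnj z = 1" by (simp add: complex_norm_square[symmetric])
  have q: "poly q z = (\<Sum>i\<le>m. coeff q i * z ^ i)"
    unfolding poly_altdef using assms by (intro sum.mono_neutral_left) (auto simp: coeff_eq_0)
  have "z ^ m * cnj (poly q z) = (\<Sum>i\<le>m. cnj (coeff q i) * (z ^ m * cnj z ^ i))"
    unfolding q by (simp add: sum_distrib_left mult_ac)
  also have "\<dots> = (\<Sum>i\<le>m. cnj (coeff q i) * z ^ (m - i))"
  proof (rule sum.cong[OF refl])
    fix i assume "i \<in> {..m}"
    then have "z ^ m = z ^ (m - i) * z ^ i" by (simp flip: power_add)
    then have "z ^ m * cnj z ^ i = z ^ (m - i) * (z * cnj z) ^ i" by (simp add: power_mult_distrib)
    then show "cnj (coeff q i) * (z ^ m * cnj z ^ i) = cnj (coeff q i) * z ^ (m - i)" by (simp add: zz)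
  qed
  finally show "poly (\<Sum>i\<le>m. monom (cnj (coeff q i)) (m - i)) z = z ^ m * cnj (poly q z)"
    by (simp add: poly_sum poly_monom)
qed

lemma kernel_denominator_nonzero:
  assumes "norm b < 1" "norm z \<le> 1"
  shows "1 - cnj b * z \<noteq> 0"
proof
  assume "1 - cnj b * z = 0"
  then have "norm (cnj b * z) = 1" by simp
  moreover have "norm (cnj b * z) \<le> norm b * 1" unfolding norm_mult using assms by (intro mult_mono) auto
  ultimately show False using assms by simp
qed

lemma kernel_P_disc_algebra:
  fixes \<beta> :: "complex ^ 'n"
  assumes "\<And>k. \<beta> $ k \<in> ball 0 1"
  shows "continuous_on (cball 0 1) (kernel_P \<beta>)" "kernel_P \<beta> holomorphic_on ball 0 1"
    "z \<in> cball 0 1 \<Longrightarrow> kernel_P \<beta> z \<noteq> 0"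
proof -
  have nz: "1 - cnj (\<beta> $ k) * z \<noteq> 0" if "norm z \<le> 1" for k z
    using assms[of k] that by (intro kernel_denominator_nonzero) auto
  show "continuous_on (cball 0 1) (kernel_P \<beta>)"
    unfolding kernel_P_def[abs_def] using nz by (intro continuous_intros) auto
  show "kernel_P \<beta> holomorphic_on ball 0 1"
    unfolding kernel_P_def[abs_def] using nz by (intro holomorphic_intros) auto
  show "z \<in> cball 0 1 \<Longrightarrow> kernel_P \<beta> z \<noteq> 0"
    unfolding kernel_P_def using nz by auto
qed

text \<open>On the circle \<open>cnj F / \<bar>F\<bar>\<close> coincides with a rational function whose only poles in the
  closed disc are simple ones at the \<open>\<beta>\<^sub>k\<close>, so it represents a combination of the evaluations.\<close>

lemma extremal_functional:
  fixes \<beta> :: "complex ^ 'n" and q :: "complex poly"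
  assumes inj: "inj (\<lambda>k. \<beta> $ k)" and \<beta>: "\<And>k. \<beta> $ k \<in> ball 0 1"
    and deg: "degree q \<le> CARD('n) - 1" and q: "\<And>z. z \<in> cball 0 1 \<Longrightarrow> poly q z \<noteq> 0"
  defines "Fc \<equiv> \<lambda>z. (poly q z)\<^sup>2 * kernel_P \<beta> z"
  obtains c :: "complex ^ 'n" and \<phi> where "continuous_on (sphere 0 1) \<phi>"
    "\<And>z. norm z = 1 \<Longrightarrow> \<phi> z * Fc z = of_real (norm (Fc z))"
    "\<And>f. f \<in> hardy1 \<Longrightarrow> (\<integral>t. boundary_value f (cis t) * \<phi> (cis t) \<partial>circ) = 2 * pi * (\<Sum>k\<in>UNIV. c $ k * f (\<beta> $ k))"
proof -
  define m where "m = CARD('n) - 1"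
  have m: "Suc m = CARD('n)" by (simp add: m_def)
  obtain s where s: "\<And>z. norm z = 1 \<Longrightarrow> poly s z = z ^ m * cnj (poly q z)"
    using conjugate_poly_on_circle deg unfolding m_def by blast
  define N where "N z = (\<Prod>k\<in>UNIV. 1 - cnj (\<beta> $ k) * z)" for z
  define D where "D z = (\<Prod>k\<in>UNIV. z - \<beta> $ k)" for z
  \<comment> \<open>Since \<open>kernel_P\<close> is \<open>1 / N^2\<close>,
    \<open>cnj F / norm F\<close> equals \<open>(cnj q / q) * (N / cnj N)\<close>. On the circle
    \<open>cnj q = s / z ^ m\<close> and \<open>cnj N = D / z ^ Suc m\<close>, which leaves
    \<open>z * s * N / (q * D)\<close>. The single factor \<open>z\<close> is the
    \<open>cis t\<close> in the numerator of the Cauchy mean.\<close>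
  define R where "R z = poly s z * N z / poly q z" for z
  define \<phi> where "\<phi> z = z * R z / D z" for z
  have \<beta>_norm: "norm (\<beta> $ k) < 1" for k using \<beta>[of k] by simp
  have D_nz: "D z \<noteq> 0" if "norm z = 1" for z
    unfolding D_def using that \<beta>_norm by (auto simp: less_le)
  have N_nz: "N z \<noteq> 0" if "norm z \<le> 1" for z
    unfolding N_def using kernel_denominator_nonzero[OF \<beta>_norm that] by simp
  have R_cont: "continuous_on (cball 0 1) R" and R_hol: "R holomorphic_on ball 0 1"
    unfolding R_def N_def using q by (auto intro!: continuous_intros holomorphic_intros)
  have \<phi>_cont: "continuous_on (sphere 0 1) \<phi>"
  proof -
    have "continuous_on (sphere 0 1) R" by (rule continuous_on_subset[OF R_cont]) auto
    moreover have "continuous_on (sphere 0 1) D" unfolding D_def by (intro continuous_intros)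
    ultimately show ?thesis unfolding \<phi>_def using D_nz by (intro continuous_intros) auto
  qed
  have P_N: "kernel_P \<beta> z = 1 / (N z)\<^sup>2" for z
    unfolding kernel_P_def N_def by (simp add: prod_dividef prod_power_distrib)
  have \<phi>_Fc: "\<phi> z * Fc z = of_real (norm (Fc z))" if z: "norm z = 1" for z
  proof -
    have zz: "z * cnj z = 1" using z by (simp add: complex_norm_square[symmetric])
    have z0: "z \<noteq> 0" using z by auto
    have qz: "poly q z \<noteq> 0" using q[of z] z by simp
    have Nz: "N z \<noteq> 0" using N_nz[of z] z by simp
    have "D z = (\<Prod>k\<in>UNIV. z * cnj (1 - cnj (\<beta> $ k) * z))"
      unfolding D_def
    proof (rule prod.cong[OF refl])
      fix k
      have "z * cnj (1 - cnj (\<beta> $ k) * z) = z - \<beta> $ k * (z * cnj z)" by (simp add: algebra_simps)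
      then show "z - \<beta> $ k = z * cnj (1 - cnj (\<beta> $ k) * z)" by (simp add: zz)
    qed
    then have D: "D z = z ^ CARD('n) * cnj (N z)" by (simp add: N_def prod.distrib)
    have "\<phi> z * Fc z = z * poly s z * poly q z / (D z * N z)"
      using qz Nz by (simp add: \<phi>_def R_def Fc_def P_N power2_eq_square)
    also have "\<dots> = z ^ Suc m * (poly q z * cnj (poly q z)) / (z ^ Suc m * (N z * cnj (N z)))"
      by (simp add: s[OF z] D m[symmetric] mult_ac)
    also have "\<dots> = of_real ((norm (poly q z))\<^sup>2 / (norm (N z))\<^sup>2)"
      using z0 by (simp add: complex_norm_square[symmetric])
    also have "(norm (poly q z))\<^sup>2 / (norm (N z))\<^sup>2 = norm (Fc z)"
      by (simp add: Fc_def P_N norm_mult norm_divide norm_power)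
    finally show ?thesis .
  qed
  define B where "B = range (\<lambda>k. \<beta> $ k)"
  have "finite B" "B \<noteq> {}" by (auto simp: B_def)
  from partial_fractions_simple[OF this] obtain w where
    w: "\<And>z. z \<notin> B \<Longrightarrow> 1 / (\<Prod>b\<in>B. z - b) = (\<Sum>b\<in>B. w b / (z - b))" by blast
  have D_inv: "1 / D z = (\<Sum>k\<in>UNIV. w (\<beta> $ k) / (z - \<beta> $ k))" if z: "norm z = 1" for z
  proof -
    have "z \<notin> B" using z \<beta>_norm by (auto simp: B_def less_le)
    moreover have "(\<Prod>b\<in>B. z - b) = D z"
      unfolding B_def D_def using inj by (simp add: prod.reindex)
    moreover have "(\<Sum>b\<in>B. w b / (z - b)) = (\<Sum>k\<in>UNIV. w (\<beta> $ k) / (z - \<beta> $ k))"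
      unfolding B_def using inj by (simp add: sum.reindex)
    ultimately show ?thesis using w[of z] by simp
  qed
  define c :: "complex ^ 'n" where "c = (\<chi> k. w (\<beta> $ k) * R (\<beta> $ k))"
  \<comment> \<open>For \<open>r < 1\<close> the integrand is continuous up to the circle, so
    Cauchy's formula applies at each pole; the case of boundary values follows as \<open>r\<close>
    tends to 1.\<close>
  have rep: "(\<integral>t. f (of_real r * cis t) * \<phi> (cis t) \<partial>circ) = 2 * pi * (\<Sum>k\<in>UNIV. c $ k * f (of_real r * \<beta> $ k))"
    if f: "f holomorphic_on ball 0 1" and r: "0 < r" "r < 1" for f r
  proof -
    define h where "h z = f (of_real r * z) * R z" for z
    have h: "continuous_on (cball 0 1) h" "h holomorphic_on ball 0 1"
      unfolding h_def using continuous_on_radius(1,3)[OF f, of r] r R_cont R_hol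
      by (auto intro!: continuous_on_mult holomorphic_on_mult)
    have hs: "continuous_on (sphere 0 1) h" by (rule continuous_on_subset[OF h(1)]) auto
    have "f (of_real r * cis t) * \<phi> (cis t) = (\<Sum>k\<in>UNIV. w (\<beta> $ k) * (h (cis t) * cis t / (cis t - \<beta> $ k)))" for t
    proof -
      have "f (of_real r * cis t) * \<phi> (cis t) = h (cis t) * cis t * (1 / D (cis t))"
        by (simp add: \<phi>_def h_def)
      also have "\<dots> = (\<Sum>k\<in>UNIV. w (\<beta> $ k) * (h (cis t) * cis t / (cis t - \<beta> $ k)))"
        by (simp add: D_inv sum_distrib_left mult_ac)
      finally show ?thesis .
    qed
    then have "(\<integral>t. f (of_real r * cis t) * \<phi> (cis t) \<partial>circ) =
        (\<integral>t. (\<Sum>k\<in>UNIV. w (\<beta> $ k) * (h (cis t) * cis t / (cis t - \<beta> $ k))) \<partial>circ)" by simp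
    also have "\<dots> = (\<Sum>k\<in>UNIV. \<integral>t. w (\<beta> $ k) * (h (cis t) * cis t / (cis t - \<beta> $ k)) \<partial>circ)"
    proof (rule Bochner_Integration.integral_sum)
      fix k
      have "continuous_on (sphere 0 1) (\<lambda>z. w (\<beta> $ k) * (h z * z / (z - \<beta> $ k)))"
        using \<beta>_norm[of k] by (intro continuous_intros hs) auto
      then show "integrable circ (\<lambda>t. w (\<beta> $ k) * (h (cis t) * cis t / (cis t - \<beta> $ k)))"
        by (rule integrable_circ)
    qed
    also have "\<dots> = (\<Sum>k\<in>UNIV. w (\<beta> $ k) * (2 * pi * h (\<beta> $ k)))"
      by (simp only: integral_mult_right_zero Cauchy_circle_mean[OF h \<beta>_norm])
    also have "\<dots> = 2 * pi * (\<Sum>k\<in>UNIV. c $ k * f (of_real r * \<beta> $ k))"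
      by (simp add: c_def h_def sum_distrib_left mult_ac)
    finally show ?thesis .
  qed
  show thesis
  proof (rule that[OF \<phi>_cont \<phi>_Fc])
    fix f assume f: "f \<in> hardy1"
    then have hol: "f holomorphic_on ball 0 1" by (simp add: hardy1_def)
    show "(\<integral>t. boundary_value f (cis t) * \<phi> (cis t) \<partial>circ) = 2 * pi * (\<Sum>k\<in>UNIV. c $ k * f (\<beta> $ k))"
    proof (rule tendsto_unique)
      show "((\<lambda>r. \<integral>t. f (of_real r * cis t) * \<phi> (cis t) \<partial>circ) \<longlongrightarrow> (\<integral>t. boundary_value f (cis t) * \<phi> (cis t) \<partial>circ)) (at_left 1)"
        by (rule hardy1_integral_limit[OF f \<phi>_cont])
      have "((\<lambda>r. f (of_real r * \<beta> $ k)) \<longlongrightarrow> f (\<beta> $ k)) (at_left 1)" for k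
      proof (rule isCont_tendsto_compose[of _ f])
        show "isCont f (\<beta> $ k)"
          using \<beta>[of k] by (intro field_differentiable_imp_continuous_at holomorphic_on_imp_differentiable_at[OF hol]) auto
        have "((\<lambda>r. of_real r * \<beta> $ k) \<longlongrightarrow> of_real 1 * \<beta> $ k) (at_left 1)" by (intro tendsto_intros)
        then show "((\<lambda>r. of_real r * \<beta> $ k) \<longlongrightarrow> \<beta> $ k) (at_left 1)" by simp
      qed
      then have lim: "((\<lambda>r. 2 * pi * (\<Sum>k\<in>UNIV. c $ k * f (of_real r * \<beta> $ k))) \<longlongrightarrow> 2 * pi * (\<Sum>k\<in>UNIV. c $ k * f (\<beta> $ k))) (at_left 1)"
        by (intro tendsto_intros)
      have "\<forall>\<^sub>F r in at_left 1. (\<integral>t. f (of_real r * cis t) * \<phi> (cis t) \<partial>circ) = 2 * pi * (\<Sum>k\<in>UNIV. c $ k * f (of_real r * \<beta> $ k))"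
        using eventually_at_left_real[OF zero_less_one] by eventually_elim (rule rep[OF hol]; simp)
      then show "((\<lambda>r. \<integral>t. f (of_real r * cis t) * \<phi> (cis t) \<partial>circ) \<longlongrightarrow> 2 * pi * (\<Sum>k\<in>UNIV. c $ k * f (\<beta> $ k))) (at_left 1)"
        using lim by (simp add: tendsto_cong)
    qed auto
  qed
qed

text \<open>Compactness bounds \<open>1 / G\<close> on the closed disc. A zero of \<open>G\<close>
  on the circle would make it unbounded, which is why zeros there matter.\<close>

lemma hardy1_divide:
  assumes f: "f \<in> hardy1" and G: "continuous_on (cball 0 1) G" "G holomorphic_on ball 0 1"
    and nz: "\<And>z. z \<in> cball 0 1 \<Longrightarrow> G z \<noteq> 0"
  shows "(\<lambda>z. f z / G z) \<in> hardy1"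
    and "AE t in circ. boundary_value (\<lambda>z. f z / G z) (cis t) = boundary_value f (cis t) / G (cis t)"
proof -
  have hol: "f holomorphic_on ball 0 1" using f by (simp add: hardy1_def)
  have gh: "(\<lambda>z. f z / G z) holomorphic_on ball 0 1"
    using nz by (intro holomorphic_on_divide hol G) auto
  have "continuous_on (cball 0 1) (\<lambda>z. 1 / G z)" using nz by (intro continuous_intros G) auto
  then have "compact ((\<lambda>z. 1 / G z) ` cball 0 1)" by (rule compact_continuous_image) simp
  then obtain M where "\<forall>x\<in>(\<lambda>z. 1 / G z) ` cball 0 1. norm x \<le> M"
    using compact_imp_bounded bounded_iff by metis
  then have M: "norm (1 / G z) \<le> M" if "z \<in> cball 0 1" for z using that by blast
  have M0: "M \<ge> 0" using order_trans[OF norm_ge_zero M[of 0]] by simp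
  obtain C where C: "\<And>r. \<lbrakk>0 \<le> r; r < 1\<rbrakk> \<Longrightarrow> (\<integral>t. norm (f (of_real r * cis t)) \<partial>circ) \<le> C"
    using hardy1_mean_bound[OF f] by metis
  have "circle_mean (\<lambda>\<zeta>. norm (f (of_real r * \<zeta>) / G (of_real r * \<zeta>))) \<le> M * C / (2 * pi)" if r: "0 \<le> r" "r < 1" for r
  proof -
    have "(\<integral>t. norm (f (of_real r * cis t) / G (of_real r * cis t)) \<partial>circ) \<le> (\<integral>t. M * norm (f (of_real r * cis t)) \<partial>circ)"
    proof (rule integral_mono)
      show "integrable circ (\<lambda>t. norm (f (of_real r * cis t) / G (of_real r * cis t)))"
        using r by (intro integrable_circ_continuous continuous_on_norm continuous_on_radius(4)[OF gh]) auto
      show "integrable circ (\<lambda>t. M * norm (f (of_real r * cis t)))"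
        using r by (intro integrable_mult_right integrable_circ_continuous continuous_on_norm continuous_on_radius(4)[OF hol]) auto
      fix t
      have "norm (f (of_real r * cis t)) * norm (1 / G (of_real r * cis t)) \<le> norm (f (of_real r * cis t)) * M"
        using r by (intro mult_left_mono M) (auto simp: norm_mult)
      then show "norm (f (of_real r * cis t) / G (of_real r * cis t)) \<le> M * norm (f (of_real r * cis t))"
        by (simp add: norm_divide mult.commute)
    qed
    also have "\<dots> \<le> M * C" using C[OF r] M0 by (simp add: mult_left_mono)
    finally show ?thesis by (simp add: circle_mean_alt divide_right_mono)
  qed
  then show "(\<lambda>z. f z / G z) \<in> hardy1" using gh by (auto simp: hardy1_def intro!: bdd_aboveI)
  show "AE t in circ. boundary_value (\<lambda>z. f z / G z) (cis t) = boundary_value f (cis t) / G (cis t)"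
    using hardy1_radial_limit[OF f]
  proof eventually_elim
    fix t assume 1: "((\<lambda>r. f (of_real r * cis t)) \<longlongrightarrow> boundary_value f (cis t)) (at_left 1)"
    have "((\<lambda>r. G (of_real r * cis t)) \<longlongrightarrow> G (cis t)) (at_left 1)"
      by (rule continuous_radial_limit[OF G(1)]) simp
    from tendsto_divide[OF 1 this] nz[of "cis t"]
    show "boundary_value (\<lambda>z. f z / G z) (cis t) = boundary_value f (cis t) / G (cis t)"
      unfolding boundary_value_def[of "\<lambda>z. f z / G z"] by (intro tendsto_Lim) auto
  qed
qed

lemma exposed_if_no_zeros:
  fixes \<beta> :: "complex ^ 'n" and F :: "complex \<Rightarrow> complex" and q :: "complex poly"
  assumes inj: "inj (\<lambda>k. \<beta> $ k)" and \<beta>: "\<And>k. \<beta> $ k \<in> ball 0 1"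
    and F: "F \<in> hardy1" "hardy1_norm F = 1"
    and deg: "degree q \<le> CARD('n) - 1" and q: "\<And>z. z \<in> cball 0 1 \<Longrightarrow> poly q z \<noteq> 0"
    and F_eq: "\<And>z. z \<in> ball 0 1 \<Longrightarrow> F z = (poly q z)\<^sup>2 * kernel_P \<beta> z"
  shows "eval_at \<beta> F exposed_point_of value_body \<beta>"
proof -
  define Fc where "Fc z = (poly q z)\<^sup>2 * kernel_P \<beta> z" for z
  obtain c :: "complex ^ 'n" and \<phi> where \<phi>: "continuous_on (sphere 0 1) \<phi>"
    and \<phi>_Fc: "\<And>z. norm z = 1 \<Longrightarrow> \<phi> z * Fc z = of_real (norm (Fc z))"
    and rep: "\<And>f. f \<in> hardy1 \<Longrightarrow> (\<integral>t. boundary_value f (cis t) * \<phi> (cis t) \<partial>circ) = 2 * pi * (\<Sum>k\<in>UNIV. c $ k * f (\<beta> $ k))"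
    by (rule extremal_functional[OF inj \<beta> deg q, folded Fc_def], assumption) (rule that)
  note P = kernel_P_disc_algebra[OF \<beta>]
  have Fc: "continuous_on (cball 0 1) Fc" "Fc holomorphic_on ball 0 1" "\<And>z. z \<in> cball 0 1 \<Longrightarrow> Fc z \<noteq> 0"
    unfolding Fc_def using P q by (auto intro!: continuous_intros holomorphic_intros)
  have F_Fc: "\<And>z. z \<in> ball 0 1 \<Longrightarrow> F z = Fc z" using F_eq by (simp add: Fc_def)
  note DF = disc_algebra_hardy1[OF Fc(1,2) F_Fc]
  have \<phi>_norm: "norm (\<phi> z) = 1" if "norm z = 1" for z
  proof -
    have "norm (\<phi> z) * norm (Fc z) = norm (Fc z)" using \<phi>_Fc[OF that] by (metis norm_mult norm_of_real abs_norm_cancel)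
    then show ?thesis using Fc(3)[of z] that by simp
  qed
  define L where "L f = (\<Sum>k\<in>UNIV. c $ k * f (\<beta> $ k))" for f
  have norm_int: "(\<integral>t. norm (boundary_value f (cis t)) \<partial>circ) = 2 * pi * hardy1_norm f" for f
    by (simp add: hardy1_norm_def circle_mean_alt)
  have int_bv: "integrable circ (\<lambda>t. boundary_value f (cis t) * \<phi> (cis t))"
    "integrable circ (\<lambda>t. norm (boundary_value f (cis t)))" if "f \<in> hardy1" for f
    using integrable_mult_continuous_circ[OF boundary_value_integrable[OF that] \<phi>] boundary_value_integrable[OF that] by auto
  have Re_L: "2 * pi * Re (L f) = (\<integral>t. Re (boundary_value f (cis t) * \<phi> (cis t)) \<partial>circ)" if "f \<in> hardy1" for f
  proof -
    have "(\<integral>t. Re (boundary_value f (cis t) * \<phi> (cis t)) \<partial>circ) = Re (\<integral>t. boundary_value f (cis t) * \<phi> (cis t) \<partial>circ)"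
      by (rule integral_Re[OF int_bv(1)[OF that]])
    then show ?thesis by (simp add: rep[OF that] L_def)
  qed
  have gap: "Re (boundary_value f (cis t) * \<phi> (cis t)) \<le> norm (boundary_value f (cis t))" for f t
    using complex_Re_le_cmod[of "boundary_value f (cis t) * \<phi> (cis t)"] \<phi>_norm[of "cis t"] by (simp add: norm_mult)
  have upper: "Re (L f) \<le> hardy1_norm f" if f: "f \<in> hardy1" for f
  proof -
    have "2 * pi * Re (L f) \<le> 2 * pi * hardy1_norm f"
      unfolding Re_L[OF f] norm_int[symmetric]
      by (rule integral_mono[OF integrable_Re[OF int_bv(1)[OF f]] int_bv(2)[OF f] gap])
    then show ?thesis by simp
  qed
  have LF: "L F = 1"
  proof -
    have "(\<integral>t. boundary_value F (cis t) * \<phi> (cis t) \<partial>circ) = (\<integral>t. complex_of_real (norm (boundary_value F (cis t))) \<partial>circ)"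
    proof (rule Bochner_Integration.integral_cong[OF refl])
      fix t show "boundary_value F (cis t) * \<phi> (cis t) = complex_of_real (norm (boundary_value F (cis t)))"
        using \<phi>_Fc[of "cis t"] DF(1)[of "cis t"] by (simp add: mult.commute)
    qed
    also have "\<dots> = of_real (2 * pi * hardy1_norm F)" by (simp only: integral_complex_of_real norm_int)
    finally show ?thesis using rep[OF F(1)] F(2) by (simp add: L_def)
  qed
  have unique: "eval_at \<beta> f = eval_at \<beta> F" if f: "f \<in> hardy1" "hardy1_norm f \<le> 1" "Re (L f) = 1" for f
  proof -
    \<comment> \<open>Equality in the norm estimate means that this nonnegative function has
      integral 0, so it vanishes almost everywhere.\<close>
    define gap_fun where "gap_fun t = norm (boundary_value f (cis t)) - Re (boundary_value f (cis t) * \<phi> (cis t))" for t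
    have gi: "integrable circ gap_fun"
      unfolding gap_fun_def using int_bv[OF f(1)] by (intro Bochner_Integration.integrable_diff integrable_Re) auto
    have "integral\<^sup>L circ gap_fun = 2 * pi * hardy1_norm f - 2 * pi * Re (L f)"
      unfolding gap_fun_def Re_L[OF f(1)] norm_int[symmetric] using int_bv[OF f(1)]
      by (intro Bochner_Integration.integral_diff integrable_Re) auto
    moreover have "hardy1_norm f = 1" using upper[OF f(1)] f by simp
    ultimately have "integral\<^sup>L circ gap_fun = 0" using f(3) by simp
    moreover have "AE t in circ. 0 \<le> gap_fun t" using gap by (intro AE_I2) (simp add: gap_fun_def)
    ultimately have "AE t in circ. gap_fun t = 0"
      using integral_nonneg_eq_0_iff_AE[OF gi] by blast
    moreover have "AE t in circ. boundary_value (\<lambda>z. f z / Fc z) (cis t) = boundary_value f (cis t) / Fc (cis t)"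
      by (rule hardy1_divide(2)[OF f(1) Fc])
    ultimately have real: "AE t in circ. boundary_value (\<lambda>z. f z / Fc z) (cis t) \<in> \<real>"
    proof eventually_elim
      fix t assume gz: "gap_fun t = 0" and bv: "boundary_value (\<lambda>z. f z / Fc z) (cis t) = boundary_value f (cis t) / Fc (cis t)"
      let ?v = "boundary_value f (cis t) * \<phi> (cis t)"
      have "Re ?v = norm ?v" using gz \<phi>_norm[of "cis t"] by (simp add: gap_fun_def norm_mult)
      then have "(Im ?v)\<^sup>2 = 0" using cmod_power2[of ?v] by simp
      then have "?v \<in> \<real>" by (simp add: complex_is_Real_iff)
      \<comment> \<open>Since \<open>\<phi> * Fc\<close> is \<open>norm Fc\<close> on the circle,
        dividing by \<open>Fc\<close> is multiplying by \<phi> up to a positive real factor.\<close>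
      moreover have "boundary_value f (cis t) / Fc (cis t) = ?v / of_real (norm (Fc (cis t)))"
      proof -
        have "\<phi> (cis t) \<noteq> 0" using \<phi>_norm[of "cis t"] by auto
        then show ?thesis using \<phi>_Fc[of "cis t", symmetric] by simp
      qed
      ultimately show "boundary_value (\<lambda>z. f z / Fc z) (cis t) \<in> \<real>"
        unfolding bv by (metis Reals_divide Reals_of_real)
    qed
    have "(\<lambda>z. f z / Fc z) \<in> hardy1" by (rule hardy1_divide(1)[OF f(1) Fc])
    then obtain a where a: "\<And>w. w \<in> ball 0 1 \<Longrightarrow> f w / Fc w = of_real a"
      by (rule hardy1_real_boundary_constant[OF _ real]) (rule that)
    have fa: "f w = of_real a * F w" if "w \<in> ball 0 1" for w
      using a[OF that] Fc(3)[of w] F_Fc[OF that] that by (simp add: divide_eq_eq)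
    \<comment> \<open>A real multiple of \<open>F\<close> on which \<open>L\<close> has real part 1
      is \<open>F\<close> itself, because \<open>L F = 1\<close>.\<close>
    have "L f = of_real a * L F"
      using \<beta> by (simp add: L_def fa sum_distrib_left mult_ac)
    then have "a = 1" using LF f(3) by simp
    then show ?thesis using fa \<beta> by (simp add: eval_at_def)
  qed
  have L_eval: "(\<Sum>k\<in>UNIV. c $ k * eval_at \<beta> f $ k) = L f" for f by (simp add: L_def eval_at_def)
  show ?thesis
    unfolding exposed_point_of_def
  proof (intro exI[of _ c] exI[of _ "1::real"] conjI)
    show "c \<noteq> 0" using LF by (auto simp: L_def)
    show "value_body \<beta> \<subseteq> {w. Re (\<Sum>k\<in>UNIV. c $ k * w $ k) \<le> 1}"
    proof
      fix w assume "w \<in> value_body \<beta>"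
      then obtain f where f: "f \<in> hardy1" "hardy1_norm f \<le> 1" "w = eval_at \<beta> f" by (auto simp: value_body_def)
      show "w \<in> {w. Re (\<Sum>k\<in>UNIV. c $ k * w $ k) \<le> 1}"
        unfolding mem_Collect_eq f(3) L_eval using upper[OF f(1)] f(2) by linarith
    qed
    show "value_body \<beta> \<inter> {w. Re (\<Sum>k\<in>UNIV. c $ k * w $ k) = 1} = {eval_at \<beta> F}"
    proof
      show "value_body \<beta> \<inter> {w. Re (\<Sum>k\<in>UNIV. c $ k * w $ k) = 1} \<subseteq> {eval_at \<beta> F}"
      proof
        fix w assume w: "w \<in> value_body \<beta> \<inter> {w. Re (\<Sum>k\<in>UNIV. c $ k * w $ k) = 1}"
        then obtain f where f: "f \<in> hardy1" "hardy1_norm f \<le> 1" "w = eval_at \<beta> f" by (auto simp: value_body_def)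
        with w have "Re (L f) = 1" by (simp only: L_eval Int_iff mem_Collect_eq)
        then show "w \<in> {eval_at \<beta> F}" using unique f by simp
      qed
      have "eval_at \<beta> F \<in> value_body \<beta>" using F by (auto simp: value_body_def)
      then show "{eval_at \<beta> F} \<subseteq> value_body \<beta> \<inter> {w. Re (\<Sum>k\<in>UNIV. c $ k * w $ k) = 1}"
        by (simp only: L_eval LF Int_iff mem_Collect_eq insert_subset empty_subsetI one_complex.sel simp_thms)
    qed
  qed
qed

section \<open>Zeros on the circle\<close>

text \<open>The preimage of \<zeta> is contained in one countable set of translates by
  \<open>2 * pi\<close>; so the factor \<open>norm (z - \<zeta>)\<close> vanishes only on a null set
  of parameters.\<close>

lemma AE_cis_neq: "AE t in circ. cis t \<noteq> \<zeta>"
proof (cases "\<exists>\<theta>. \<zeta> = cis \<theta>")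
  case True
  then obtain \<theta> where \<theta>: "\<zeta> = cis \<theta>" by blast
  have "countable (range (\<lambda>n::int. \<theta> + 2 * pi * n))" by simp
  then have "AE t in lebesgue. t \<notin> range (\<lambda>n::int. \<theta> + 2 * pi * n)"
    by (intro AE_not_in null_sets_completionI countable_imp_null_set_lborel)
  then have "AE t in lebesgue. t \<in> {0..2 * pi} \<longrightarrow> cis t \<noteq> \<zeta>"
  proof eventually_elim
    fix t assume t: "t \<notin> range (\<lambda>n::int. \<theta> + 2 * pi * n)"
    show "t \<in> {0..2 * pi} \<longrightarrow> cis t \<noteq> \<zeta>"
    proof (intro impI notI)
      assume "cis t = \<zeta>"
      then have "sin t = sin \<theta> \<and> cos t = cos \<theta>" unfolding \<theta> by (metis cis.sel)
      then show False using t sin_cos_eq_iff by blast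
    qed
  qed
  then show ?thesis by (simp add: AE_restrict_space_iff)
qed auto

text \<open>If \<open>F\<close> vanishes at \<open>\<zeta>\<close>, then \<open>F = s F\<^sub>1\<close> on the circle with \<open>s = \<bar>z - \<zeta>\<bar>\<^sup>2\<close>. The norm of \<open>F - \<epsilon> F\<^sub>1\<close> is
  \<open>\<parallel>F\<parallel> - \<epsilon> \<parallel>F\<^sub>1\<parallel> + o(\<epsilon>)\<close>, so a functional attaining its norm at \<open>F\<close> also attains it at \<open>F\<^sub>1\<close>.\<close>

lemma perturbation_norm_tendsto:
  fixes u s :: "complex \<Rightarrow> real"
  assumes u: "continuous_on (sphere 0 1) u" "\<And>z. u z \<ge> 0"
    and s: "continuous_on (sphere 0 1) s" "\<And>z. s z \<ge> 0" "AE t in circ. s (cis t) \<noteq> 0"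
    and eps: "\<And>n. eps n > 0" "eps \<longlonglongrightarrow> 0"
  shows "(\<lambda>n::nat. \<integral>t. u (cis t) * (2 * eps n / (s (cis t) + eps n)) \<partial>circ) \<longlonglongrightarrow> 0"
proof -
  have pos: "s z + eps n > 0" for z n using s(2)[of z] eps(1)[of n] by linarith
  have "(\<lambda>n. \<integral>t. u (cis t) * (2 * eps n / (s (cis t) + eps n)) \<partial>circ) \<longlonglongrightarrow> (\<integral>t. 0 \<partial>circ)"
  proof (rule integral_dominated_convergence[where w = "\<lambda>t. 2 * u (cis t)"])
    show "integrable circ (\<lambda>t. 2 * u (cis t))" by (intro integrable_mult_right integrable_circ u)
    have "continuous_on (sphere 0 1) (\<lambda>z. u z * (2 * eps n / (s z + eps n)))" for n
      using pos by (intro continuous_intros u s) (simp add: less_imp_neq[symmetric])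
    then show "(\<lambda>t. u (cis t) * (2 * eps n / (s (cis t) + eps n))) \<in> borel_measurable circ" for n
      by (intro borel_measurable_integrable integrable_circ)
    show "AE t in circ. (\<lambda>n. u (cis t) * (2 * eps n / (s (cis t) + eps n))) \<longlonglongrightarrow> 0"
      using s(3)
    proof eventually_elim
      fix t assume "s (cis t) \<noteq> 0"
      then have "(\<lambda>n. u (cis t) * (2 * eps n / (s (cis t) + eps n))) \<longlonglongrightarrow> u (cis t) * (2 * 0 / (s (cis t) + 0))"
        by (intro tendsto_intros eps(2)) auto
      then show "(\<lambda>n. u (cis t) * (2 * eps n / (s (cis t) + eps n))) \<longlonglongrightarrow> 0" by simp
    qed
    show "AE t in circ. norm (u (cis t) * (2 * eps n / (s (cis t) + eps n))) \<le> 2 * u (cis t)" for n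
    proof (rule AE_I2)
      fix t
      have "2 * eps n / (s (cis t) + eps n) \<le> 2" using pos[of "cis t" n] s(2)[of "cis t"] by (simp add: field_simps)
      then have "u (cis t) * (2 * eps n / (s (cis t) + eps n)) \<le> u (cis t) * 2" by (intro mult_left_mono u)
      moreover have "u (cis t) * (2 * eps n / (s (cis t) + eps n)) \<ge> 0"
        using u(2)[of "cis t"] pos[of "cis t" n] eps(1)[of n] by simp
      ultimately show "norm (u (cis t) * (2 * eps n / (s (cis t) + eps n))) \<le> 2 * u (cis t)"
        unfolding real_norm_def by linarith
    qed
  qed simp
  then show ?thesis by simp
qed

text \<open>For \<open>s < e\<close> the claim reduces to \<open>e^2 - s^2 \<le> e^2\<close>. The
  correction factor \<open>2 * e / (s + e)\<close> is at most 2 and tends to 0 with \<open>e\<close>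
  wherever \<open>s > 0\<close>, so after integration the error is of smaller order than
  \<open>e\<close>.\<close>

lemma abs_diff_le_perturbation:
  fixes s e :: real
  assumes "s \<ge> 0" "e > 0"
  shows "\<bar>s - e\<bar> \<le> s - e + e * (2 * e / (s + e))"
proof (cases "s \<ge> e")
  case True
  then show ?thesis using assms by simp
next
  case False
  have "2 * (e - s) * (s + e) \<le> 2 * e * e" using assms by (simp add: algebra_simps)
  then have "2 * (e - s) \<le> 2 * e * e / (s + e)" using assms by (simp add: pos_le_divide_eq)
  then show ?thesis using False by (simp add: mult_ac)
qed

text \<open>The half-space inequality in homogeneous form, for functions of any norm. Scaling by
  \<open>2 * pi / (I + e)\<close> instead of \<open>2 * pi / I\<close> avoids the case
  \<open>I = 0\<close>; at the end \<open>e\<close> tends to 0.\<close>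

lemma value_body_functional_bound:
  fixes \<beta> c :: "complex ^ 'n"
  assumes sub: "value_body \<beta> \<subseteq> {w. Re (\<Sum>k\<in>UNIV. c $ k * w $ k) \<le> d}"
    and \<beta>: "\<And>k. \<beta> $ k \<in> ball 0 1"
    and G: "continuous_on (cball 0 1) G" "G holomorphic_on ball 0 1"
  shows "2 * pi * Re (\<Sum>k\<in>UNIV. c $ k * G (\<beta> $ k)) \<le> d * (\<integral>t. norm (G (cis t)) \<partial>circ)"
proof -
  define I where "I = (\<integral>t. norm (G (cis t)) \<partial>circ)"
  define L where "L = Re (\<Sum>k\<in>UNIV. c $ k * G (\<beta> $ k))"
  have I0: "I \<ge> 0" unfolding I_def by simp
  have bound: "2 * pi * L \<le> d * (I + e)" if e: "e > 0" for e
  proof -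
    define a where "a = 2 * pi / (I + e)"
    have a: "a > 0" using I0 e by (simp add: a_def)
    let ?g = "\<lambda>z. of_real a * G z"
    have g: "continuous_on (cball 0 1) ?g" "?g holomorphic_on ball 0 1"
      by (intro continuous_intros holomorphic_intros G)+
    note D = disc_algebra_hardy1[OF g refl]
    have "hardy1_norm ?g = a * I / (2 * pi)"
      using a by (simp add: D(3) norm_mult I_def)
    also have "\<dots> = I / (I + e)" by (simp add: a_def)
    also have "\<dots> \<le> 1" using I0 e by simp
    finally have "eval_at \<beta> ?g \<in> value_body \<beta>" using D(2) by (auto simp: value_body_def)
    with sub have "Re (\<Sum>k\<in>UNIV. c $ k * eval_at \<beta> ?g $ k) \<le> d" by blast
    moreover have "(\<Sum>k\<in>UNIV. c $ k * eval_at \<beta> ?g $ k) = of_real a * (\<Sum>k\<in>UNIV. c $ k * G (\<beta> $ k))"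
      by (simp add: eval_at_def sum_distrib_left mult_ac)
    ultimately have "a * L \<le> d" by (simp add: L_def)
    then show ?thesis using I0 e by (simp add: a_def field_simps)
  qed
  have "(\<lambda>n. d * (I + inverse (real (Suc n)))) \<longlonglongrightarrow> d * (I + 0)"
    by (intro tendsto_intros LIMSEQ_inverse_real_of_nat)
  then have "2 * pi * L \<le> d * (I + 0)"
    by (rule LIMSEQ_le_const) (use bound in auto)
  then show ?thesis by (simp add: I_def L_def)
qed

lemma no_zeros_if_exposed:
  fixes \<beta> :: "complex ^ 'n" and F :: "complex \<Rightarrow> complex" and q :: "complex poly"
  assumes inj: "inj (\<lambda>k. \<beta> $ k)" and \<beta>: "\<And>k. \<beta> $ k \<in> ball 0 1"
    and F: "F \<in> hardy1" "hardy1_norm F = 1"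
    and deg: "degree q \<le> CARD('n) - 1" and q: "\<And>z. z \<in> ball 0 1 \<Longrightarrow> poly q z \<noteq> 0"
    and F_eq: "\<And>z. z \<in> ball 0 1 \<Longrightarrow> F z = (poly q z)\<^sup>2 * kernel_P \<beta> z"
    and exposed: "eval_at \<beta> F exposed_point_of value_body \<beta>"
    and \<zeta>: "norm \<zeta> = 1"
  shows "poly q \<zeta> \<noteq> 0"
proof
  assume "poly q \<zeta> = 0"
  then obtain q1 where q1: "q = [:-\<zeta>, 1:] * q1" by (metis dvdE poly_eq_0_iff_dvd)
  have q_q1: "poly q z = (z - \<zeta>) * poly q1 z" for z by (simp add: q1 algebra_simps)
  note P = kernel_P_disc_algebra[OF \<beta>]
  obtain c :: "complex ^ 'n" and d where
    sub: "value_body \<beta> \<subseteq> {w. Re (\<Sum>k\<in>UNIV. c $ k * w $ k) \<le> d}" and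
    single: "value_body \<beta> \<inter> {w. Re (\<Sum>k\<in>UNIV. c $ k * w $ k) = d} = {eval_at \<beta> F}"
    using exposed unfolding exposed_point_of_def by blast
  define Fc where "Fc z = (poly q z)\<^sup>2 * kernel_P \<beta> z" for z
  \<comment> \<open>On the circle \<open>(z - \<zeta>)^2 = s z * (- \<zeta> * z)\<close>, so putting
    \<open>- \<zeta> * z\<close> for the double factor of \<open>Fc\<close> divides by
    \<open>s\<close> and keeps the function holomorphic.\<close>
  define F1 where "F1 z = - \<zeta> * z * (poly q1 z)\<^sup>2 * kernel_P \<beta> z" for z
  define s where "s z = (norm (z - \<zeta>))\<^sup>2" for z
  have Fc: "continuous_on (cball 0 1) Fc" "Fc holomorphic_on ball 0 1"
    unfolding Fc_def by (intro continuous_intros holomorphic_intros P)+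
  have F1: "continuous_on (cball 0 1) F1" "F1 holomorphic_on ball 0 1"
    unfolding F1_def by (intro continuous_intros holomorphic_intros P)+
  have F1s: "continuous_on (sphere 0 1) F1" by (rule continuous_on_subset[OF F1(1)]) auto
  have s_cont: "continuous_on (sphere 0 1) s" unfolding s_def by (intro continuous_intros)
  have s0: "s z \<ge> 0" for z by (simp add: s_def)
  have Fc_F1: "Fc z = of_real (s z) * F1 z" if z: "norm z = 1" for z
  proof -
    have zz: "z * cnj z = 1" "\<zeta> * cnj \<zeta> = 1" using z \<zeta> by (simp_all add: complex_norm_square[symmetric])
    have "of_real (s z) * (- \<zeta> * z) = (z - \<zeta>) * (\<zeta> * cnj \<zeta> * z - \<zeta> * (z * cnj z))"
      unfolding s_def complex_norm_square by (simp add: algebra_simps)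
    then have "of_real (s z) * (- \<zeta> * z) = (z - \<zeta>)\<^sup>2" by (simp add: zz power2_eq_square)
    then have "of_real (s z) * F1 z = (z - \<zeta>)\<^sup>2 * (poly q1 z)\<^sup>2 * kernel_P \<beta> z"
      unfolding F1_def by (metis mult.assoc)
    then show ?thesis by (simp add: Fc_def q_q1 power_mult_distrib)
  qed
  define L where "L G = Re (\<Sum>k\<in>UNIV. c $ k * G (\<beta> $ k))" for G
  define I where "I G = (\<integral>t. norm (G (cis t)) \<partial>circ)" for G :: "complex \<Rightarrow> complex"
  have bound: "2 * pi * L G \<le> d * I G" if "continuous_on (cball 0 1) G" "G holomorphic_on ball 0 1" for G
    using value_body_functional_bound[OF sub \<beta> that] by (simp add: L_def I_def)
  have F_Fc: "\<And>z. z \<in> ball 0 1 \<Longrightarrow> F z = Fc z" using F_eq by (simp add: Fc_def)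
  have LFc: "L Fc = d"
  proof -
    have "Re (\<Sum>k\<in>UNIV. c $ k * eval_at \<beta> F $ k) = d" using single by blast
    moreover have "F (\<beta> $ k) = Fc (\<beta> $ k)" for k by (rule F_Fc[OF \<beta>])
    ultimately show ?thesis by (simp add: L_def eval_at_def)
  qed
  have IFc: "I Fc = 2 * pi"
    using disc_algebra_norm[OF Fc F_Fc] F(2) by (simp add: I_def)
  \<comment> \<open>The zero function belongs to the body. The sign is needed to multiply the norm
    estimate of the perturbation by \<open>d\<close>.\<close>
  have d0: "d \<ge> 0"
  proof -
    have "eval_at \<beta> (\<lambda>_. 0) \<in> value_body \<beta>"
      using disc_algebra_hardy1[of "\<lambda>_. 0" "\<lambda>_. 0"] unfolding value_body_def by auto
    with sub have "Re (\<Sum>k\<in>UNIV. c $ k * eval_at \<beta> (\<lambda>_. 0) $ k) \<le> d" by blast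
    then show ?thesis by (simp add: eval_at_def)
  qed
  \<comment> \<open>On the circle \<open>s\<close> is at most \<open>2^2\<close>, so the norm of
    \<open>F1\<close> is at least a quarter of that of \<open>F\<close>; this permits normalizing
    \<open>F1\<close>.\<close>
  have IF1: "I F1 > 0"
  proof -
    have "I Fc \<le> (\<integral>t. 4 * norm (F1 (cis t)) \<partial>circ)"
      unfolding I_def
    proof (rule integral_mono)
      show "integrable circ (\<lambda>t. norm (Fc (cis t)))"
        by (intro integrable_circ continuous_on_norm continuous_on_subset[OF Fc(1)]) auto
      show "integrable circ (\<lambda>t. 4 * norm (F1 (cis t)))"
        by (intro integrable_mult_right integrable_circ continuous_on_norm F1s)
      fix t
      have "norm (cis t - \<zeta>) \<le> 2" using norm_triangle_ineq4[of "cis t" \<zeta>] \<zeta> by simp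
      then have "s (cis t) \<le> 2\<^sup>2" unfolding s_def by (intro power_mono) auto
      then have "s (cis t) * norm (F1 (cis t)) \<le> 4 * norm (F1 (cis t))" by (intro mult_right_mono) auto
      then show "norm (Fc (cis t)) \<le> 4 * norm (F1 (cis t))" using s0 by (simp add: Fc_F1 norm_mult)
    qed
    also have "\<dots> = 4 * I F1" by (simp add: I_def)
    finally show ?thesis using IFc pi_gt_zero by linarith
  qed
  define J where "J e = (\<integral>t. norm (F1 (cis t)) * (2 * e / (s (cis t) + e)) \<partial>circ)" for e
  have perturb: "d * I F1 - d * J e \<le> 2 * pi * L F1" if e: "e > 0" for e
  proof -
    \<comment> \<open>On the circle this is \<open>(s - e) * F1\<close>: where \<open>s > e\<close>,
      subtracting \<open>e * F1\<close> shortens \<open>Fc\<close> by exactly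
      \<open>e * norm F1\<close>.\<close>
    let ?G = "\<lambda>z. Fc z - of_real e * F1 z"
    have pos: "s z + e > 0" for z using s0[of z] e by linarith
    have G: "continuous_on (cball 0 1) ?G" "?G holomorphic_on ball 0 1"
      by (intro continuous_intros holomorphic_intros Fc F1)+
    have i1: "integrable circ (\<lambda>t. norm (Fc (cis t)))"
      by (intro integrable_circ continuous_on_norm continuous_on_subset[OF Fc(1)]) auto
    have i2: "integrable circ (\<lambda>t. norm (F1 (cis t)))" by (intro integrable_circ continuous_on_norm F1s)
    have i3: "integrable circ (\<lambda>t. norm (F1 (cis t)) * (2 * e / (s (cis t) + e)))"
    proof -
      have "continuous_on (sphere 0 1) (\<lambda>z. norm (F1 z) * (2 * e / (s z + e)))"
        using pos by (intro continuous_intros F1s s_cont) (simp add: less_imp_neq[symmetric])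
      then show ?thesis by (rule integrable_circ)
    qed
    have "I ?G \<le> (\<integral>t. norm (Fc (cis t)) - e * norm (F1 (cis t)) + e * (norm (F1 (cis t)) * (2 * e / (s (cis t) + e))) \<partial>circ)"
      unfolding I_def
    proof (rule integral_mono)
      show "integrable circ (\<lambda>t. norm (?G (cis t)))"
        by (intro integrable_circ continuous_on_norm continuous_on_subset[OF G(1)]) auto
      show "integrable circ (\<lambda>t. norm (Fc (cis t)) - e * norm (F1 (cis t)) + e * (norm (F1 (cis t)) * (2 * e / (s (cis t) + e))))"
        by (intro Bochner_Integration.integrable_add Bochner_Integration.integrable_diff integrable_mult_right i1 i2 i3)
      fix t
      have "?G (cis t) = of_real (s (cis t) - e) * F1 (cis t)" by (simp add: Fc_F1 algebra_simps)
      then have "norm (?G (cis t)) = \<bar>s (cis t) - e\<bar> * norm (F1 (cis t))" by (simp only: norm_mult norm_of_real)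
      also have "\<dots> \<le> (s (cis t) - e + e * (2 * e / (s (cis t) + e))) * norm (F1 (cis t))"
        by (intro mult_right_mono abs_diff_le_perturbation s0 e) auto
      also have "\<dots> = s (cis t) * norm (F1 (cis t)) - e * norm (F1 (cis t)) + e * (norm (F1 (cis t)) * (2 * e / (s (cis t) + e)))"
        by (simp add: algebra_simps)
      also have "s (cis t) * norm (F1 (cis t)) = norm (Fc (cis t))" using s0 by (simp add: Fc_F1 norm_mult)
      finally show "norm (?G (cis t)) \<le> norm (Fc (cis t)) - e * norm (F1 (cis t)) + e * (norm (F1 (cis t)) * (2 * e / (s (cis t) + e)))" .
    qed
    also have "\<dots> = I Fc - e * I F1 + e * J e"
    proof -
      have "(\<integral>t. x t - e * y t + e * z t \<partial>circ) = (\<integral>t. x t \<partial>circ) - e * (\<integral>t. y t \<partial>circ) + e * (\<integral>t. z t \<partial>circ)"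
        if "integrable circ x" "integrable circ y" "integrable circ z" for x y z
        using that by simp
      from this[OF i1 i2 i3] show ?thesis unfolding I_def J_def .
    qed
    finally have "I ?G \<le> 2 * pi - e * I F1 + e * J e" by (simp add: IFc)
    then have "d * I ?G \<le> d * (2 * pi - e * I F1 + e * J e)" using d0 by (rule mult_left_mono)
    moreover have "L ?G = d - e * L F1"
      by (simp add: LFc[symmetric] L_def right_diff_distrib sum_subtractf sum_distrib_left mult_ac)
    ultimately have "2 * pi * (d - e * L F1) \<le> d * (2 * pi - e * I F1 + e * J e)"
      using bound[OF G] by simp
    then have "e * (d * I F1 - d * J e) \<le> e * (2 * pi * L F1)" by (simp add: algebra_simps)
    then show ?thesis using e by simp
  qed
  \<comment> \<open>The upper bound holds throughout the disc algebra; the lower one is the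
    perturbation inequality as \<open>e\<close> tends to 0.\<close>
  have "2 * pi * L F1 = d * I F1"
  proof (rule antisym)
    show "2 * pi * L F1 \<le> d * I F1" by (rule bound[OF F1])
    have "AE t in circ. s (cis t) \<noteq> 0" using AE_cis_neq[of \<zeta>] by eventually_elim (simp add: s_def)
    then have "(\<lambda>n. J (inverse (real (Suc n)))) \<longlonglongrightarrow> 0"
      unfolding J_def by (intro perturbation_norm_tendsto continuous_on_norm F1s s_cont s0 LIMSEQ_inverse_real_of_nat) auto
    then have "(\<lambda>n. d * I F1 - d * J (inverse (real (Suc n)))) \<longlonglongrightarrow> d * I F1 - d * 0"
      by (intro tendsto_intros)
    then have "d * I F1 - d * 0 \<le> 2 * pi * L F1"
      by (rule LIMSEQ_le_const2) (use perturb in auto)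
    then show "d * I F1 \<le> 2 * pi * L F1" by simp
  qed
  define lam where "lam = 2 * pi / I F1"
  have lam: "lam > 0" using IF1 by (simp add: lam_def)
  let ?g = "\<lambda>z. of_real lam * F1 z"
  have g: "continuous_on (cball 0 1) ?g" "?g holomorphic_on ball 0 1"
    by (intro continuous_intros holomorphic_intros F1)+
  note D = disc_algebra_hardy1[OF g refl]
  have "hardy1_norm ?g = lam * I F1 / (2 * pi)" using lam by (simp add: D(3) norm_mult I_def)
  also have "\<dots> = 1" using IF1 by (simp add: lam_def)
  finally have "eval_at \<beta> ?g \<in> value_body \<beta>" using D(2) by (auto simp: value_body_def)
  moreover have "Re (\<Sum>k\<in>UNIV. c $ k * eval_at \<beta> ?g $ k) = d"
  proof -
    have "(\<Sum>k\<in>UNIV. c $ k * eval_at \<beta> ?g $ k) = of_real lam * (\<Sum>k\<in>UNIV. c $ k * F1 (\<beta> $ k))"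
      by (simp add: eval_at_def sum_distrib_left mult_ac)
    then have "Re (\<Sum>k\<in>UNIV. c $ k * eval_at \<beta> ?g $ k) = lam * L F1" by (simp add: L_def)
    also have "\<dots> = d" using \<open>2 * pi * L F1 = d * I F1\<close> IF1 by (simp add: lam_def field_simps)
    finally show ?thesis .
  qed
  ultimately have same: "eval_at \<beta> ?g = eval_at \<beta> F" using single by blast
  \<comment> \<open>Equal values at \<beta>_k, after cancelling the common nonzero factor, put every
    \<beta>_k among the roots of one monic quadratic with constant term
    \<open>\<zeta>^2\<close>.\<close>
  have root: "(\<beta> $ k - \<zeta>)\<^sup>2 = - of_real lam * \<zeta> * \<beta> $ k" for k
  proof -
    have "of_real lam * F1 (\<beta> $ k) = Fc (\<beta> $ k)"
      using same F_Fc[OF \<beta>, of k] by (simp add: eval_at_def vec_eq_iff)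
    moreover have "poly q1 (\<beta> $ k) \<noteq> 0" using q[OF \<beta>, of k] by (simp add: q_q1)
    moreover have "kernel_P \<beta> (\<beta> $ k) \<noteq> 0" using \<beta>[of k] by (intro P(3)) auto
    ultimately have nz: "(poly q1 (\<beta> $ k))\<^sup>2 * kernel_P \<beta> (\<beta> $ k) \<noteq> 0"
      and "(\<beta> $ k - \<zeta>)\<^sup>2 * ((poly q1 (\<beta> $ k))\<^sup>2 * kernel_P \<beta> (\<beta> $ k))
        = (- of_real lam * \<zeta> * \<beta> $ k) * ((poly q1 (\<beta> $ k))\<^sup>2 * kernel_P \<beta> (\<beta> $ k))"
      by (simp_all add: F1_def Fc_def q_q1 power_mult_distrib mult.assoc)
    then show ?thesis using mult_right_cancel by blast
  qed
  \<comment> \<open>A zero on the circle makes \<open>q\<close> nonconstant, and the degree bound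
    then provides two evaluation points.\<close>
  have "q1 \<noteq> 0" using q[of 0] by (auto simp: q1)
  then have "degree q = Suc (degree q1)" unfolding q1 by (subst degree_mult_eq) auto
  then have "CARD('n) \<ge> 2" using deg by simp
  then obtain i j :: 'n where "i \<noteq> j" by (metis card_2_iff' ex_card UNIV_I)
  then have ij: "\<beta> $ i \<noteq> \<beta> $ j" using inj by (auto dest: injD)
  \<comment> \<open>Vieta's formula: eliminating \<open>lam\<close> from the two equations shows
    that two distinct roots have product \<open>\<zeta>^2\<close>, of modulus 1.\<close>
  have "(\<beta> $ i - \<beta> $ j) * (\<beta> $ i * \<beta> $ j - \<zeta>\<^sup>2) = 0"
  proof -
    have "(\<beta> $ i - \<beta> $ j) * (\<beta> $ i * \<beta> $ j - \<zeta>\<^sup>2) = \<beta> $ j * (\<beta> $ i - \<zeta>)\<^sup>2 - \<beta> $ i * (\<beta> $ j - \<zeta>)\<^sup>2"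
      by (simp add: power2_eq_square algebra_simps)
    also have "\<dots> = 0" by (simp add: root mult_ac)
    finally show ?thesis .
  qed
  then have "\<beta> $ i * \<beta> $ j = \<zeta>\<^sup>2" using ij by simp
  then have "norm (\<beta> $ i) * norm (\<beta> $ j) = 1" using \<zeta> by (metis norm_mult norm_power one_power2)
  moreover have "norm (\<beta> $ i) * norm (\<beta> $ j) < 1 * 1"
    using \<beta>[of i] \<beta>[of j] by (intro mult_strict_mono') auto
  ultimately show False by simp
qed

theorem theorem4:
  fixes \<beta> :: "complex ^ 'n"
    and F :: "complex \<Rightarrow> complex"
    and q :: "complex poly"
  assumes "inj (\<lambda>k. \<beta> $ k)"
    and "\<And>k. \<beta> $ k \<in> ball 0 1"
    and "\<And>k. \<beta> $ k \<noteq> 0"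
    and "F \<in> hardy1"
    and "hardy1_norm F = 1"
    and "eval_at \<beta> F \<in> frontier (value_body \<beta>)"
    and "eval_at \<beta> F extreme_point_of value_body \<beta>"
    and "degree q \<le> CARD('n) - 1"
    and "\<And>z. z \<in> ball 0 1 \<Longrightarrow> poly q z \<noteq> 0"
    and "\<And>z. z \<in> ball 0 1 \<Longrightarrow> F z = (poly q z) ^ 2 * kernel_P \<beta> z"
  shows "eval_at \<beta> F exposed_point_of value_body \<beta> \<longleftrightarrow>
         (\<forall>z \<in> sphere 0 1. poly q z \<noteq> 0)"
proof
  assume "eval_at \<beta> F exposed_point_of value_body \<beta>"
  then show "\<forall>z\<in>sphere 0 1. poly q z \<noteq> 0"
    using no_zeros_if_exposed[OF assms(1,2,4,5,8-10)] by simp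
next
  assume "\<forall>z\<in>sphere 0 1. poly q z \<noteq> 0"
  then have "poly q z \<noteq> 0" if "z \<in> cball 0 1" for z
    using assms(9)[of z] that by (cases "norm z = 1") auto
  then show "eval_at \<beta> F exposed_point_of value_body \<beta>"
    by (rule exposed_if_no_zeros[OF assms(1,2,4,5,8) _ assms(10)])
qed

end
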